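(* Let $K$ be a field of characteristic zero, let $V$ be a $K$-vector space, and let $\mathfrak{g}=(V,[\,,])$ and $\mathfrak{n}=(V,\{\,,\})$ be two Lie algebra structures on $V$, where $\mathfrak{g}$ is semisimple and $\mathfrak{n}$ is complete. Let $(V,\cdot)$ be a post-Lie algebra structure on the pair $(\mathfrak{g},\mathfrak{n})$. Then $\mathfrak{n}$ is semisimple.
   Context: Lie algebras are finite-dimensional. A Lie algebra is complete if its center is zero and all its derivations are inner. Given two Lie brackets $\mathfrak{g}=(V,[\,,])$ and $\mathfrak{n}=(V,\{\,,\})$ on the same $K$-vector space $V$, a post-Lie algebra structure on the pair $(\mathfrak{g},\mathfrak{n})$ is a $K$-bilinear product $x\cdot y$ on $V$ such that for all $x,y,z\in V$: (1) $x\cdot y-y\cdot x=[x,y]-\{x,y\}$; (2) $[x,y]\cdot z=x\cdot(y\cdot z)-y\cdot(x\cdot z)$; (3) $x\cdot\{y,z\}=\{x\cdot y,z\}+\{y,x\cdot z\}$. *)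

theory Defs
  imports Complex_Main
begin

definition bilinear_product ::
  "('k::field \<Rightarrow> 'v::ab_group_add \<Rightarrow> 'v) \<Rightarrow> ('v \<Rightarrow> 'v \<Rightarrow> 'v) \<Rightarrow> bool"
  where "bilinear_product scale p \<longleftrightarrow>
    (\<forall>y. Vector_Spaces.linear scale scale (\<lambda>x. p x y)) \<and>
    (\<forall>x. Vector_Spaces.linear scale scale (\<lambda>y. p x y))"

text \<open>The underlying vector space is the whole type \<open>'v\<close> with scalar multiplication
  \<open>scale\<close>. Lie algebras are finite-dimensional by convention.\<close>

locale lie_algebra = vector_space scale
  for scale :: "'k::field \<Rightarrow> 'v::ab_group_add \<Rightarrow> 'v" +
  fixes br :: "'v \<Rightarrow> 'v \<Rightarrow> 'v"
  assumes finite_dim: "\<exists>B. finite B \<and> span B = UNIV"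
    and bilinear: "bilinear_product scale br"
    and alternating: "br x x = 0"
    and jacobi: "br x (br y z) + br y (br z x) + br z (br x y) = 0"
begin

definition lie_ideal :: "'v set \<Rightarrow> bool"
  where "lie_ideal I \<longleftrightarrow> subspace I \<and> (\<forall>x. \<forall>y\<in>I. br x y \<in> I)"

definition derived :: "'v set \<Rightarrow> 'v set"
  where "derived S = span {br x y | x y. x \<in> S \<and> y \<in> S}"

definition solvable :: "'v set \<Rightarrow> bool"
  where "solvable S \<longleftrightarrow> (\<exists>k. (derived ^^ k) S = {0})"

text \<open>The sum of all solvable ideals; in finite dimension this is the largest solvable ideal.\<close>

definition radical :: "'v set"
  where "radical = span (\<Union>{I. lie_ideal I \<and> solvable I})"

text \<open>With this convention the zero Lie algebra is semisimple.\<close>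

definition semisimple :: bool
  where "semisimple \<longleftrightarrow> radical = {0}"

definition center :: "'v set"
  where "center = {z. \<forall>x. br z x = 0}"

definition derivation :: "('v \<Rightarrow> 'v) \<Rightarrow> bool"
  where "derivation D \<longleftrightarrow> Vector_Spaces.linear scale scale D \<and>
    (\<forall>x y. D (br x y) = br (D x) y + br x (D y))"

definition inner_derivation :: "('v \<Rightarrow> 'v) \<Rightarrow> bool"
  where "inner_derivation D \<longleftrightarrow> (\<exists>z. \<forall>x. D x = br z x)"

definition complete :: bool
  where "complete \<longleftrightarrow> center = {0} \<and> (\<forall>D. derivation D \<longrightarrow> inner_derivation D)"

end

locale post_lie_algebra =
  g: lie_algebra scale brg + n: lie_algebra scale brn
  for scale :: "'k::field \<Rightarrow> 'v::ab_group_add \<Rightarrow> 'v"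
    and brg brn :: "'v \<Rightarrow> 'v \<Rightarrow> 'v" +
  fixes prod :: "'v \<Rightarrow> 'v \<Rightarrow> 'v"
  assumes prod_bilinear: "bilinear_product scale prod"
    and prod_commutator: "prod x y - prod y x = brg x y - brn x y"
    and prod_bracket: "prod (brg x y) z = prod x (prod y z) - prod y (prod x z)"
    and prod_derivation: "prod x (brn y z) = brn (prod x y) z + brn y (prod x z)"

end

theory Submission
imports Defs "HOL-Algebra.Algebraic_Closure_Type" "Jordan_Normal_Form.Jordan_Normal_Form_Existence"
  "Jordan_Normal_Form.DL_Rank" "HOL-Library.Function_Algebras"
begin

text \<open>
  Since \<open>n\<close> is complete, \<open>x \<cdot> y = {\<phi> x, y}\<close> for a linear map \<open>\<phi>\<close>, and both \<open>\<phi>\<close> and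
  \<open>\<psi> = \<phi> + id\<close> are homomorphisms from \<open>g\<close> to \<open>n\<close>. As \<open>g\<close> is perfect, so is
  \<open>n = \<phi>(g) + \<psi>(g)\<close>, and therefore the radical \<open>r\<close> of \<open>n\<close> acts nilpotently.

  There is a Levi projection \<open>\<tau>\<close> of \<open>n\<close> with kernel \<open>r\<close> that fixes \<open>\<phi>(g)\<close>, and by Malcev's
  argument \<open>\<psi> = exp(ad w) \<circ> \<tau> \<circ> \<psi>\<close> for some \<open>w\<close> in \<open>r\<close>. For \<open>x\<close> in \<open>r\<close> the difference
  \<open>\<psi> x - \<phi> x = x\<close> is killed by \<open>\<tau>\<close>, so that \<open>x = exp(ad w)(\<phi> x) - \<phi> x\<close>. Hence
  \<open>x \<mapsto> {\<phi> x, w}\<close> is minus a unipotent operator on \<open>r\<close> and has trace \<open>-dim r\<close>.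
  On the other hand \<open>[w, x] = {\<psi> w, x} - {\<phi> x, w}\<close>, and perfectness of \<open>g\<close> and \<open>n\<close> forces this
  trace to vanish. So \<open>r = 0\<close>.

  The Levi and Malcev steps are successive approximations along a chain of ideals on whose
  layers \<open>r\<close> acts trivially; the obstructions are cocycles, which are coboundaries by Whitehead's
  lemmas for the semisimple algebras \<open>g\<close> and \<open>n/r\<close>.
\<close>

section \<open>Linear operators on a finite-dimensional space\<close>

text \<open>The field need not be algebraically closed, so eigenvectors and Lie's theorem are out of
  reach. Nilpotency is read off traces instead: an operator \<open>f\<close> is nilpotent as soon as
  tr (f d) = 0 for all \<open>d\<close> that commute with everything commuting with
  \<open>f\<close>, and perfectness makes such traces vanish. Eigenvalues enter only in Cartan's
  criterion, over an algebraic closure.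

  Quotients are avoided as well, since a Lie algebra has to fill its type. A statement about n/r
  becomes one about maps on n that kill \<open>r\<close>, with identities holding modulo
  \<open>r\<close>. The locale \<open>lie_radical\<close> thus proves Whitehead's lemmas once, for g
  with \<open>{0}\<close> as radical and for n/r.

  The crux is that the Levi factor can be chosen to contain \<phi>(g). An arbitrary one would leave
  \<psi> x - \<phi> x unrelated to \<phi> x; this one expresses it through \<phi> x and a single
  \<open>w\<close>. Characteristic zero then lets a vanishing trace, which counts the dimension of
  \<open>r\<close>, force \<open>r\<close> itself to vanish.\<close>

locale fin_dim_space = finite_dimensional_vector_space scale Basis
  for scale :: "'k::field_char_0 \<Rightarrow> 'v::ab_group_add \<Rightarrow> 'v" and Basis :: "'v set"
begin

sublocale endo: finite_dimensional_vector_space_pair scale Basis scale Basis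
  by unfold_locales

abbreviation lin :: "('v \<Rightarrow> 'v) \<Rightarrow> bool"
  where "lin \<equiv> Vector_Spaces.linear scale scale"

lemma linI:
  assumes "\<And>x y. f (x + y) = f x + f y" "\<And>c x. f (scale c x) = scale c (f x)"
  shows "lin f"
  using assms vector_space_axioms by (auto simp add: Vector_Spaces.linear_iff)

lemma lin_addD: "lin f \<Longrightarrow> f (x + y) = f x + f y"
  and lin_scaleD: "lin f \<Longrightarrow> f (scale c x) = scale c (f x)"
  and lin_zeroD: "lin f \<Longrightarrow> f 0 = 0"
  and lin_diffD: "lin f \<Longrightarrow> f (x - y) = f x - f y"
  and lin_minusD: "lin f \<Longrightarrow> f (- x) = - f x"
  and lin_sumD: "lin f \<Longrightarrow> f (sum h A) = (\<Sum>a\<in>A. f (h a))"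
  by (simp_all add: endo.linear_add endo.linear_scale endo.linear_0 endo.linear_diff
      endo.linear_neg endo.linear_sum)

lemma lin_add: "lin f \<Longrightarrow> lin g \<Longrightarrow> lin (\<lambda>x. f x + g x)"
  by (rule endo.linear_compose_add)

lemma lin_diff: "lin f \<Longrightarrow> lin g \<Longrightarrow> lin (\<lambda>x. f x - g x)"
  by (rule endo.linear_compose_sub)

lemma lin_minus: "lin f \<Longrightarrow> lin (\<lambda>x. - f x)"
  by (rule endo.linear_compose_neg)

lemma lin_scale: "lin f \<Longrightarrow> lin (\<lambda>x. scale c (f x))"
  by (rule endo.linear_compose_scale_right)

lemma lin_sum: "(\<And>a. a \<in> A \<Longrightarrow> lin (f a)) \<Longrightarrow> lin (\<lambda>x. \<Sum>a\<in>A. f a x)"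
  by (rule endo.linear_compose_sum) auto

lemma lin_comp: "lin f \<Longrightarrow> lin g \<Longrightarrow> lin (\<lambda>x. f (g x))"
  using Vector_Spaces.linear_compose[of scale scale g scale f] by (simp add: o_def)

lemma lin_comp': "lin f \<Longrightarrow> lin g \<Longrightarrow> lin (f \<circ> g)"
  by (rule Vector_Spaces.linear_compose)

lemma lin_id: "lin (\<lambda>x. x)"
  by (rule linI) auto

lemma lin_0: "lin (\<lambda>x. 0)"
  by (rule linI) auto

lemma lin_funpow: "lin f \<Longrightarrow> lin (f ^^ k)"
  by (induction k) (auto intro: lin_comp' lin_id simp: id_def)

lemmas lin_intros = lin_add lin_diff lin_minus lin_scale lin_sum lin_id lin_0 lin_funpow

lemma lin_span_mem:
  assumes "lin f" "\<And>s. s \<in> S \<Longrightarrow> f s \<in> T" "subspace T" "x \<in> span S"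
  shows "f x \<in> T"
proof -
  have "subspace {x. f x \<in> T}"
    using assms(1,3) by (auto simp: subspace_def lin_addD lin_scaleD lin_zeroD)
  from span_induct[OF assms(4) this] assms(2) show ?thesis by blast
qed

lemma subspace_vimage: "lin f \<Longrightarrow> subspace T \<Longrightarrow> subspace {x. f x \<in> T}"
  by (auto simp: subspace_def lin_addD lin_scaleD lin_zeroD)

lemma subspace_image: "lin f \<Longrightarrow> subspace T \<Longrightarrow> subspace (f ` T)"
  by (rule endo.linear_subspace_image)

subsection \<open>Traces\<close>

text \<open>The basis is a parameter because the trace of a projection is evaluated in a basis
  adapted to its range.\<close>

definition tr_on :: "'v set \<Rightarrow> ('v \<Rightarrow> 'v) \<Rightarrow> 'k"
  where "tr_on B f = (\<Sum>b\<in>B. representation B (f b) b)"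

definition tr :: "('v \<Rightarrow> 'v) \<Rightarrow> 'k" where "tr = tr_on Basis"

lemma lin_rep:
  assumes "independent B" "span B = UNIV"
  shows "representation B (x + y) b = representation B x b + representation B y b"
    and "representation B (scale c x) b = c * representation B x b"
    and "representation B (sum h A) b = (\<Sum>a\<in>A. representation B (h a) b)"
    and "representation B 0 b = 0"
  using assms by (simp_all add: representation_add representation_scale representation_sum
      representation_zero)

lemma rep_expand:
  assumes "independent B" "span B = UNIV"
  shows "(\<Sum>b\<in>B. scale (representation B x b) b) = x"
  using sum_representation_eq[of B x B] assms finiteI_independent by auto

lemma rep_lin:
  assumes "independent B" "span B = UNIV" "lin f"
  shows "representation B (f x) b = (\<Sum>c\<in>B. representation B x c * representation B (f c) b)"
proof -
  have "f x = f (\<Sum>c\<in>B. scale (representation B x c) c)"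
    using rep_expand[OF assms(1,2)] by simp
  also have "\<dots> = (\<Sum>c\<in>B. scale (representation B x c) (f c))"
    using assms(3) by (simp add: lin_sumD lin_scaleD)
  finally show ?thesis by (simp add: lin_rep[OF assms(1,2)])
qed

lemma basis_indep: "independent Basis" and basis_span: "span Basis = UNIV"
  and basis_fin: "finite Basis"
  by (simp_all add: independent_Basis span_Basis finite_Basis)

lemma tr_on_change:
  assumes B: "independent B" "span B = UNIV" and B': "independent B'" "span B' = UNIV"
    and f: "lin f"
  shows "tr_on B f = tr_on B' f"
proof -
  have "tr_on B f = (\<Sum>b\<in>B. \<Sum>c\<in>B'. representation B' (f b) c * representation B c b)"
    unfolding tr_on_def
  proof (rule sum.cong[OF refl])
    fix b assume "b \<in> B"
    have "representation B (f b) b = representation B (\<Sum>c\<in>B'. scale (representation B' (f b) c) c) b"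
      using rep_expand[OF B'] by simp
    then show "representation B (f b) b = (\<Sum>c\<in>B'. representation B' (f b) c * representation B c b)"
      by (simp add: lin_rep[OF B])
  qed
  also have "\<dots> = (\<Sum>c\<in>B'. \<Sum>b\<in>B. representation B c b * representation B' (f b) c)"
    by (subst sum.swap) (simp add: mult.commute)
  also have "\<dots> = (\<Sum>c\<in>B'. representation B' (\<Sum>b\<in>B. scale (representation B c b) (f b)) c)"
    by (simp add: lin_rep[OF B'])
  also have "\<dots> = (\<Sum>c\<in>B'. representation B' (f (\<Sum>b\<in>B. scale (representation B c b) b)) c)"
    using f by (simp add: lin_sumD lin_scaleD)
  also have "\<dots> = tr_on B' f"
    unfolding tr_on_def using rep_expand[OF B] by simp
  finally show ?thesis .
qed

lemma tr_add: "tr (\<lambda>x. f x + g x) = tr f + tr g"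
  and tr_scale: "tr (\<lambda>x. scale c (f x)) = c * tr f"
  and tr_0: "tr (\<lambda>x. 0) = 0"
  unfolding tr_def tr_on_def
  by (simp_all add: lin_rep[OF basis_indep basis_span] sum.distrib sum_distrib_left)

lemma tr_minus: "tr (\<lambda>x. - f x) = - tr f"
  using tr_scale[of "-1" f] by simp

lemma tr_diff: "tr (\<lambda>x. f x - g x) = tr f - tr g"
  using tr_add[of f "\<lambda>x. - g x"] tr_minus[of g] by simp

lemma tr_sum: "finite A \<Longrightarrow> tr (\<lambda>x. \<Sum>a\<in>A. f a x) = (\<Sum>a\<in>A. tr (f a))"
  by (induction A rule: finite_induct) (simp_all add: tr_0 tr_add)

lemma tr_comm:
  assumes "lin f" "lin g"
  shows "tr (\<lambda>x. f (g x)) = tr (\<lambda>x. g (f x))"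
proof -
  note B = basis_indep basis_span
  have "tr (\<lambda>x. f (g x)) = (\<Sum>b\<in>Basis. \<Sum>c\<in>Basis. representation Basis (g b) c * representation Basis (f c) b)"
    unfolding tr_def tr_on_def by (intro sum.cong refl) (simp add: rep_lin[OF B assms(1), of "g _"])
  also have "\<dots> = (\<Sum>c\<in>Basis. \<Sum>b\<in>Basis. representation Basis (f c) b * representation Basis (g b) c)"
    by (subst sum.swap) (simp add: mult.commute)
  also have "\<dots> = tr (\<lambda>x. g (f x))"
    unfolding tr_def tr_on_def by (intro sum.cong refl) (simp add: rep_lin[OF B assms(2), of "f _"])
  finally show ?thesis .
qed

subsection \<open>Projections\<close>

lemma projection_exists:
  assumes "subspace U"
  obtains p where "lin p" "\<And>v. p v \<in> U" "\<And>u. u \<in> U \<Longrightarrow> p u = u"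
proof -
  from endo.linear_exists_left_inverse_on[OF lin_id assms]
  obtain g where "g ` UNIV \<subseteq> U" "lin g" "\<forall>v\<in>U. g v = v" by (auto simp: inj_on_def)
  then show thesis by (intro that[of g]) auto
qed

text \<open>Project to \<open>U\<close>, then remove the \<open>W\<close>-component. The range of
  \<open>q\<close> is a complement of \<open>W\<close> in \<open>U\<close>, a copy of U/W inside the
  space.\<close>

lemma subquotient_projection:
  assumes U: "subspace U" and W: "subspace W" and WU: "W \<subseteq> U"
  obtains q where "lin q" "\<And>v. q v \<in> U" "\<And>w. w \<in> W \<Longrightarrow> q w = 0" "\<And>u. u \<in> U \<Longrightarrow> u - q u \<in> W"
    "\<And>v. q (q v) = q v"
proof -
  obtain p where p: "lin p" "\<And>v. p v \<in> U" "\<And>u. u \<in> U \<Longrightarrow> p u = u"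
    by (rule projection_exists[OF U]) blast
  obtain s where s: "lin s" "\<And>v. s v \<in> W" "\<And>u. u \<in> W \<Longrightarrow> s u = u"
    by (rule projection_exists[OF W]) blast
  define q where "q v = p v - s (p v)" for v
  have l: "lin q" unfolding q_def by (intro lin_intros lin_comp[OF s(1) p(1)] p(1))
  have qU: "q v \<in> U" for v
    unfolding q_def using p(2) s(2) WU U by (intro subspace_diff) auto
  have q0: "q w = 0" if "w \<in> W" for w
    using that WU p(3)[of w] s(3)[of w] unfolding q_def by auto
  have qW: "u - q u \<in> W" if "u \<in> U" for u
    unfolding q_def using that p(3)[of u] s(2) by auto
  have qq: "q (q v) = q v" for v
  proof -
    have "s (q v) = 0" unfolding q_def using s(2,3) by (simp add: lin_diffD[OF s(1)])
    then show ?thesis using p(3)[OF qU, of v] by (simp add: q_def[of "q v"])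
  qed
  show thesis using that[OF l qU q0 qW qq] .
qed

text \<open>With \<open>p\<close> a projection onto the kernel of \<open>f\<close>, the operator g =
  f - p f has the same trace, because tr (p f) = tr (f p) = 0. A power of \<open>f\<close> landing
  in the kernel is killed by 1 - p, so \<open>g\<close> has smaller nilpotency index.\<close>

lemma tr_nilpotent:
  assumes "lin f" "\<And>x. (f ^^ k) x = 0"
  shows "tr f = 0"
  using assms
proof (induction k arbitrary: f)
  case 0
  then have "f = (\<lambda>x. 0)" by (auto simp: fun_eq_iff)
  then show ?case by (simp add: tr_0)
next
  case (Suc k)
  note f = Suc.prems(1) and prems0 = Suc.prems(2) and IH0 = Suc.IH
  have "subspace {x. f x = 0}"
    using subspace_vimage[OF f subspace_single_0] by simp
  then obtain p where p: "lin p" "\<And>v. f (p v) = 0" "\<And>u. f u = 0 \<Longrightarrow> p u = u"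
    by (rule projection_exists) blast
  define g where "g x = f x - p (f x)" for x
  have g: "lin g" unfolding g_def by (intro lin_intros lin_comp[OF p(1) f] f)
  have pw: "(g ^^ Suc j) x = (f ^^ Suc j) x - p ((f ^^ Suc j) x)" for j x
  proof (induction j)
    case 0 show ?case by (simp add: g_def)
  next
    case (Suc j)
    have "(g ^^ Suc (Suc j)) x = g ((f ^^ Suc j) x - p ((f ^^ Suc j) x))"
      using Suc by simp
    also have "\<dots> = f ((f ^^ Suc j) x) - p (f ((f ^^ Suc j) x))"
      unfolding g_def by (simp add: lin_diffD[OF f] lin_diffD[OF p(1)] p(2))
    finally show ?case by simp
  qed
  show ?case
  proof (cases k)
    case 0
    then have "f = (\<lambda>x. 0)" using prems0 by (auto simp: fun_eq_iff)
    then show ?thesis by (simp add: tr_0)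
  next
    case (Suc j)
    have gk: "(g ^^ k) x = 0" for x
    proof -
      have "f ((f ^^ Suc j) x) = 0" using prems0[of x] Suc by simp
      then show ?thesis using pw[of j x] p(3) Suc by simp
    qed
    have "tr f = tr (\<lambda>x. f x - f (p x))" by (simp add: p(2))
    also have "\<dots> = tr f - tr (\<lambda>x. p (f x))"
      using tr_comm[OF f p(1)] by (simp add: tr_diff)
    also have "\<dots> = tr g" unfolding g_def by (simp add: tr_diff)
    finally show ?thesis using IH0[OF g gk] by simp
  qed
qed

text \<open>In a basis extending one of the range, the trace counts the basis vectors of the range,
  and characteristic zero lets this number be recovered.\<close>

lemma tr_idempotent_eq_0:
  assumes e: "lin e" and ee: "\<And>x. e (e x) = e x" and t: "tr e = 0"
  shows "e x = 0"
proof -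
  obtain B1 where B1: "B1 \<subseteq> range e" "independent B1" "range e \<subseteq> span B1"
    by (rule basis_exists[of "range e"]) blast
  obtain B where B: "B1 \<subseteq> B" "independent B" "UNIV \<subseteq> span B"
    using maximal_independent_subset_extend[OF _ B1(2), of UNIV] by auto
  have sB: "span B = UNIV" using B(3) by auto
  have fin: "finite B" "finite B1" using B(2) B1(2) finiteI_independent by auto
  have r: "representation B (e b) b = (if b \<in> B1 then 1 else 0)" if "b \<in> B" for b
  proof (cases "b \<in> B1")
    case True
    then have "e b = b" using B1(1) ee by auto
    then show ?thesis using True that B(2) by (simp add: representation_basis)
  next
    case False
    have "e b \<in> span B1" using B1(3) by auto
    then have "representation B (e b) = representation B1 (e b)"
      using representation_extend[OF B(2)] B(1) by blast
    moreover have "representation B1 (e b) b = 0"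
      using False representation_ne_zero by blast
    ultimately show ?thesis using False by simp
  qed
  have "tr e = tr_on B e"
    unfolding tr_def by (rule tr_on_change[OF basis_indep basis_span B(2) sB e])
  also have "\<dots> = (\<Sum>b\<in>B. if b \<in> B1 then 1 else 0)"
    unfolding tr_on_def using r by (intro sum.cong) auto
  also have "\<dots> = of_nat (card B1)"
    using fin B(1) by (simp add: sum.If_cases Int_absorb1)
  finally have "card B1 = 0" using t by simp
  then have "range e \<subseteq> {0}" using fin B1(3) by simp
  then show ?thesis by auto
qed

subsection \<open>Fitting decomposition\<close>

lemma mono_bounded_stable:
  fixes a :: "nat \<Rightarrow> nat"
  assumes "\<And>j. a j \<le> a (Suc j)" "\<And>j. a j \<le> N"
  obtains k where "a (Suc k) = a k"
proof (rule ccontr)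
  assume "\<not> thesis"
  then have "a j < a (Suc j)" for j using assms(1)[of j] that[of j] by fastforce
  then have "strict_mono a" by (simp add: strict_mono_Suc_iff)
  then have "Suc N \<le> a (Suc N)" by (rule strict_mono_imp_increasing)
  then show False using assms(2)[of "Suc N"] by simp
qed

text \<open>The space splits into the kernel of a high power of \<open>f\<close> and its range, on
  which \<open>f\<close> is bijective. \<open>d\<close> inverts \<open>f\<close> on the range and
  vanishes on the kernel, so \<open>f d\<close> is the projection to the range. Whatever commutes
  with \<open>f\<close> preserves both summands and hence commutes with \<open>d\<close>.\<close>

lemma fitting:
  assumes f: "lin f"
  obtains d k where "lin d" "\<And>h x. lin h \<Longrightarrow> (\<And>y. h (f y) = f (h y)) \<Longrightarrow> h (d x) = d (h x)"
    "\<And>x. f (d (f (d x))) = f (d x)" "\<And>x. (f ^^ k) (f (d x)) = (f ^^ k) x"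
proof -
  define K I where "K j = {x. (f ^^ j) x = 0}" and "I j = range (f ^^ j)" for j
  have fl: "lin (f ^^ j)" for j using f by (rule lin_funpow)
  have sK: "subspace (K j)" for j
    unfolding K_def using subspace_vimage[OF fl subspace_single_0] by simp
  have sI: "subspace (I j)" for j
    unfolding I_def using subspace_image[OF fl subspace_UNIV] .
  have Kmono: "K j \<subseteq> K (Suc j)" for j
    unfolding K_def by (auto simp: lin_zeroD[OF f])
  have Imono: "I (Suc j) \<subseteq> I j" for j
    unfolding I_def funpow_Suc_right by auto
  \<comment> \<open>Kernels grow and ranges shrink; adding the codimension of the range gives one
    monotone sequence whose stability at \<open>k\<close> settles both.\<close>
  define a where "a j = dim (K j) + (dimension - dim (I j))" for j
  have "a j \<le> a (Suc j)" for j
    unfolding a_def by (intro add_mono diff_le_mono2 dim_subset Kmono Imono)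
  moreover have "a j \<le> dimension + dimension" for j
    unfolding a_def using dim_subset_UNIV[of "K j"] by linarith
  ultimately obtain k where "a (Suc k) = a k" by (rule mono_bounded_stable)
  moreover have "dim (K k) \<le> dim (K (Suc k))" "dim (I (Suc k)) \<le> dim (I k)"
    by (intro dim_subset Kmono Imono)+
  moreover have "dim (I k) \<le> dimension" by (rule dim_subset_UNIV)
  ultimately have "dim (K (Suc k)) \<le> dim (K k)" "dim (I k) \<le> dim (I (Suc k))"
    unfolding a_def by linarith+
  then have Keq: "K (Suc k) = K k" and Ieq: "I (Suc k) = I k"
    using subspace_dim_equal[OF sK sK Kmono, of k] subspace_dim_equal[OF sI sI Imono, of k] by auto
  have fI: "f x \<in> I k" if x: "x \<in> I k" for x
  proof -
    obtain z where "x = (f ^^ k) z" using x unfolding I_def by auto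
    then have "f x = (f ^^ Suc k) z" by simp
    then show ?thesis using Ieq unfolding I_def by blast
  qed
  have inj: "x = 0" if x: "x \<in> I k" "f x = 0" for x
  proof -
    obtain z where z: "x = (f ^^ k) z" using x unfolding I_def by auto
    then have "z \<in> K (Suc k)" using x unfolding K_def by simp
    then have "z \<in> K k" using Keq by simp
    then show ?thesis using z unfolding K_def by simp
  qed
  have "inj_on f (I k)"
  proof (rule inj_onI)
    fix x y assume "x \<in> I k" "y \<in> I k" "f x = f y"
    then show "x = y" using inj[of "x - y"] subspace_diff[OF sI] by (simp add: lin_diffD[OF f])
  qed
  from endo.linear_exists_left_inverse_on[OF f sI this]
  obtain g where g: "range g \<subseteq> I k" "lin g" "\<And>v. v \<in> I k \<Longrightarrow> g (f v) = v" by auto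
  have surj: "\<exists>u\<in>I k. x = f u" if x: "x \<in> I k" for x
  proof -
    have "x \<in> I (Suc k)" using x Ieq by simp
    then obtain z where "x = f ((f ^^ k) z)" unfolding I_def by auto
    then show ?thesis unfolding I_def by auto
  qed
  have fg: "f (g x) = x" if "x \<in> I k" for x
    using surj[OF that] g(3) by auto
  have gI: "g x \<in> I k" for x using g(1) by auto
  define e where "e x = (g ^^ k) ((f ^^ k) x)" for x
  have el: "lin e" unfolding e_def by (rule lin_comp[OF lin_funpow[OF g(2)] lin_funpow[OF f]])
  have fkI: "(f ^^ j) x \<in> I k" if "x \<in> I k" for x j
    using that by (induction j) (auto intro: fI)
  have gkI: "(g ^^ j) x \<in> I k" if "x \<in> I k" for x j
    using that by (induction j) (auto intro: gI)
  have gfj: "(g ^^ j) ((f ^^ j) x) = x" if "x \<in> I k" for x j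
    using that
  proof (induction j)
    case (Suc j)
    have "(g ^^ Suc j) ((f ^^ Suc j) x) = (g ^^ j) (g (f ((f ^^ j) x)))"
      by (simp add: funpow_swap1)
    also have "\<dots> = x" using Suc g(3)[OF fkI[OF Suc.prems]] by simp
    finally show ?case .
  qed simp
  have fgj: "(f ^^ j) ((g ^^ j) x) = x" if "x \<in> I k" for x j
    using that
  proof (induction j)
    case (Suc j)
    have "(f ^^ Suc j) ((g ^^ Suc j) x) = (f ^^ j) (f (g ((g ^^ j) x)))"
      by (simp add: funpow_swap1)
    also have "\<dots> = x" using Suc fg[OF gkI[OF Suc.prems]] by simp
    finally show ?case .
  qed simp
  have fkx: "(f ^^ k) x \<in> I k" for x unfolding I_def by auto
  have eI: "e x \<in> I k" for x unfolding e_def by (rule gkI[OF fkx])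
  have ee: "e x = x" if "x \<in> I k" for x unfolding e_def by (rule gfj[OF that])
  have fe: "(f ^^ k) (e x) = (f ^^ k) x" for x unfolding e_def by (rule fgj[OF fkx])
  define d where "d x = g (e x)" for x
  have dl: "lin d" unfolding d_def by (rule lin_comp[OF g(2) el])
  have fd: "f (d x) = e x" for x unfolding d_def by (rule fg[OF eI])
  have comm: "h (d x) = d (h x)" if h: "lin h" and hf: "\<And>y. h (f y) = f (h y)" for h x
  proof -
    have hfj: "h ((f ^^ j) y) = (f ^^ j) (h y)" for j y
      by (induction j) (auto simp: hf)
    have hI: "h y \<in> I k" if "y \<in> I k" for y
      using that unfolding I_def by (auto simp: hfj)
    have "(f ^^ k) (h (x - e x)) = 0"
      using fe[of x] by (simp add: hfj[symmetric] lin_diffD[OF fl] lin_zeroD[OF h])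
    then have "e (h (x - e x)) = 0"
      unfolding e_def by (simp add: lin_zeroD[OF lin_funpow[OF g(2)]])
    then have "e (h x) = e (h (e x))" by (simp add: lin_diffD[OF h] lin_diffD[OF el])
    also have "\<dots> = h (e x)" by (rule ee[OF hI[OF eI]])
    finally have eh: "e (h x) = h (e x)" .
    have "d (h x) = g (h (f (g (e x))))" unfolding d_def eh fg[OF eI] ..
    also have "\<dots> = h (d x)" unfolding hf d_def by (rule g(3)[OF hI[OF gI]])
    finally show ?thesis ..
  qed
  show thesis
    by (rule that[OF dl, of k]) (simp_all add: comm fd fe ee eI)
qed

text \<open>For the Fitting inverse \<open>d\<close>, the projection \<open>f d\<close> has trace
  zero and therefore vanishes, which leaves only the nilpotent part of \<open>f\<close>.\<close>

lemma nilpotent_if_traces_vanish: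
  assumes f: "lin f"
    and t: "\<And>d. lin d \<Longrightarrow> (\<And>h x. lin h \<Longrightarrow> (\<And>y. h (f y) = f (h y)) \<Longrightarrow> h (d x) = d (h x)) \<Longrightarrow>
      tr (\<lambda>x. f (d x)) = 0"
  obtains k where "\<And>x. (f ^^ k) x = 0"
proof -
  obtain d k where d: "lin d" "\<And>h x. lin h \<Longrightarrow> (\<And>y. h (f y) = f (h y)) \<Longrightarrow> h (d x) = d (h x)"
    "\<And>x. f (d (f (d x))) = f (d x)" "\<And>x. (f ^^ k) (f (d x)) = (f ^^ k) x"
    by (rule fitting[OF f]) blast
  have "f (d x) = 0" for x
    using tr_idempotent_eq_0[OF lin_comp[OF f d(1)] d(3) t[OF d(1,2)]] .
  then have "(f ^^ k) x = 0" for x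
    using d(4)[of x] by (simp add: lin_zeroD[OF lin_funpow[OF f]])
  then show thesis by (rule that)
qed

end

section \<open>Jordan form and traces of iterated commutators\<close>

text \<open>In a basis starting with an eigenvector the first column is the eigenvalue times a unit
  vector; the induction hypothesis conjugates the lower right block.\<close>

lemma triangularizable:
  fixes A :: "'a::alg_closed_field mat"
  assumes "A \<in> carrier_mat n n"
  shows "\<exists>B\<in>carrier_mat n n. upper_triangular B \<and> similar_mat A B"
  using assms
proof (induction n arbitrary: A)
  case 0
  then show ?case
    by (intro bexI[of _ A]) (auto intro: similar_mat_refl)
next
  case (Suc n)
  note A = Suc.prems
  have "degree (char_poly A) > 0" using degree_monic_char_poly[OF A] by simp
  then obtain e where "poly (char_poly A) e = 0"
    using alg_closed_imp_poly_has_root by blast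
  then have "eigenvalue A e" using eigenvalue_root_char_poly[OF A] by simp
  then obtain v where ev: "eigenvector A v e" unfolding eigenvalue_def by blast
  then have v: "v \<in> carrier_vec (Suc n)" "v \<noteq> 0\<^sub>v (Suc n)" "A *\<^sub>v v = e \<cdot>\<^sub>v v"
    using A unfolding eigenvector_def by auto
  interpret vec_space "TYPE('a)" "Suc n" .
  define W where "W = mat_of_cols (Suc n) (basis_completion v)"
  note bc = basis_completion[OF v(1,2)]
  have W: "W \<in> carrier_mat (Suc n) (Suc n)"
    unfolding W_def using bc(6) mat_of_cols_carrier(1)[of "Suc n" "basis_completion v"] by simp
  have cols: "cols W = basis_completion v" unfolding W_def using bc(2) by simp
  have "rank W = Suc n"
    by (rule lin_indpt_full_rank[OF W]) (simp_all add: cols bc)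
  then have "det W \<noteq> 0" using det_rank_iff[OF W] by simp
  from det_non_zero_imp_unit[OF W this, of "()"]
  obtain W' where W': "W' \<in> carrier_mat (Suc n) (Suc n)" "W' * W = 1\<^sub>m (Suc n)" "W * W' = 1\<^sub>m (Suc n)"
    unfolding Units_def ring_mat_def by auto
  have colW: "col W 0 = v"
  proof -
    obtain vs where vs: "basis_completion v = v # vs"
      using bc(6,7) by (cases "basis_completion v") auto
    then show ?thesis unfolding W_def using v(1) by simp
  qed
  define A' where "A' = W' * A * W"
  have A': "A' \<in> carrier_mat (Suc n) (Suc n)" unfolding A'_def using W W' A by auto
  have "A = W * A' * W'"
  proof -
    have "W * A' * W' = W * (W' * A * W) * W'" unfolding A'_def ..
    also have "\<dots> = (W * W') * A * (W * W')"
      using W W'(1) A by (simp add: assoc_mult_mat[of _ "Suc n" "Suc n" _ "Suc n" _ "Suc n"])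
    finally show ?thesis using W'(3) A by simp
  qed
  then have sim1: "similar_mat A A'"
    by (intro similar_matI[of _ _ W W' "Suc n"]) (use W W' A A' in auto)
  have col0: "col A' 0 = e \<cdot>\<^sub>v unit_vec (Suc n) 0"
  proof -
    have "col A' 0 = W' * A *\<^sub>v v"
      unfolding A'_def by (subst col_mult2[of _ "Suc n" "Suc n"]) (use W' A W colW in auto)
    also have "\<dots> = W' *\<^sub>v (e \<cdot>\<^sub>v v)"
      using assoc_mult_mat_vec[OF W'(1) A v(1)] v(3) by simp
    also have "\<dots> = e \<cdot>\<^sub>v (W' *\<^sub>v v)" using mult_mat_vec[OF W'(1) v(1)] .
    also have "W' *\<^sub>v v = col (W' * W) 0"
      by (subst col_mult2[of _ "Suc n" "Suc n"]) (use W' W colW in auto)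
    also have "\<dots> = unit_vec (Suc n) 0" unfolding W'(2) by simp
    finally show ?thesis .
  qed
  obtain A1 A2 A0 A3 where split: "split_block A' 1 1 = (A1,A2,A0,A3)"
    by (cases "split_block A' 1 1") auto
  have d: "dim_row A' = 1 + n" "dim_col A' = 1 + n" using A' by auto
  note blk = split_block[OF split d]
  have A0: "A0 = 0\<^sub>m n 1"
  proof (rule eq_matI)
    fix i j assume ij: "i < dim_row (0\<^sub>m n 1 :: 'a mat)" "j < dim_col (0\<^sub>m n 1 :: 'a mat)"
    have "col A' 0 $ Suc i = 0" unfolding col0 using ij by simp
    then have "A' $$ (Suc i, 0) = 0" using A' ij by (simp add: col_def)
    then show "A0 $$ (i, j) = 0\<^sub>m n 1 $$ (i, j)"
      using split[unfolded split_block_def Let_def] ij d by auto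
  qed (use blk in auto)
  obtain B3 where B3: "B3 \<in> carrier_mat n n" "upper_triangular B3" "similar_mat A3 B3"
    using Suc.IH[OF blk(4)] by auto
  then obtain P Q where wit: "similar_mat_wit A3 B3 P Q" unfolding similar_mat_def by auto
  from similar_mat_witD2[OF blk(4) wit]
  have P: "P \<in> carrier_mat n n" and Q: "Q \<in> carrier_mat n n" and PQ: "P * Q = 1\<^sub>m n" by auto
  have "similar_mat_wit A' (four_block_mat A1 (A2 * P) (0\<^sub>m n 1) B3)
     (four_block_mat (1\<^sub>m 1) (0\<^sub>m 1 n) (0\<^sub>m n 1) P) (four_block_mat (1\<^sub>m 1) (0\<^sub>m 1 n) (0\<^sub>m n 1) Q)"
    unfolding blk(5) A0
  proof (rule similar_mat_wit_four_block[OF similar_mat_wit_refl[OF blk(1)] wit _ _ blk(1) blk(4)])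
    show "A2 = 1\<^sub>m 1 * (A2 * P) * Q"
      using blk(2) P Q PQ by (simp add: assoc_mult_mat[of _ 1 n _ n _ n])
  qed (use P blk in auto)
  then have "similar_mat A' (four_block_mat A1 (A2 * P) (0\<^sub>m n 1) B3)"
    unfolding similar_mat_def by blast
  then have "similar_mat A (four_block_mat A1 (A2 * P) (0\<^sub>m n 1) B3)"
    by (rule similar_mat_trans[OF sim1])
  moreover have "upper_triangular (four_block_mat A1 (A2 * P) (0\<^sub>m n 1) B3)"
    by (rule upper_triangular_four_block[OF blk(1) B3(1) _ B3(2)]) (use blk(1) in auto)
  moreover have "four_block_mat A1 (A2 * P) (0\<^sub>m n 1) B3 \<in> carrier_mat (Suc n) (Suc n)"
    using four_block_carrier_mat[OF blk(1) B3(1)] by simp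
  ultimately show ?case by blast
qed

text \<open>A nonzero entry lies inside one block. In other words, the diagonal of the Jordan matrix
  commutes with it; besides triangularity this is the only feature of the Jordan form that the trace
  argument uses.\<close>

lemma jordan_matrix_same_eigenvalue:
  assumes "i < sum_list (map fst n_as)" "j < sum_list (map fst n_as)"
    "jordan_matrix n_as $$ (i, j) \<noteq> (0 :: 'a::{zero,one})"
  shows "jordan_matrix n_as $$ (i, i) = jordan_matrix n_as $$ (j, j)"
  using assms
proof (induction n_as arbitrary: i j)
  case (Cons na n_as)
  obtain m a where na: "na = (m, a)" by force
  show ?case
    using Cons.prems Cons.IH[of "i - m" "j - m"] unfolding na jordan_matrix_Cons
    by (auto split: if_splits)
qed simp

lemma jordan_form_exists:
  fixes A :: "'a::alg_closed_field mat"
  assumes A: "A \<in> carrier_mat n n"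
  obtains P Q J where "P \<in> carrier_mat n n" "Q \<in> carrier_mat n n" "J \<in> carrier_mat n n"
    "P * Q = 1\<^sub>m n" "Q * P = 1\<^sub>m n" "A = P * J * Q"
    "\<And>i j. i < n \<Longrightarrow> j < i \<Longrightarrow> J $$ (i, j) = 0"
    "\<And>i j. i < n \<Longrightarrow> j < n \<Longrightarrow> J $$ (i, j) \<noteq> 0 \<Longrightarrow> J $$ (i, i) = J $$ (j, j)"
proof -
  obtain B where B: "B \<in> carrier_mat n n" "upper_triangular B" "similar_mat A B"
    using triangularizable[OF A] by auto
  obtain n_as where "jordan_nf B n_as"
    using triangular_to_jnf_vector[OF B(1,2)] by blast
  then have "similar_mat A (jordan_matrix n_as)"
    using B(3) similar_mat_trans unfolding jordan_nf_def by blast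
  then obtain P Q where wit: "similar_mat_wit A (jordan_matrix n_as) P Q"
    unfolding similar_mat_def by auto
  note w = similar_mat_witD2[OF A wit]
  have "sum_list (map fst n_as) = n"
    using w(5) unfolding carrier_mat_def by simp
  with w show thesis
    by (intro that[of P Q "jordan_matrix n_as"])
      (auto intro: jordan_matrix_upper_triangular jordan_matrix_same_eigenvalue)
qed

text \<open>A power of T - \<nu> removes the \<nu>-component and is injective modulo
  \<open>N\<close> on the others, so induction on the number of components applies. This replaces
  writing the component projections as polynomials in \<open>T\<close>.\<close>

lemma (in vector_space) generalized_eigencomponents_mem:
  assumes T: "Vector_Spaces.linear scale scale T" and N: "subspace N" and TN: "\<And>u. u \<in> N \<Longrightarrow> T u \<in> N"
    and fin: "finite S"
    and nil: "\<And>\<mu>. \<mu> \<in> S \<Longrightarrow> ((\<lambda>u. T u - scale \<mu> u) ^^ m) (v \<mu>) = 0"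
    and sum: "(\<Sum>\<mu>\<in>S. v \<mu>) \<in> N" and mem: "\<mu> \<in> S"
  shows "v \<mu> \<in> N"
proof -
  interpret T: Vector_Spaces.linear scale scale T by (rule T)
  define D where "D \<mu> u = T u - scale \<mu> u" for \<mu> u
  have Dadd: "D \<mu> (u + w) = D \<mu> u + D \<mu> w" for \<mu> u w
    unfolding D_def by (simp add: T.add scale_right_distrib)
  have D0: "D \<mu> 0 = 0" for \<mu> unfolding D_def by simp
  have Dsum: "D \<mu> (sum g A) = (\<Sum>a\<in>A. D \<mu> (g a))" for \<mu> g and A :: "'a set"
    by (induction A rule: infinite_finite_induct) (simp_all add: D0 Dadd)
  have Dcomm: "D \<mu> (D \<nu> u) = D \<nu> (D \<mu> u)" for \<mu> \<nu> u
    unfolding D_def by (simp add: T.diff T.scale scale_right_diff_distrib scale_left_commute)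
  have Dpcomm: "D \<mu> ((D \<nu> ^^ k) u) = (D \<nu> ^^ k) (D \<mu> u)" for \<mu> \<nu> u k
    by (induction k) (simp_all add: Dcomm[of \<mu> \<nu>])
  have Dppcomm: "(D \<mu> ^^ j) ((D \<nu> ^^ k) u) = (D \<nu> ^^ k) ((D \<mu> ^^ j) u)" for \<mu> \<nu> u j k
    by (induction j) (simp_all add: Dpcomm)
  have Dp0: "(D \<mu> ^^ k) 0 = 0" for \<mu> k by (induction k) (simp_all add: D0)
  have Dpsum: "(D \<mu> ^^ k) (sum g A) = (\<Sum>a\<in>A. (D \<mu> ^^ k) (g a))" for \<mu> k g and A :: "'a set"
    by (induction k) (simp_all add: Dsum)
  have DN: "u \<in> N \<Longrightarrow> D \<mu> u \<in> N" for \<mu> u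
    unfolding D_def by (intro subspace_diff N TN subspace_scale)
  have DpN: "u \<in> N \<Longrightarrow> (D \<mu> ^^ k) u \<in> N" for \<mu> u k
    by (induction k) (simp_all add: DN)
  have step: "u \<in> N" if "\<mu> \<noteq> \<nu>" "D \<nu> u \<in> N" "(D \<mu> ^^ k) u = 0" for \<mu> \<nu> u k
    using that(2,3)
  proof (induction k arbitrary: u)
    case 0
    then show ?case using subspace_0[OF N] by simp
  next
    case (Suc k)
    have "D \<mu> u \<in> N"
    proof (rule Suc.IH)
      show "D \<nu> (D \<mu> u) \<in> N" using DN[OF Suc.prems(1), of \<mu>] Dcomm by simp
      show "(D \<mu> ^^ k) (D \<mu> u) = 0" using Suc.prems(2) by (simp add: funpow_swap1)
    qed
    then have "D \<nu> u - D \<mu> u \<in> N" using Suc.prems(1) N by (intro subspace_diff)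
    moreover have "D \<nu> u - D \<mu> u = scale (\<mu> - \<nu>) u"
      unfolding D_def by (simp add: scale_left_diff_distrib)
    ultimately have "scale (inverse (\<mu> - \<nu>)) (scale (\<mu> - \<nu>) u) \<in> N"
      using subspace_scale[OF N] by metis
    then show ?case using that(1) by simp
  qed
  have steps: "u \<in> N" if "\<mu> \<noteq> \<nu>" "(D \<nu> ^^ j) u \<in> N" "(D \<mu> ^^ k) u = 0" for \<mu> \<nu> u j k
    using that(2)
  proof (induction j)
    case (Suc j)
    have "(D \<nu> ^^ j) u \<in> N"
      by (rule step[OF that(1), of _ k]) (use Suc.prems that(3) in \<open>simp_all add: Dppcomm[where \<mu> = \<mu>] Dp0\<close>)
    then show ?case by (rule Suc.IH)
  qed simp
  have "\<forall>v. (\<forall>\<mu>\<in>S. (D \<mu> ^^ m) (v \<mu>) = 0) \<longrightarrow> (\<Sum>\<mu>\<in>S. v \<mu>) \<in> N \<longrightarrow> (\<forall>\<mu>\<in>S. v \<mu> \<in> N)"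
    using fin
  proof (induction S rule: finite_induct)
    case (insert \<nu> S)
    show ?case
    proof (intro allI impI)
      fix v assume nil: "\<forall>\<mu>\<in>insert \<nu> S. (D \<mu> ^^ m) (v \<mu>) = 0" and s: "(\<Sum>\<mu>\<in>insert \<nu> S. v \<mu>) \<in> N"
      have "(\<Sum>\<mu>\<in>S. (D \<nu> ^^ m) (v \<mu>)) = (D \<nu> ^^ m) (\<Sum>\<mu>\<in>insert \<nu> S. v \<mu>)"
        using nil insert.hyps by (simp only: Dpsum) simp
      then have "(\<Sum>\<mu>\<in>S. (D \<nu> ^^ m) (v \<mu>)) \<in> N" using DpN[OF s] by simp
      moreover have "\<forall>\<mu>\<in>S. (D \<mu> ^^ m) ((D \<nu> ^^ m) (v \<mu>)) = 0"
        using nil by (simp add: Dppcomm[where \<nu> = \<nu>] Dp0)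
      ultimately have "\<forall>\<mu>\<in>S. (D \<nu> ^^ m) (v \<mu>) \<in> N"
        using insert.IH[rule_format, of "\<lambda>\<mu>. (D \<nu> ^^ m) (v \<mu>)"] by blast
      then have S: "\<forall>\<mu>\<in>S. v \<mu> \<in> N"
        using steps nil insert.hyps by (metis insert_iff)
      then have "(\<Sum>\<mu>\<in>S. v \<mu>) \<in> N" by (intro subspace_sum N) auto
      then have "(\<Sum>\<mu>\<in>insert \<nu> S. v \<mu>) - (\<Sum>\<mu>\<in>S. v \<mu>) \<in> N"
        by (rule subspace_diff[OF N s])
      then have "v \<nu> \<in> N" using insert.hyps by simp
      with S show "\<forall>\<mu>\<in>insert \<nu> S. v \<mu> \<in> N" by simp
    qed
  qed simp
  then show ?thesis using nil sum mem unfolding D_def[abs_def] by blast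
qed

text \<open>The commutator with \<open>J\<close>. Matrices are functions on pairs of naturals so
  that a whole type forms a vector space; entries outside the n by n square are zero.\<close>

definition ad_mat :: "nat \<Rightarrow> (nat \<Rightarrow> nat \<Rightarrow> 'a::comm_ring_1) \<Rightarrow> (nat \<Rightarrow> nat \<Rightarrow> 'a) \<Rightarrow> nat \<Rightarrow> nat \<Rightarrow> 'a"
  where "ad_mat n J A = (\<lambda>i j. if i < n \<and> j < n then (\<Sum>l<n. J i l * A l j) - (\<Sum>l<n. A i l * J l j) else 0)"

text \<open>On the support of \<open>A\<close> the diagonal of \<open>J\<close> contributes exactly
  \<mu>. By \<open>same\<close>, the strictly upper entries respect the support condition, and they
  lower i - j. Since i - j stays strictly between -n and n, 2n steps leave nothing.\<close>

lemma ad_mat_eigencomponent: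
  fixes J A :: "nat \<Rightarrow> nat \<Rightarrow> 'a::field"
  assumes upper: "\<And>i j. i < n \<Longrightarrow> j < i \<Longrightarrow> J i j = 0"
    and same: "\<And>i j. i < n \<Longrightarrow> j < n \<Longrightarrow> J i j \<noteq> 0 \<Longrightarrow> J i i = J j j"
    and A: "\<And>i j. A i j \<noteq> 0 \<Longrightarrow> i < n \<and> j < n \<and> J i i - J j j = \<mu>"
  shows "((\<lambda>u. ad_mat n J u - (\<lambda>i j. \<mu> * u i j)) ^^ (2 * n)) A = 0"
proof -
  define Q where "Q c A \<longleftrightarrow> (\<forall>i j. A i j \<noteq> 0 \<longrightarrow> i < n \<and> j < n \<and> J i i - J j j = \<mu> \<and> int i - int j < c)"
    for c :: int and A :: "nat \<Rightarrow> nat \<Rightarrow> 'a"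
  define D where "D u = ad_mat n J u - (\<lambda>i j. \<mu> * u i j)" for u
  have step: "Q (c - 1) (D u)" if "Q c u" for c u
    unfolding Q_def
  proof (intro allI impI)
    fix i j assume nz: "D u i j \<noteq> 0"
    have q: "u i j \<noteq> 0 \<Longrightarrow> i < n \<and> j < n \<and> J i i - J j j = \<mu> \<and> int i - int j < c" for i j
      using that unfolding Q_def by blast
    show "i < n \<and> j < n \<and> J i i - J j j = \<mu> \<and> int i - int j < c - 1"
    proof (cases "i < n \<and> j < n")
      case False
      then have "u i j = 0" using q by blast
      then show ?thesis using nz False unfolding D_def ad_mat_def by auto
    next
      case True
      have 1: "(\<Sum>l<n. J i l * u l j) = J i i * u i j + (\<Sum>l\<in>{..<n}-{i}. J i l * u l j)"
        using True sum.remove[of "{..<n}" i "\<lambda>l. J i l * u l j"] by auto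
      have 2: "(\<Sum>l<n. u i l * J l j) = u i j * J j j + (\<Sum>l\<in>{..<n}-{j}. u i l * J l j)"
        using True sum.remove[of "{..<n}" j "\<lambda>l. u i l * J l j"] by auto
      have "D u i j = (J i i - J j j - \<mu>) * u i j + (\<Sum>l\<in>{..<n}-{i}. J i l * u l j)
          - (\<Sum>l\<in>{..<n}-{j}. u i l * J l j)"
        using True 1 2 unfolding D_def ad_mat_def by (simp add: algebra_simps)
      moreover have "(J i i - J j j - \<mu>) * u i j = 0" using q[of i j] by auto
      ultimately have "(\<Sum>l\<in>{..<n}-{i}. J i l * u l j) \<noteq> 0 \<or> (\<Sum>l\<in>{..<n}-{j}. u i l * J l j) \<noteq> 0"
        using nz by auto
      then show ?thesis
      proof
        assume "(\<Sum>l\<in>{..<n}-{i}. J i l * u l j) \<noteq> 0"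
        then obtain l where l: "l < n" "l \<noteq> i" "J i l \<noteq> 0" "u l j \<noteq> 0"
          by (rule sum.not_neutral_contains_not_neutral) auto
        then have "i < l" using upper[of i l] True by (meson nat_neq_iff)
        then show ?thesis using q[OF l(4)] same[of i l] l True by simp
      next
        assume "(\<Sum>l\<in>{..<n}-{j}. u i l * J l j) \<noteq> 0"
        then obtain l where l: "l < n" "l \<noteq> j" "J l j \<noteq> 0" "u i l \<noteq> 0"
          by (rule sum.not_neutral_contains_not_neutral) auto
        then have "l < j" using upper[of l j] by (meson nat_neq_iff)
        then show ?thesis using q[OF l(4)] same[of l j] l True by simp
      qed
    qed
  qed
  have "Q (int n - int k) ((D ^^ k) A)" for k
  proof (induction k)
    case 0
    then show ?case unfolding Q_def using A by fastforce
  next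
    case (Suc k)
    then show ?case using step[OF Suc] by (simp add: algebra_simps)
  qed
  from this[of "2 * n"] have Q: "Q (- int n) ((D ^^ (2 * n)) A)" by simp
  have "(D ^^ (2 * n)) A i j = 0" for i j
  proof (rule ccontr)
    assume "(D ^^ (2 * n)) A i j \<noteq> 0"
    then have "j < n" "int i - int j < - int n" using Q unfolding Q_def by blast+
    then show False by linarith
  qed
  then show ?thesis unfolding D_def[abs_def] by (auto simp: fun_eq_iff)
qed

text \<open>The diagonal matrix of the values \<open>f (J i i)\<close>, \<open>f\<close> additive, acts on the
  \<open>\<mu>\<close>-eigencomponent of \<open>ad J\<close> as the scalar \<open>f \<mu>\<close>. Its commutator with \<open>A\<close> is therefore
  a combination of the components of \<open>A\<close>, all of which pair to zero with \<open>B\<close>.\<close>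

lemma trace_pairing_additive_weight:
  fixes J A B :: "nat \<Rightarrow> nat \<Rightarrow> 'a::field"
  assumes upper: "\<And>i j. i < n \<Longrightarrow> j < i \<Longrightarrow> J i j = 0"
    and same: "\<And>i j. i < n \<Longrightarrow> j < n \<Longrightarrow> J i j \<noteq> 0 \<Longrightarrow> J i i = J j j"
    and A: "\<And>i j. \<not> (i < n \<and> j < n) \<Longrightarrow> A i j = 0"
    and tr: "\<And>k. (\<Sum>i<n. \<Sum>j<n. (ad_mat n J ^^ k) A i j * B j i) = 0"
  shows "(\<Sum>i<n. \<Sum>j<n. A i j * B j i * f (J i i - J j j)) = 0"
proof -
  define sc :: "'a \<Rightarrow> (nat \<Rightarrow> nat \<Rightarrow> 'a) \<Rightarrow> (nat \<Rightarrow> nat \<Rightarrow> 'a)" where "sc c u = (\<lambda>i j. c * u i j)" for c u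
  interpret vector_space sc
    by unfold_locales (auto simp: sc_def fun_eq_iff algebra_simps)
  define ell where "ell u = (\<Sum>i<n. \<Sum>j<n. u i j * B j i)" for u
  have ell: "ell (u + w) = ell u + ell w" "ell (sc c u) = c * ell u" "ell 0 = 0" for u w c
    unfolding ell_def sc_def by (simp_all add: algebra_simps sum.distrib sum_distrib_left)
  define T where "T = ad_mat n J"
  have Tadd: "T (u + w) = T u + T w" and Tsc: "T (sc c u) = sc c (T u)" for u w c
    unfolding T_def ad_mat_def sc_def
    by (auto simp: fun_eq_iff algebra_simps sum.distrib sum_distrib_left)
  have T: "Vector_Spaces.linear sc sc T"
    unfolding Vector_Spaces.linear_iff using vector_space_axioms Tadd Tsc by blast
  have T0: "T 0 = 0" using Tadd[of 0 0] by simp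
  have Tk: "(T ^^ k) (u + w) = (T ^^ k) u + (T ^^ k) w" "(T ^^ k) (sc c u) = sc c ((T ^^ k) u)"
    "(T ^^ k) 0 = 0" for k u w c
    by (induction k) (simp_all add: Tadd Tsc T0)
  \<comment> \<open>The largest T-invariant subspace of the kernel of \<open>ell\<close>. It
    contains \<open>A\<close> by hypothesis, hence every eigencomponent of \<open>A\<close>.\<close>
  define N where "N = {u. \<forall>k. ell ((T ^^ k) u) = 0}"
  have N: "subspace N"
    unfolding N_def subspace_def by (auto simp: Tk ell)
  have TN: "T u \<in> N" if "u \<in> N" for u
    unfolding N_def
  proof (intro CollectI allI)
    fix k
    have "(T ^^ k) (T u) = (T ^^ Suc k) u" by (simp add: funpow_swap1)
    then show "ell ((T ^^ k) (T u)) = 0" using that unfolding N_def by (simp only: mem_Collect_eq)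
  qed
  define S where "S = (\<lambda>(i, j). J i i - J j j) ` ({..<n} \<times> {..<n})"
  define v where "v \<mu> = (\<lambda>i j. if i < n \<and> j < n \<and> J i i - J j j = \<mu> then A i j else 0)" for \<mu>
  have fin: "finite S" unfolding S_def by simp
  have nil: "((\<lambda>u. T u - sc \<mu> u) ^^ (2 * n)) (v \<mu>) = 0" for \<mu>
    unfolding T_def sc_def
    by (rule ad_mat_eigencomponent[OF upper same]) (auto simp: v_def split: if_splits)
  have sum_apply: "(\<Sum>\<mu>\<in>S. g \<mu>) i j = (\<Sum>\<mu>\<in>S. g \<mu> i j)" for g :: "'a \<Rightarrow> nat \<Rightarrow> nat \<Rightarrow> 'a" and i j
    using fin by (induction S rule: finite_induct) auto
  have "(\<Sum>\<mu>\<in>S. v \<mu>) = A"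
  proof (intro ext)
    fix i j
    show "(\<Sum>\<mu>\<in>S. v \<mu>) i j = A i j"
    proof (cases "i < n \<and> j < n")
      case True
      then have "J i i - J j j \<in> S" unfolding S_def by force
      then show ?thesis unfolding sum_apply v_def using True fin by (simp add: sum.delta')
    next
      case False
      then have "v \<mu> i j = 0" for \<mu> unfolding v_def by auto
      then show ?thesis using A[OF False] by (simp add: sum_apply)
    qed
  qed
  moreover have "A \<in> N" unfolding N_def T_def ell_def using tr by simp
  ultimately have "(\<Sum>\<mu>\<in>S. v \<mu>) \<in> N" by simp
  from generalized_eigencomponents_mem[OF T N TN fin nil this]
  have "ell ((T ^^ 0) (v \<mu>)) = 0" if "\<mu> \<in> S" for \<mu>
    using that unfolding N_def by blast
  then have "(\<Sum>\<mu>\<in>S. f \<mu> * ell (v \<mu>)) = 0" by simp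
  also have "(\<Sum>\<mu>\<in>S. f \<mu> * ell (v \<mu>)) = (\<Sum>\<mu>\<in>S. \<Sum>i<n. \<Sum>j<n. f \<mu> * (v \<mu> i j * B j i))"
    unfolding ell_def by (simp add: sum_distrib_left)
  also have "\<dots> = (\<Sum>i<n. \<Sum>j<n. \<Sum>\<mu>\<in>S. f \<mu> * (v \<mu> i j * B j i))"
    by (subst sum.swap, rule sum.cong[OF refl], subst sum.swap, rule refl)
  also have "\<dots> = (\<Sum>i<n. \<Sum>j<n. A i j * B j i * f (J i i - J j j))"
  proof (intro sum.cong refl)
    fix i j assume ij: "i \<in> {..<n}" "j \<in> {..<n}"
    then have m: "J i i - J j j \<in> S" unfolding S_def by force
    have "(\<Sum>\<mu>\<in>S. f \<mu> * (v \<mu> i j * B j i)) = (\<Sum>\<mu>\<in>S. if \<mu> = J i i - J j j then f \<mu> * (A i j * B j i) else 0)"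
      using ij by (intro sum.cong refl) (auto simp: v_def)
    also have "\<dots> = A i j * B j i * f (J i i - J j j)"
      using fin m by (simp add: sum.delta mult_ac)
    finally show "(\<Sum>\<mu>\<in>S. f \<mu> * (v \<mu> i j * B j i)) = A i j * B j i * f (J i i - J j j)" .
  qed
  finally show ?thesis .
qed

text \<open>Meant for eigenvalues: rational values are wanted because a vanishing sum of rational
  squares has vanishing terms.\<close>

lemma rat_linear_functional:
  fixes a :: "'a::field_char_0"
  assumes "a \<noteq> 0"
  obtains f :: "'a \<Rightarrow> rat" where "\<And>x y. f (x + y) = f x + f y" "\<And>q x. f (of_rat q * x) = q * f x" "f a = 1"
proof -
  interpret vector_space_pair "\<lambda>q (x::'a). of_rat q * x" "(*) :: rat \<Rightarrow> rat \<Rightarrow> rat"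
    by unfold_locales (auto simp: algebra_simps of_rat_add of_rat_mult)
  have "vs1.independent {a}" using assms by simp
  then obtain g where "Vector_Spaces.linear (\<lambda>q (x::'a). of_rat q * x) (*) g" "\<forall>x\<in>{a}. g x = 1"
    using linear_independent_extend[of "{a}" "\<lambda>_. 1"] by blast
  then show thesis
    by (intro that[of g]) (auto simp: Vector_Spaces.linear_iff)
qed

section \<open>A trace criterion for nilpotency, proved over the algebraic closure\<close>

context fin_dim_space
begin

definition comm :: "('v \<Rightarrow> 'v) \<Rightarrow> ('v \<Rightarrow> 'v) \<Rightarrow> 'v \<Rightarrow> 'v"
  where "comm f g = (\<lambda>v. f (g v) - g (f v))"

lemma lin_comm: "lin f \<Longrightarrow> lin g \<Longrightarrow> lin (comm f g)"
  unfolding comm_def using lin_diff[OF lin_comp[of f g] lin_comp[of g f]] .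

lemma lin_comm_pow: "lin f \<Longrightarrow> lin g \<Longrightarrow> lin ((comm f ^^ k) g)"
  by (induction k) (simp_all add: lin_comm)

text \<open>In a Jordan basis of \<open>x\<close> let y be the diagonal matrix of the values f
  \<lambda> of a rational functional \<open>f\<close> on the eigenvalues \<lambda>. Then tr (x y) is
  the sum of the traces of [y, a i] (b i), which vanish by
  \<open>trace_pairing_additive_weight\<close>. Applying \<open>f\<close> to the sum of all
  \<lambda> f \<lambda> gives the sum of the squares of f \<lambda>, so every \<lambda> is
  zero.\<close>

theorem nilpotent_if_traces_of_iterated_commutators_vanish:
  fixes a b :: "'i \<Rightarrow> 'v \<Rightarrow> 'v"
  assumes I: "finite I" and x: "lin x" and a: "\<And>i. i \<in> I \<Longrightarrow> lin (a i)" and b: "\<And>i. i \<in> I \<Longrightarrow> lin (b i)"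
    and sum: "\<And>v. x v = (\<Sum>i\<in>I. comm (a i) (b i) v)"
    and t: "\<And>i k. i \<in> I \<Longrightarrow> tr (\<lambda>v. (comm x ^^ k) (a i) (b i v)) = 0"
  obtains k where "\<And>v. (x ^^ k) v = 0"
proof -
  obtain bs where bs: "set bs = Basis" "distinct bs"
    using finite_distinct_list[OF basis_fin] by blast
  define n where "n = length bs"
  define rep where "rep f i j = representation Basis (f (bs ! j)) (bs ! i)" for f i j
  define M where "M f = mat n n (\<lambda>(i, j). to_ac (rep f i j))" for f :: "'v \<Rightarrow> 'v"
  have M: "M f \<in> carrier_mat n n" for f unfolding M_def by simp
  have sum_bs: "(\<Sum>c\<in>Basis. h c) = (\<Sum>l<n. h (bs ! l))" for h :: "'v \<Rightarrow> 'k"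
  proof -
    have "bij_betw ((!) bs) {..<n} Basis"
      unfolding n_def bs(1)[symmetric] using bs(2) by (intro bij_betw_nth) auto
    then show ?thesis by (rule sum.reindex_bij_betw[symmetric])
  qed
  have rep_comp: "rep (\<lambda>v. f (g v)) i j = (\<Sum>l<n. rep f i l * rep g l j)" if "lin f" for f g i j
    using rep_lin[OF basis_indep basis_span that, of "g (bs ! j)" "bs ! i"]
    unfolding rep_def sum_bs by (simp add: mult.commute)
  have M_comp: "M (\<lambda>v. f (g v)) = M f * M g" if "lin f" for f g
    unfolding M_def
    by (rule eq_matI) (simp_all add: rep_comp[OF that, where g = g] scalar_prod_def to_ac_sum atLeast0LessThan)
  have M_diff: "M (\<lambda>v. f v - g v) = M f - M g" for f g
    unfolding M_def rep_def using basis_indep basis_span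
    by (intro eq_matI) (simp_all add: representation_diff)
  obtain P Q J where PQ: "P \<in> carrier_mat n n" "Q \<in> carrier_mat n n" and J: "J \<in> carrier_mat n n"
    and inv: "P * Q = 1\<^sub>m n" "Q * P = 1\<^sub>m n" and MxJ: "M x = P * J * Q"
    and upper: "\<And>i j. i < n \<Longrightarrow> j < i \<Longrightarrow> J $$ (i, j) = 0"
    and same: "\<And>i j. i < n \<Longrightarrow> j < n \<Longrightarrow> J $$ (i, j) \<noteq> 0 \<Longrightarrow> J $$ (i, i) = J $$ (j, j)"
    by (rule jordan_form_exists[OF M[of x]]) blast
  \<comment> \<open>\<open>M\<close> takes matrices over the algebraic closure, \<open>C\<close>
    passes to the Jordan basis of \<open>x\<close>, and \<open>N\<close> below turns the result into
    a total function suited to \<open>ad_mat\<close>.\<close>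
  define C where "C f = Q * M f * P" for f
  have C: "C f \<in> carrier_mat n n" for f unfolding C_def using PQ M by auto
  have C_comp: "C (\<lambda>v. f (g v)) = C f * C g" if "lin f" for f g
  proof -
    have "C f * C g = Q * M f * (P * Q) * M g * P"
      unfolding C_def using PQ M[of f] M[of g] by (simp add: assoc_mult_mat[of _ n n _ n _ n])
    also have "\<dots> = Q * (M f * M g) * P"
      using PQ M[of f] M[of g] inv(1) by (simp add: assoc_mult_mat[of _ n n _ n _ n])
    finally show ?thesis unfolding C_def M_comp[OF that, of g] by simp
  qed
  have C_diff: "C (\<lambda>v. f v - g v) = C f - C g" for f g
    unfolding C_def M_diff using PQ M[of f] M[of g]
    by (simp add: mult_minus_distrib_mat[of _ n n] minus_mult_distrib_mat[of _ n n _ _ n])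
  have M_C: "M f = P * C f * Q" for f
  proof -
    have "P * C f * Q = (P * Q) * M f * (P * Q)"
      unfolding C_def using PQ M[of f] by (simp add: assoc_mult_mat[of _ n n _ n _ n])
    then show ?thesis using inv(1) M[of f] by simp
  qed
  have Cx: "C x = J"
  proof -
    have "C x = (Q * P) * J * (Q * P)"
      unfolding C_def MxJ using PQ J by (simp add: assoc_mult_mat[of _ n n _ n _ n])
    then show ?thesis using inv(2) J by simp
  qed
  define N where "N f i j = (if i < n \<and> j < n then C f $$ (i, j) else 0)" for f i j
  have N_comp: "N (\<lambda>v. f (g v)) i j = (\<Sum>l<n. N f i l * N g l j)" if "lin f" "i < n" "j < n" for f g i j
    unfolding N_def C_comp[OF that(1), of g] using that C[of f] C[of g]
    by (simp add: scalar_prod_def atLeast0LessThan)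
  have N_diff: "N (\<lambda>v. f v - g v) i j = N f i j - N g i j" for f g i j
    unfolding N_def C_diff using C[of f] C[of g] by auto
  have N_out: "\<not> (i < n \<and> j < n) \<Longrightarrow> N f i j = 0" for f i j by (auto simp: N_def)
  have N_zero: "f v = 0" if "lin f" "\<And>i j. N f i j = 0" for f v
  proof -
    have "C f = 0\<^sub>m n n"
    proof (rule eq_matI)
      fix i j assume "i < dim_row (0\<^sub>m n n)" "j < dim_col (0\<^sub>m n n)"
      then show "C f $$ (i, j) = 0\<^sub>m n n $$ (i, j)" using that(2)[of i j] unfolding N_def by simp
    qed (use C[of f] in auto)
    then have "M f = 0\<^sub>m n n" using M_C[of f] PQ by simp
    then have "M f $$ (i, j) = 0" if "i < n" "j < n" for i j using that by simp
    then have rep0: "rep f i j = 0" if "i < n" "j < n" for i j using that unfolding M_def by simp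
    have "representation Basis (f v) c = 0" for c
    proof (cases "c \<in> Basis")
      case True
      then obtain i where i: "i < n" "c = bs ! i" unfolding bs(1)[symmetric] n_def
        by (auto simp: in_set_conv_nth)
      show ?thesis
        using rep_lin[OF basis_indep basis_span that(1), of v c] rep0[OF i(1)]
        unfolding rep_def sum_bs i(2) by simp
    next
      case False
      then show ?thesis using representation_ne_zero by blast
    qed
    then show ?thesis using rep_expand[OF basis_indep basis_span, of "f v"] by simp
  qed
  have N_tr: "(\<Sum>i<n. N f i i) = to_ac (tr f)" for f
  proof -
    have mult: "(S * T) $$ (i, j) = (\<Sum>l<n. S $$ (i, l) * T $$ (l, j))"
      if "S \<in> carrier_mat n n" "T \<in> carrier_mat n n" "i < n" "j < n"
      for S T :: "'k alg_closure mat" and i j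
      using that by (simp add: scalar_prod_def atLeast0LessThan)
    have QM: "Q * M f \<in> carrier_mat n n" using PQ M[of f] by simp
    have "(\<Sum>i<n. N f i i) = (\<Sum>i<n. \<Sum>l<n. (Q * M f) $$ (i, l) * P $$ (l, i))"
      unfolding N_def C_def by (intro sum.cong refl) (simp add: mult[OF QM PQ(1)] del: index_mult_mat)
    also have "\<dots> = (\<Sum>l<n. \<Sum>i<n. P $$ (l, i) * (Q * M f) $$ (i, l))"
      by (subst sum.swap) (simp add: mult.commute)
    also have "\<dots> = (\<Sum>l<n. (P * (Q * M f)) $$ (l, l))"
      by (intro sum.cong refl) (simp add: mult[OF PQ(1) QM] del: index_mult_mat)
    also have "P * (Q * M f) = M f"
      using PQ M[of f] inv(1) by (simp add: assoc_mult_mat[of _ n n _ n _ n, symmetric])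
    also have "(\<Sum>l<n. M f $$ (l, l)) = to_ac (tr f)"
      unfolding tr_def tr_on_def sum_bs by (simp add: M_def rep_def to_ac_sum)
    finally show ?thesis .
  qed
  have Nx: "N x i j = (if i < n \<and> j < n then J $$ (i, j) else 0)" for i j unfolding N_def Cx ..
  have N_comm: "N (comm x f) = ad_mat n (N x) (N f)" if "lin f" for f
  proof (intro ext)
    fix i j
    show "N (comm x f) i j = ad_mat n (N x) (N f) i j"
      unfolding comm_def N_diff ad_mat_def
      by (auto simp: N_comp[OF x, where g = f] N_comp[OF that, where g = x] N_out)
  qed
  have N_pow: "N ((comm x ^^ k) f) = (ad_mat n (N x) ^^ k) (N f)" if "lin f" for f k
    by (induction k) (simp_all add: N_comm lin_comm_pow[OF x that])
  have upperN: "N x i j = 0" if "i < n" "j < i" for i j using upper[OF that] unfolding Nx by simp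
  have sameN: "N x i i = N x j j" if "i < n" "j < n" "N x i j \<noteq> 0" for i j
    using same[of i j] that unfolding Nx by simp
  have diag0: "N x m m = 0" if m: "m < n" for m
  proof (rule ccontr)
    assume "N x m m \<noteq> 0"
    then obtain f :: "'k alg_closure \<Rightarrow> rat" where f: "\<And>x y. f (x + y) = f x + f y"
      "\<And>q x. f (of_rat q * x) = q * f x" "f (N x m m) = 1"
      by (rule rat_linear_functional) blast
    have f0: "f 0 = 0" using f(1)[of 0 0] by simp
    have fdiff: "f (u - w) = f u - f w" for u w using f(1)[of "u - w" w] by simp
    have fsum: "f (sum g A) = (\<Sum>a\<in>A. f (g a))" for g and A :: "nat set"
      by (induction A rule: infinite_finite_induct) (simp_all add: f f0)
    define y :: "nat \<Rightarrow> 'k alg_closure" where "y i = of_rat (f (N x i i))" for i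
    have xsum: "x = (\<lambda>v. \<Sum>i\<in>I. comm (a i) (b i) v)" using sum by auto
    have Nsum: "N (\<lambda>v. \<Sum>i\<in>A. comm (a i) (b i) v) p q = (\<Sum>i\<in>A. N (comm (a i) (b i)) p q)"
      if "finite A" for A p q
      using that
    proof (induction A rule: finite_induct)
      case empty
      have "N (\<lambda>v. 0) p q = 0" using N_diff[of "\<lambda>v. 0" "\<lambda>v. 0"] by simp
      then show ?case by simp
    next
      case (insert i A)
      let ?g = "\<lambda>v. \<Sum>i\<in>A. comm (a i) (b i) v"
      have "N ?g p q = N (\<lambda>v. (comm (a i) (b i) v + ?g v) - comm (a i) (b i) v) p q" by simp
      then have "N (\<lambda>v. comm (a i) (b i) v + ?g v) p q = N (comm (a i) (b i)) p q + N ?g p q"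
        unfolding N_diff by simp
      then show ?case using insert by simp
    qed
    have "(\<Sum>p<n. N (comm (a i) (b i)) p p * y p) = 0" if i: "i \<in> I" for i
    proof -
      have tr0: "(\<Sum>p<n. \<Sum>q<n. (ad_mat n (N x) ^^ k) (N (a i)) p q * N (b i) q p) = 0" for k
      proof -
        have "(\<Sum>p<n. \<Sum>q<n. (ad_mat n (N x) ^^ k) (N (a i)) p q * N (b i) q p)
            = (\<Sum>p<n. N (\<lambda>v. (comm x ^^ k) (a i) (b i v)) p p)"
          by (simp add: N_comp[OF lin_comm_pow[OF x a[OF i]], where g = "b i"] N_pow[OF a[OF i]])
        then show ?thesis unfolding N_tr t[OF i] by simp
      qed
      have "(\<Sum>p<n. \<Sum>q<n. N (a i) p q * N (b i) q p * of_rat (f (N x p p - N x q q))) = 0"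
        by (rule trace_pairing_additive_weight[OF upperN sameN N_out tr0])
      then have "(\<Sum>p<n. \<Sum>q<n. N (a i) p q * N (b i) q p * y p)
         - (\<Sum>p<n. \<Sum>q<n. N (a i) p q * N (b i) q p * y q) = 0"
        unfolding y_def by (simp add: fdiff of_rat_diff right_diff_distrib sum_subtractf)
      moreover have "(\<Sum>p<n. \<Sum>q<n. N (a i) p q * N (b i) q p * y q)
         = (\<Sum>p<n. \<Sum>q<n. N (b i) p q * N (a i) q p * y p)"
        by (subst sum.swap) (simp add: mult.commute)
      ultimately show ?thesis
        unfolding comm_def N_diff
        by (simp add: N_comp[OF a[OF i], where g = "b i"] N_comp[OF b[OF i], where g = "a i"] left_diff_distrib sum_subtractf sum_distrib_right)
    qed
    then have "(\<Sum>i\<in>I. \<Sum>p<n. N (comm (a i) (b i)) p p * y p) = 0" by simp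
    then have "(\<Sum>p<n. (\<Sum>i\<in>I. N (comm (a i) (b i)) p p) * y p) = 0"
      by (subst (asm) sum.swap) (simp add: sum_distrib_right)
    then have "(\<Sum>p<n. y p * N x p p) = 0"
      using Nsum[OF I] by (subst xsum) (simp add: mult.commute)
    then have "f (\<Sum>p<n. y p * N x p p) = 0" using f0 by simp
    then have "(\<Sum>p<n. (f (N x p p))\<^sup>2) = 0"
      unfolding fsum y_def f(2) by (simp add: power2_eq_square)
    then have "(f (N x m m))\<^sup>2 = 0"
      using m by (subst (asm) sum_nonneg_eq_0_iff) auto
    then show False using f(3) by simp
  qed
  \<comment> \<open>With zero diagonal, \<open>x\<close> is strictly upper triangular and each
    factor moves the support up by one diagonal. At k = 0 this says that the identity has no entries
    below the diagonal.\<close>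
  have "N (x ^^ k) i j = 0" if "j < i + k" for i j k
    using that
  proof (induction k arbitrary: i j)
    case 0
    show ?case
    proof (cases "i < n")
      case True
      have "N (\<lambda>v. v) i j = (\<Sum>l<n. N (\<lambda>v. v) i l * N (\<lambda>v. v) l j)" if "j < n"
        using N_comp[OF lin_id True that] .
      have "C (\<lambda>v. v) = Q * 1\<^sub>m n * P"
      proof -
        have "M (\<lambda>v. v) = 1\<^sub>m n"
        proof (rule eq_matI)
          fix i j assume "i < dim_row (1\<^sub>m n)" "j < dim_col (1\<^sub>m n)"
          then show "M (\<lambda>v. v) $$ (i, j) = 1\<^sub>m n $$ (i, j)"
            unfolding M_def rep_def using basis_indep bs
            by (auto simp: representation_basis n_def nth_eq_iff_index_eq)
        qed (simp_all add: M_def)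
        then show ?thesis unfolding C_def by simp
      qed
      then have "C (\<lambda>v. v) = 1\<^sub>m n" using PQ inv(2) by simp
      then show ?thesis unfolding N_def using 0 True by (simp add: id_def)
    qed (simp add: N_out)
  next
    case (Suc k)
    have s: "x ^^ Suc k = (\<lambda>v. x ((x ^^ k) v))" by auto
    show ?case
    proof (cases "i < n \<and> j < n")
      case True
      have "N x i l * N (x ^^ k) l j = 0" if "l < n" for l
      proof (cases "l \<le> i")
        case True
        then have "N x i l = 0"
          using upperN[of i l] diag0[of i] \<open>i < n \<and> j < n\<close> by (cases "l = i") auto
        then show ?thesis by simp
      next
        case False
        then show ?thesis using Suc.IH[of j l] Suc.prems by simp
      qed
      then have "(\<Sum>l<n. N x i l * N (x ^^ k) l j) = 0" by (intro sum.neutral) auto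
      then show ?thesis unfolding s using True N_comp[OF x, of i j "x ^^ k"] by simp
    qed (simp add: N_out)
  qed
  then have "N (x ^^ n) i j = 0" for i j using N_out[of i j] by (cases "j < n") auto
  then have "(x ^^ n) v = 0" for v by (rule N_zero[OF lin_funpow[OF x]])
  then show thesis by (rule that)
qed

end

section \<open>Nilpotency and Cartan's criterion\<close>

locale lie_space = fin_dim_space scale Basis + lie_algebra scale br
  for scale :: "'k::field_char_0 \<Rightarrow> 'v::ab_group_add \<Rightarrow> 'v" and Basis :: "'v set"
    and br :: "'v \<Rightarrow> 'v \<Rightarrow> 'v"
begin

lemma br_lin: "lin (br x)" "lin (\<lambda>x. br x y)"
  using bilinear unfolding bilinear_product_def by simp_all

lemma br_add: "br (x + y) z = br x z + br y z" "br x (y + z) = br x y + br x z"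
  using lin_addD[OF br_lin(1)] lin_addD[OF br_lin(2)] by auto

lemma br_scale: "br (scale c x) y = scale c (br x y)" "br x (scale c y) = scale c (br x y)"
  using lin_scaleD[OF br_lin(1)] lin_scaleD[OF br_lin(2)] by auto

lemma br_diff: "br (x - y) z = br x z - br y z" "br x (y - z) = br x y - br x z"
  using lin_diffD[OF br_lin(1)] lin_diffD[OF br_lin(2)] by auto

lemma br_minus: "br (- x) z = - br x z" "br x (- z) = - br x z"
  using lin_minusD[OF br_lin(1)] lin_minusD[OF br_lin(2)] by auto

lemma br_zero: "br 0 z = 0" "br x 0 = 0"
  using lin_zeroD[OF br_lin(1)] lin_zeroD[OF br_lin(2)] by auto

lemma br_anti: "br y x = - br x y"
proof -
  have "br (x + y) (x + y) = br x y + br y x"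
    unfolding br_add by (simp add: alternating add.commute)
  then have "br x y + br y x = 0" by (simp add: alternating)
  then show ?thesis by (simp add: eq_neg_iff_add_eq_0 add.commute)
qed

lemma br_br_left: "br (br x y) z = br x (br y z) - br y (br x z)"
proof -
  have "br (br x y) z = - br z (br x y)" by (rule br_anti)
  also have "\<dots> = br x (br y z) + br y (br z x)" using jacobi[of x y z] by (simp add: add_eq_0_iff2)
  also have "br y (br z x) = - br y (br x z)" by (simp add: br_anti[of z x] br_minus)
  finally show ?thesis by simp
qed

lemma br_br_right: "br x (br y z) = br (br x y) z + br y (br x z)"
  using br_br_left[of x y z] by simp

subsection \<open>Ideals and the derived series\<close>

definition subalg :: "'v set \<Rightarrow> bool"
  where "subalg S \<longleftrightarrow> subspace S \<and> (\<forall>x\<in>S. \<forall>y\<in>S. br x y \<in> S)"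

lemma ideal_subspace: "lie_ideal I \<Longrightarrow> subspace I"
  and ideal_br: "lie_ideal I \<Longrightarrow> y \<in> I \<Longrightarrow> br x y \<in> I"
  unfolding lie_ideal_def by auto

lemma ideal_br': "lie_ideal I \<Longrightarrow> y \<in> I \<Longrightarrow> br y x \<in> I"
  using ideal_br[of I y x] subspace_neg[of I "br x y"] by (simp add: ideal_subspace br_anti[of y x])

lemma ideal_subalg: "lie_ideal I \<Longrightarrow> subalg I"
  unfolding subalg_def by (simp add: ideal_subspace ideal_br)

lemma ideal_Int: "lie_ideal I \<Longrightarrow> lie_ideal J \<Longrightarrow> lie_ideal (I \<inter> J)"
  unfolding lie_ideal_def by (simp add: subspace_inter)

lemma derived_mono: "S \<subseteq> T \<Longrightarrow> derived S \<subseteq> derived T"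
  unfolding derived_def by (intro span_mono) auto

lemma derived_pow_mono: "S \<subseteq> T \<Longrightarrow> (derived ^^ k) S \<subseteq> (derived ^^ k) T"
  by (induction k) (simp_all add: derived_mono)

lemma br_mem_derived: "x \<in> S \<Longrightarrow> y \<in> S \<Longrightarrow> br x y \<in> derived S"
  unfolding derived_def by (intro span_base) auto

lemma derived_subspace: "subspace (derived S)"
  unfolding derived_def by (rule subspace_span)

lemma derived_least: "subspace T \<Longrightarrow> (\<And>x y. x \<in> S \<Longrightarrow> y \<in> S \<Longrightarrow> br x y \<in> T) \<Longrightarrow> derived S \<subseteq> T"
  unfolding derived_def by (intro span_minimal) auto

lemma derived_pow_subspace: "subspace S \<Longrightarrow> subspace ((derived ^^ k) S)"
  by (cases k) (simp_all add: derived_subspace)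

lemma subalg_derived_subset: "subalg S \<Longrightarrow> derived S \<subseteq> S"
  unfolding subalg_def by (intro derived_least) auto

lemma subalg_derived: "subalg S \<Longrightarrow> subalg (derived S)"
  using subalg_derived_subset[of S] br_mem_derived[of _ S] derived_subspace
  unfolding subalg_def by blast

lemma ideal_derived:
  assumes "lie_ideal I"
  shows "lie_ideal (derived I)"
  unfolding lie_ideal_def
proof (intro conjI allI ballI)
  show "subspace (derived I)" by (rule derived_subspace)
  fix x y assume "y \<in> derived I"
  then show "br x y \<in> derived I"
    unfolding derived_def
  proof (rule lin_span_mem[OF br_lin(1) _ subspace_span, rotated])
    fix s assume "s \<in> {br x y |x y. x \<in> I \<and> y \<in> I}"
    then obtain a b where s: "s = br a b" "a \<in> I" "b \<in> I" by auto
    have "br (br x a) b \<in> span {br x y |x y. x \<in> I \<and> y \<in> I}"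
      "br a (br x b) \<in> span {br x y |x y. x \<in> I \<and> y \<in> I}"
      using s ideal_br[OF assms] by (auto intro!: span_base)
    then show "br x s \<in> span {br x y |x y. x \<in> I \<and> y \<in> I}"
      unfolding s(1) br_br_right[of x a b] by (rule span_add)
  qed
qed

lemma ideal_derived_pow: "lie_ideal I \<Longrightarrow> lie_ideal ((derived ^^ k) I)"
  by (induction k) (simp_all add: ideal_derived)

lemma solvable_if_derived_subset:
  assumes "subspace J" "(derived ^^ k) J \<subseteq> r" "solvable r"
  shows "solvable J"
proof -
  obtain l where l: "(derived ^^ l) r = {0}" using assms(3) unfolding solvable_def by blast
  have "(derived ^^ (l + k)) J \<subseteq> {0}"
    using derived_pow_mono[OF assms(2), of l] l by (simp add: funpow_add)
  moreover have "0 \<in> (derived ^^ (l + k)) J"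
    by (rule subspace_0[OF derived_pow_subspace[OF assms(1)]])
  ultimately show ?thesis unfolding solvable_def by blast
qed

lemma ideal_sum:
  assumes "lie_ideal I" "lie_ideal J"
  shows "lie_ideal {x + y |x y. x \<in> I \<and> y \<in> J}"
proof -
  have "br z (x + y) \<in> {x + y |x y. x \<in> I \<and> y \<in> J}" if "x \<in> I" "y \<in> J" for x y z
    using ideal_br[OF assms(1) that(1), of z] ideal_br[OF assms(2) that(2), of z] by (auto simp: br_add)
  then show ?thesis
    unfolding lie_ideal_def using subspace_sums[OF ideal_subspace ideal_subspace, OF assms] by auto
qed

text \<open>Modulo \<open>J\<close> the derived series of the sum is that of \<open>I\<close>, so it
  ends inside \<open>J\<close>.\<close>

lemma solvable_sum:
  assumes I: "lie_ideal I" "solvable I" and J: "lie_ideal J" "solvable J"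
  shows "solvable {x + y |x y. x \<in> I \<and> y \<in> J}" (is "solvable ?S")
proof -
  have *: "(derived ^^ k) ?S \<subseteq> {x + y |x y. x \<in> (derived ^^ k) I \<and> y \<in> J}" for k
  proof (induction k)
    case (Suc k)
    let ?T = "{x + y |x y. x \<in> derived ((derived ^^ k) I) \<and> y \<in> J}"
    have "derived ((derived ^^ k) ?S) \<subseteq> ?T"
    proof (rule derived_least)
      show "subspace ?T" by (rule subspace_sums[OF derived_subspace ideal_subspace[OF J(1)]])
      fix u v assume "u \<in> (derived ^^ k) ?S" "v \<in> (derived ^^ k) ?S"
      then obtain a b c d where u: "u = a + b" "a \<in> (derived ^^ k) I" "b \<in> J"
        and v: "v = c + d" "c \<in> (derived ^^ k) I" "d \<in> J" using Suc by blast
      have "br u v = br a c + (br a d + br b v)" unfolding u v by (simp add: br_add algebra_simps)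
      moreover have "br a c \<in> derived ((derived ^^ k) I)" using u v by (intro br_mem_derived)
      moreover have "br a d + br b v \<in> J"
        using u v ideal_br[OF J(1)] ideal_br'[OF J(1)] by (intro subspace_add ideal_subspace[OF J(1)])
      ultimately show "br u v \<in> ?T" by blast
    qed
    then show ?case by simp
  qed auto
  obtain k where "(derived ^^ k) I = {0}" using I(2) unfolding solvable_def by blast
  then have "(derived ^^ k) ?S \<subseteq> J" using *[of k] by auto
  then show ?thesis
    by (rule solvable_if_derived_subset[OF ideal_subspace[OF ideal_sum[OF I(1) J(1)]] _ J(2)])
qed

text \<open>The maximality through which the radical is used. A predicate also allows
  \<open>{0}\<close> to be presented as the radical of a semisimple algebra.\<close>

definition is_radical :: "'v set \<Rightarrow> bool"
  where "is_radical r \<longleftrightarrow> lie_ideal r \<and> solvable r \<and> (\<forall>I. lie_ideal I \<longrightarrow> solvable I \<longrightarrow> I \<subseteq> r)"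

text \<open>A solvable ideal of maximal dimension absorbs every other one, since their sum is again
  solvable.\<close>

lemma is_radical_radical: "is_radical radical"
proof -
  let ?A = "{I. lie_ideal I \<and> solvable I}"
  have "lie_ideal {0}" unfolding lie_ideal_def by (simp add: subspace_single_0 br_zero)
  moreover have "solvable {0}" unfolding solvable_def by (intro exI[of _ 0]) simp
  ultimately have zero: "{0} \<in> ?A" by simp
  define N where "N = Max (dim ` ?A)"
  have fin: "finite (dim ` ?A)"
    by (rule finite_subset[of _ "{..dimension}"]) (auto simp: dim_subset_UNIV)
  have "N \<in> dim ` ?A" unfolding N_def using zero by (intro Max_in fin) auto
  then obtain r where r: "lie_ideal r" "solvable r" "dim r = N" by auto
  have max: "I \<subseteq> r" if I: "lie_ideal I" "solvable I" for I
  proof -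
    let ?S = "{x + y |x y. x \<in> r \<and> y \<in> I}"
    have S: "lie_ideal ?S" "solvable ?S"
      using ideal_sum[OF r(1) I(1)] solvable_sum[OF r(1,2) I] by auto
    then have "dim ?S \<le> dim r" unfolding r(3) N_def using fin by (intro Max_ge) auto
    moreover have "r \<subseteq> ?S" using subspace_0[OF ideal_subspace[OF I(1)]] by force
    ultimately have "r = ?S"
      by (intro subspace_dim_equal ideal_subspace r(1) S(1)) auto
    moreover have "I \<subseteq> ?S" using subspace_0[OF ideal_subspace[OF r(1)]] by force
    ultimately show ?thesis by simp
  qed
  have "radical = r"
    unfolding radical_def
  proof
    show "span (\<Union> ?A) \<subseteq> r" using max by (intro span_minimal ideal_subspace r(1)) auto
    show "r \<subseteq> span (\<Union> ?A)" using r span_superset[of "\<Union> ?A"] by blast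
  qed
  then show ?thesis unfolding is_radical_def using r max by auto
qed

subsection \<open>Representations\<close>

text \<open>All modules live on the whole space: a subquotient \<open>U/W\<close> is represented by the operators
  \<open>q \<circ> \<rho> x \<circ> q\<close>, where \<open>q\<close> projects onto a complement of \<open>W\<close> in \<open>U\<close>.\<close>

definition lie_rep :: "('v \<Rightarrow> 'v \<Rightarrow> 'v) \<Rightarrow> bool"
  where "lie_rep \<rho> \<longleftrightarrow> (\<forall>x. lin (\<rho> x)) \<and> (\<forall>v. lin (\<lambda>x. \<rho> x v)) \<and>
    (\<forall>x y v. \<rho> (br x y) v = \<rho> x (\<rho> y v) - \<rho> y (\<rho> x v))"

lemma rep_lin1: "lie_rep \<rho> \<Longrightarrow> lin (\<rho> x)"
  and rep_lin2: "lie_rep \<rho> \<Longrightarrow> lin (\<lambda>x. \<rho> x v)"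
  and rep_br: "lie_rep \<rho> \<Longrightarrow> \<rho> (br x y) v = \<rho> x (\<rho> y v) - \<rho> y (\<rho> x v)"
  unfolding lie_rep_def by auto

lemma lie_rep_br: "lie_rep br"
  unfolding lie_rep_def using br_lin br_br_left by auto

lemma lie_rep_subquotient:
  assumes \<rho>: "lie_rep \<rho>" and q: "lin q" "\<And>v. q v \<in> U" "\<And>w. w \<in> W \<Longrightarrow> q w = 0" "\<And>u. u \<in> U \<Longrightarrow> u - q u \<in> W" "\<And>v. q (q v) = q v"
    and U: "\<And>x u. u \<in> U \<Longrightarrow> \<rho> x u \<in> U" and W: "\<And>x w. w \<in> W \<Longrightarrow> \<rho> x w \<in> W"
  shows "lie_rep (\<lambda>x v. q (\<rho> x (q v)))"
proof -
  \<comment> \<open>Dropping the inner \<open>q\<close> changes the argument by an element of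
    \<open>W\<close>, which \<rho> x keeps in \<open>W\<close> and the outer \<open>q\<close>
    kills.\<close>
  have *: "q (\<rho> x (q (\<rho> y (q v)))) = q (\<rho> x (\<rho> y (q v)))" for x y v
  proof -
    have "\<rho> y (q v) - q (\<rho> y (q v)) \<in> W" by (intro q(4) U q(2))
    then have "q (\<rho> x (\<rho> y (q v) - q (\<rho> y (q v)))) = 0" by (intro q(3) W)
    then show ?thesis by (simp add: lin_diffD[OF rep_lin1[OF \<rho>]] lin_diffD[OF q(1)])
  qed
  show ?thesis
    unfolding lie_rep_def
  proof (intro conjI allI)
    fix x show "lin (\<lambda>v. q (\<rho> x (q v)))"
      by (rule lin_comp[OF q(1) lin_comp[OF rep_lin1[OF \<rho>] q(1)]])
  next
    fix v show "lin (\<lambda>x. q (\<rho> x (q v)))"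
      by (rule lin_comp[OF q(1) rep_lin2[OF \<rho>]])
  next
    fix x y v
    show "q (\<rho> (br x y) (q v)) = q (\<rho> x (q (q (\<rho> y (q v))))) - q (\<rho> y (q (q (\<rho> x (q v)))))"
    proof -
      show ?thesis unfolding q(5) * rep_br[OF \<rho>] by (simp add: lin_diffD[OF q(1)])
    qed
  qed
qed

subsection \<open>Engel's theorem\<close>

text \<open>Level \<open>j\<close> consists of the vectors killed by all products of
  \<open>j\<close> operators from \<open>H\<close>; reaching the whole space means that
  \<open>H\<close> acts by simultaneously nilpotent operators.\<close>

primrec ann_chain :: "('v \<Rightarrow> 'v \<Rightarrow> 'v) \<Rightarrow> 'v set \<Rightarrow> nat \<Rightarrow> 'v set"
  where "ann_chain \<rho> H 0 = {0}"
  | "ann_chain \<rho> H (Suc j) = {v. \<forall>x\<in>H. \<rho> x v \<in> ann_chain \<rho> H j}"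

context
  fixes \<rho> :: "'v \<Rightarrow> 'v \<Rightarrow> 'v" and H :: "'v set"
  assumes \<rho>: "lie_rep \<rho>"
begin

lemma ann_chain_subspace: "subspace (ann_chain \<rho> H j)"
proof (induction j)
  case (Suc j)
  have "ann_chain \<rho> H (Suc j) = \<Inter> ((\<lambda>x. {v. \<rho> x v \<in> ann_chain \<rho> H j}) ` H)" by auto
  moreover have "subspace \<dots>"
    by (rule subspace_Inter) (use subspace_vimage[OF rep_lin1[OF \<rho>] Suc] in auto)
  ultimately show ?case by simp
qed (simp add: subspace_single_0)

lemma ann_chain_Suc: "ann_chain \<rho> H j \<subseteq> ann_chain \<rho> H (Suc j)"
  by (induction j) (auto simp: lin_zeroD[OF rep_lin1[OF \<rho>]])

lemma ann_chain_mono: "i \<le> j \<Longrightarrow> ann_chain \<rho> H i \<subseteq> ann_chain \<rho> H j"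
  by (rule lift_Suc_mono_le[of "ann_chain \<rho> H"]) (use ann_chain_Suc in auto)

lemma ann_chain_lower:
  "x \<in> H \<Longrightarrow> v \<in> ann_chain \<rho> H j \<Longrightarrow> \<rho> x v \<in> ann_chain \<rho> H (j - 1)"
  by (cases j) (auto simp: lin_zeroD[OF rep_lin1[OF \<rho>]])

lemma ann_chain_invariant:
  "x \<in> H \<Longrightarrow> v \<in> ann_chain \<rho> H j \<Longrightarrow> \<rho> x v \<in> ann_chain \<rho> H j"
  using ann_chain_lower ann_chain_mono[of "j - 1" j] by auto

lemma ann_chain_exhausts:
  assumes "\<And>j. ann_chain \<rho> H j \<noteq> UNIV \<Longrightarrow>
    \<exists>u. u \<notin> ann_chain \<rho> H j \<and> (\<forall>x\<in>H. \<rho> x u \<in> ann_chain \<rho> H j)"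
  obtains k where "ann_chain \<rho> H k = UNIV"
proof -
  let ?Z = "ann_chain \<rho> H"
  have "dim (?Z j) \<le> dim (?Z (Suc j))" for j by (rule dim_subset[OF ann_chain_Suc])
  moreover have "dim (?Z j) \<le> dimension" for j by (rule dim_subset_UNIV)
  ultimately obtain k where "dim (?Z (Suc k)) = dim (?Z k)" by (rule mono_bounded_stable)
  then have eq: "?Z (Suc k) = ?Z k"
    using subspace_dim_equal[OF ann_chain_subspace ann_chain_subspace
        ann_chain_Suc, of k] by simp
  have "?Z k = UNIV"
  proof (rule ccontr)
    assume "?Z k \<noteq> UNIV"
    then obtain u where "u \<notin> ?Z k" "u \<in> ?Z (Suc k)" using assms[of k] by auto
    then show False unfolding eq by simp
  qed
  then show thesis by (rule that)
qed

end

text \<open>Engel's conclusion for every invariant subquotient U/W at once, which replaces passing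
  to quotient modules. The case U = UNIV is what makes \<open>ann_chain\<close> grow.\<close>

definition engel_property :: "('v \<Rightarrow> 'v \<Rightarrow> 'v) \<Rightarrow> 'v set \<Rightarrow> bool"
  where "engel_property \<rho> H \<longleftrightarrow> (\<forall>W U. subspace W \<longrightarrow> subspace U \<longrightarrow> W \<subset> U \<longrightarrow>
    (\<forall>x\<in>H. (\<forall>w\<in>W. \<rho> x w \<in> W) \<and> (\<forall>u\<in>U. \<rho> x u \<in> U)) \<longrightarrow>
    (\<exists>u\<in>U. u \<notin> W \<and> (\<forall>x\<in>H. \<rho> x u \<in> W)))"

lemma engel_propertyD:
  assumes "engel_property \<rho> H" "subspace W" "subspace U" "W \<subset> U"
    "\<And>x w. x \<in> H \<Longrightarrow> w \<in> W \<Longrightarrow> \<rho> x w \<in> W" "\<And>x u. x \<in> H \<Longrightarrow> u \<in> U \<Longrightarrow> \<rho> x u \<in> U"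
  obtains u where "u \<in> U" "u \<notin> W" "\<And>x. x \<in> H \<Longrightarrow> \<rho> x u \<in> W"
proof -
  have "\<forall>x\<in>H. (\<forall>w\<in>W. \<rho> x w \<in> W) \<and> (\<forall>u\<in>U. \<rho> x u \<in> U)" using assms(5,6) by simp
  then have "\<exists>u\<in>U. u \<notin> W \<and> (\<forall>x\<in>H. \<rho> x u \<in> W)"
    using assms(1)[unfolded engel_property_def, rule_format, OF assms(2-4)] by simp
  then show thesis using that by auto
qed

lemma engel_propertyI:
  assumes "\<And>W U. subspace W \<Longrightarrow> subspace U \<Longrightarrow> W \<subset> U \<Longrightarrow> (\<And>x w. x \<in> H \<Longrightarrow> w \<in> W \<Longrightarrow> \<rho> x w \<in> W) \<Longrightarrow>
    (\<And>x u. x \<in> H \<Longrightarrow> u \<in> U \<Longrightarrow> \<rho> x u \<in> U) \<Longrightarrow> \<exists>u. u \<in> U \<and> u \<notin> W \<and> (\<forall>x\<in>H. \<rho> x u \<in> W)"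
  shows "engel_property \<rho> H"
  unfolding engel_property_def
proof (intro allI impI)
  fix W U assume "subspace W" "subspace U" "W \<subset> U"
    "\<forall>x\<in>H. (\<forall>w\<in>W. \<rho> x w \<in> W) \<and> (\<forall>u\<in>U. \<rho> x u \<in> U)"
  then have "\<exists>u. u \<in> U \<and> u \<notin> W \<and> (\<forall>x\<in>H. \<rho> x u \<in> W)" by (intro assms) simp_all
  then show "\<exists>u\<in>U. u \<notin> W \<and> (\<forall>x\<in>H. \<rho> x u \<in> W)" by auto
qed

lemma engel_property_exhausts:
  assumes \<rho>: "lie_rep \<rho>" and "engel_property \<rho> H"
  obtains k where "ann_chain \<rho> H k = UNIV"
proof (rule ann_chain_exhausts[OF \<rho>])
  fix j assume ne: "ann_chain \<rho> H j \<noteq> UNIV"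
  show "\<exists>u. u \<notin> ann_chain \<rho> H j \<and> (\<forall>x\<in>H. \<rho> x u \<in> ann_chain \<rho> H j)"
  proof -
    have "ann_chain \<rho> H j \<subset> UNIV" using ne by auto
    then obtain u where "u \<notin> ann_chain \<rho> H j" "\<And>x. x \<in> H \<Longrightarrow> \<rho> x u \<in> ann_chain \<rho> H j"
      by (rule engel_propertyD[OF assms(2) ann_chain_subspace[OF \<rho>] subspace_UNIV])
        (auto intro: ann_chain_invariant[OF \<rho>])
    then show ?thesis by auto
  qed
qed (rule that)

text \<open>Bracketing with \<open>H0\<close> sufficiently often kills every operator, so that iterated brackets of
  \<open>x0\<close> with \<open>H0\<close> eventually fall into \<open>H0\<close>.\<close>

lemma engel_normalizer:
  assumes \<rho>: "lie_rep \<rho>" and H: "subalg H" and H0: "H0 \<subseteq> H" "engel_property \<rho> H0"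
    and ker: "\<And>x. x \<in> H \<Longrightarrow> (\<And>v. \<rho> x v = 0) \<Longrightarrow> x \<in> H0" and x0: "x0 \<in> H - H0"
  shows "\<exists>x\<in>H - H0. \<forall>h\<in>H0. br h x \<in> H0"
proof (rule ccontr)
  assume "\<not> ?thesis"
  then have ex: "\<exists>h\<in>H0. br h x \<notin> H0" if "x \<in> H - H0" for x using that by blast
  let ?Z = "ann_chain \<rho> H0"
  obtain k where k: "?Z k = UNIV" by (rule engel_property_exhausts[OF \<rho> H0(2)])
  have lower: "\<And>x v j. x \<in> H0 \<Longrightarrow> v \<in> ?Z j \<Longrightarrow> \<rho> x v \<in> ?Z (j - 1)"
    by (rule ann_chain_lower[OF \<rho>])
  \<comment> \<open>A degree filtration: \<open>x\<close> in \<open>D m\<close> sends level j to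
    level j + k - m. The shift by \<open>k\<close> makes \<open>D 0\<close> everything in spite of
    truncated subtraction; at m = 2k, level k (the whole space) goes to level 0, so the operator
    vanishes.\<close>
  define D where "D m = {x. \<forall>j. \<forall>v\<in>?Z j. \<rho> x v \<in> ?Z (j + k - m)}" for m
  have D0: "x \<in> D 0" for x
    unfolding D_def
  proof (intro CollectI allI ballI)
    fix j v
    have "?Z k \<subseteq> ?Z (j + k)" by (rule ann_chain_mono[OF \<rho>]) simp
    then show "\<rho> x v \<in> ?Z (j + k - 0)" unfolding k by auto
  qed
  have DS: "br h x \<in> D (Suc m)" if h: "h \<in> H0" and x: "x \<in> D m" for h x m
    unfolding D_def
  proof (intro CollectI allI ballI)
    fix j v assume v: "v \<in> ?Z j"
    have "\<rho> x v \<in> ?Z (j + k - m)" using x v unfolding D_def by auto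
    then have 1: "\<rho> h (\<rho> x v) \<in> ?Z (j + k - Suc m)" using lower[OF h] by fastforce
    have 2: "\<rho> x (\<rho> h v) \<in> ?Z (j + k - Suc m)"
    proof (cases j)
      case 0
      then have "\<rho> x (\<rho> h v) = 0" using v by (simp add: lin_zeroD[OF rep_lin1[OF \<rho>]])
      then show ?thesis using subspace_0[OF ann_chain_subspace[OF \<rho>]] by simp
    next
      case (Suc i)
      then have "\<rho> h v \<in> ?Z i" using lower[OF h v] by simp
      then show ?thesis using x Suc unfolding D_def by auto
    qed
    show "\<rho> (br h x) v \<in> ?Z (j + k - Suc m)"
      unfolding rep_br[OF \<rho>] using 1 2 by (rule subspace_diff[OF ann_chain_subspace[OF \<rho>]])
  qed
  have "\<exists>x\<in>H - H0. x \<in> D m" for m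
  proof (induction m)
    case 0
    then show ?case using x0 D0 by blast
  next
    case (Suc m)
    then obtain x where x: "x \<in> H - H0" "x \<in> D m" by blast
    then obtain h where h: "h \<in> H0" "br h x \<notin> H0" using ex by blast
    then have "br h x \<in> H - H0" using x H H0(1) unfolding subalg_def by auto
    then show ?case using DS[OF h(1) x(2)] by blast
  qed
  then obtain x where x: "x \<in> H - H0" "x \<in> D (2 * k)" by blast
  have "\<rho> x v = 0" for v
  proof -
    have "\<rho> x v \<in> ?Z (k + k - 2 * k)" using x(2) k unfolding D_def by blast
    then show ?thesis by simp
  qed
  then show False using ker x(1) by blast
qed

text \<open>The Engel property passes from a subalgebra to the span of it and one idealizing element, so
  a subalgebra of maximal dimension with this property is everything.\<close>

theorem engel:
  assumes \<rho>: "lie_rep \<rho>" and H: "subalg H" and nil: "\<And>x. x \<in> H \<Longrightarrow> \<exists>k. \<forall>v. (\<rho> x ^^ k) v = 0"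
  shows "engel_property \<rho> H"
proof -
  let ?A = "{H0. H0 \<subseteq> H \<and> subalg H0 \<and> engel_property \<rho> H0}"
  have "engel_property \<rho> {0}"
    by (rule engel_propertyI) (use subspace_0 in \<open>auto simp: lin_zeroD[OF rep_lin2[OF \<rho>]]\<close>)
  then have "{0} \<in> ?A"
    using H subspace_0 unfolding subalg_def by (auto simp: subspace_single_0 br_zero)
  moreover define N where "N = Max (dim ` ?A)"
  have fin: "finite (dim ` ?A)"
    by (rule finite_subset[of _ "{..dimension}"]) (auto simp: dim_subset_UNIV)
  ultimately have "N \<in> dim ` ?A" by (simp only: N_def) (intro Max_in fin, auto)
  then obtain H0 where H0: "H0 \<subseteq> H" "subalg H0" "engel_property \<rho> H0" "dim H0 = N" by auto
  have max: "H1 = H0" if "H0 \<subseteq> H1" "H1 \<in> ?A" for H1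
  proof -
    have "dim H1 \<le> dim H0" unfolding H0(4) N_def using that fin by (intro Max_ge) auto
    then show ?thesis
      using subspace_dim_equal[of H0 H1] H0(2) that unfolding subalg_def by auto
  qed
  note sH = H[unfolded subalg_def, THEN conjunct1] and sH0 = H0(2)[unfolded subalg_def, THEN conjunct1]
  have cH: "\<And>x y. x \<in> H \<Longrightarrow> y \<in> H \<Longrightarrow> br x y \<in> H" and cH0: "\<And>x y. x \<in> H0 \<Longrightarrow> y \<in> H0 \<Longrightarrow> br x y \<in> H0"
    using H H0(2) unfolding subalg_def by auto
  have r0: "\<rho> x 0 = 0" for x by (rule lin_zeroD[OF rep_lin1[OF \<rho>]])
  have radd: "\<rho> (x + y) v = \<rho> x v + \<rho> y v" and rsc: "\<rho> (scale c x) v = scale c (\<rho> x v)" for x y v c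
    using lin_addD[OF rep_lin2[OF \<rho>]] lin_scaleD[OF rep_lin2[OF \<rho>]] by auto
  \<comment> \<open>Adding elements that act as zero preserves the Engel property, so the maximal
    \<open>H0\<close> already contains them, as \<open>engel_normalizer\<close> demands.\<close>
  have ker: "x \<in> H0" if x: "x \<in> H" "\<And>v. \<rho> x v = 0" for x
  proof -
    let ?K = "{x\<in>H. \<forall>v. \<rho> x v = 0}"
    let ?S = "{x + y |x y. x \<in> H0 \<and> y \<in> ?K}"
    have sK: "subspace ?K"
      using sH unfolding subspace_def by (auto simp: radd rsc lin_zeroD[OF rep_lin2[OF \<rho>]])
    have "subalg ?S"
      unfolding subalg_def
    proof (intro conjI ballI)
      show "subspace ?S" by (rule subspace_sums[OF sH0 sK])
      fix u v assume "u \<in> ?S" "v \<in> ?S"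
      then obtain a b c d where u: "u = a + b" "a \<in> H0" "b \<in> ?K" and v: "v = c + d" "c \<in> H0" "d \<in> ?K"
        by blast
      have "br u v = br a c + (br a d + br b v)" unfolding u v by (simp add: br_add algebra_simps)
      moreover have "br a d + br b v \<in> ?K"
        using u v H0(1) cH by (auto simp: radd rep_br[OF \<rho>] r0 intro!: subspace_add[OF sH])
      ultimately show "br u v \<in> ?S" using cH0[OF u(2) v(2)] by blast
    qed
    moreover have "?S \<subseteq> H" using H0(1) by (auto intro!: subspace_add[OF sH])
    moreover have sub: "H0 \<subseteq> ?S" using subspace_0[OF sK] by force
    moreover have "engel_property \<rho> ?S"
    proof (rule engel_propertyI)
      fix W U assume WU: "subspace W" "subspace U" "W \<subset> U"
        and inv: "\<And>x w. x \<in> ?S \<Longrightarrow> w \<in> W \<Longrightarrow> \<rho> x w \<in> W" "\<And>x u. x \<in> ?S \<Longrightarrow> u \<in> U \<Longrightarrow> \<rho> x u \<in> U"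
      obtain u where "u \<in> U" "u \<notin> W" "\<And>x. x \<in> H0 \<Longrightarrow> \<rho> x u \<in> W"
        by (rule engel_propertyD[OF H0(3) WU inv[OF subsetD[OF sub]]]) blast+
      then show "\<exists>u. u \<in> U \<and> u \<notin> W \<and> (\<forall>x\<in>?S. \<rho> x u \<in> W)" by (intro exI[of _ u]) (auto simp: radd)
    qed
    ultimately have "?S = H0" by (intro max) auto
    moreover have "x \<in> ?S" using x subspace_0[OF sH0] by force
    ultimately show ?thesis by simp
  qed
  have "H0 = H"
  proof (rule ccontr)
    assume "H0 \<noteq> H"
    then obtain x0 where "x0 \<in> H - H0" using H0(1) by blast
    from engel_normalizer[OF \<rho> H H0(1,3) ker this]
    obtain x where x: "x \<in> H" "x \<notin> H0" "\<And>h. h \<in> H0 \<Longrightarrow> br h x \<in> H0" by blast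
    have x': "br x h \<in> H0" if "h \<in> H0" for h
      using x(3)[OF that] subspace_neg[OF sH0] by (simp add: br_anti[of x h])
    let ?S = "span (insert x H0)"
    have S: "u \<in> ?S \<longleftrightarrow> (\<exists>c. u - scale c x \<in> H0)" for u
      by (simp add: span_insert span_eq_iff[THEN iffD2, OF sH0])
    have Sdec: "\<exists>c h. u = h + scale c x \<and> h \<in> H0" if "u \<in> ?S" for u
      using that unfolding S by (metis diff_add_cancel)
    have sub: "H0 \<subseteq> ?S" by (meson span_superset subset_insertI subset_trans)
    have "subalg ?S"
      unfolding subalg_def
    proof (intro conjI ballI)
      show "subspace ?S" by (rule subspace_span)
      fix u v assume "u \<in> ?S" "v \<in> ?S"
      then obtain a c b d where u: "u = a + scale c x" "a \<in> H0" and v: "v = b + scale d x" "b \<in> H0"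
        using Sdec by metis
      have "br u v = br a b + scale d (br a x) + scale c (br x b)"
        unfolding u v by (simp add: br_add br_scale alternating)
      also have "\<dots> \<in> H0"
        using u v x(3) x' cH0 by (intro subspace_add[OF sH0] subspace_scale[OF sH0]) auto
      finally show "br u v \<in> ?S" using sub by blast
    qed
    moreover have "?S \<subseteq> H" using x(1) H0(1) by (intro span_minimal sH) auto
    moreover have "engel_property \<rho> ?S"
    proof (rule engel_propertyI)
      fix W U assume W: "subspace W" and U: "subspace U" and WU: "W \<subset> U"
        and inv: "\<And>x w. x \<in> ?S \<Longrightarrow> w \<in> W \<Longrightarrow> \<rho> x w \<in> W" "\<And>x u. x \<in> ?S \<Longrightarrow> u \<in> U \<Longrightarrow> \<rho> x u \<in> U"
      obtain u0 where u0: "u0 \<in> U" "u0 \<notin> W" "\<And>h. h \<in> H0 \<Longrightarrow> \<rho> h u0 \<in> W"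
        by (rule engel_propertyD[OF H0(3) W U WU inv[OF subsetD[OF sub]]]) blast+
      have "x \<in> ?S" by (rule span_base) simp
      then have invx: "\<And>w. w \<in> W \<Longrightarrow> \<rho> x w \<in> W" "\<And>u. u \<in> U \<Longrightarrow> \<rho> x u \<in> U" using inv by auto
      have pow: "(\<rho> x ^^ m) u0 \<in> U \<and> (\<forall>h\<in>H0. \<rho> h ((\<rho> x ^^ m) u0) \<in> W)" for m
      proof (induction m)
        case 0
        then show ?case using u0 by simp
      next
        case (Suc m)
        let ?u = "(\<rho> x ^^ m) u0"
        have "\<rho> h (\<rho> x ?u) \<in> W" if h: "h \<in> H0" for h
        proof -
          have "\<rho> h (\<rho> x ?u) = \<rho> (br h x) ?u + \<rho> x (\<rho> h ?u)" by (simp add: rep_br[OF \<rho>])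
          also have "\<dots> \<in> W" using Suc h x(3) invx(1) by (intro subspace_add[OF W]) auto
          finally show ?thesis .
        qed
        then show ?case using Suc invx(2) by simp
      qed
      \<comment> \<open>The vectors of \<open>U\<close> that \<open>H0\<close> sends into
        \<open>W\<close> are stable under \<rho> x. The iterate of \<open>u0\<close> just before the
        first one in \<open>W\<close> is sent into \<open>W\<close> by \<open>x\<close> as
        well.\<close>
      obtain k where "(\<rho> x ^^ k) u0 = 0" using nil[OF x(1)] by blast
      then have "\<exists>k. (\<rho> x ^^ k) u0 \<in> W" using subspace_0[OF W] by metis
      moreover have "(\<rho> x ^^ 0) u0 \<notin> W" using u0(2) by simp
      ultimately obtain m where m: "(\<rho> x ^^ m) u0 \<notin> W" "(\<rho> x ^^ Suc m) u0 \<in> W"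
        using ex_least_nat_less[of "\<lambda>k. (\<rho> x ^^ k) u0 \<in> W"] by (metis Suc_eq_plus1 order_refl)
      show "\<exists>u. u \<in> U \<and> u \<notin> W \<and> (\<forall>y\<in>?S. \<rho> y u \<in> W)"
      proof (intro exI[of _ "(\<rho> x ^^ m) u0"] conjI ballI)
        fix y assume "y \<in> ?S"
        then obtain c h where "y = h + scale c x" "h \<in> H0" using Sdec by metis
        then show "\<rho> y ((\<rho> x ^^ m) u0) \<in> W"
          using pow m(2) by (auto simp: radd rsc intro!: subspace_add[OF W] subspace_scale[OF W])
      qed (use pow m in auto)
    qed
    ultimately have "?S = H0" using sub by (intro max) auto
    then show False using x(2) span_base[of x "insert x H0"] by blast
  qed
  then show ?thesis using H0(3) by simp
qed

subsection \<open>Cartan's criterion\<close>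

lemma derived_sum:
  assumes "subspace S" "x \<in> derived S"
  obtains I :: "'v set" and a b where "finite I" "\<And>i. i \<in> I \<Longrightarrow> a i \<in> S" "\<And>i. i \<in> I \<Longrightarrow> b i \<in> S"
    "x = (\<Sum>i\<in>I. br (a i) (b i))"
proof -
  obtain I r where I: "finite I" "I \<subseteq> {br x y |x y. x \<in> S \<and> y \<in> S}" "x = (\<Sum>i\<in>I. scale (r i) i)"
    using assms(2) unfolding derived_def span_explicit by blast
  then have "\<forall>i\<in>I. \<exists>a b. a \<in> S \<and> b \<in> S \<and> i = br a b" by blast
  then obtain a b where ab: "\<And>i. i \<in> I \<Longrightarrow> a i \<in> S \<and> b i \<in> S \<and> i = br (a i) (b i)" by metis
  show thesis
  proof (rule that[of I "\<lambda>i. scale (r i) (a i)" b])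
    show "x = (\<Sum>i\<in>I. br (scale (r i) (a i)) (b i))"
      unfolding I(3)
    proof (rule sum.cong[OF refl])
      fix i assume "i \<in> I"
      then have "i = br (a i) (b i)" using ab by blast
      then show "scale (r i) i = br (scale (r i) (a i)) (b i)" unfolding br_scale by (rule arg_cong)
    qed
  qed (use I ab subspace_scale[OF assms(1)] in auto)
qed

text \<open>Iterated commutators of \<rho> x with \<rho> y are again operators \<rho> z with z in
  \<open>J\<close>, so the trace hypothesis makes every element of the derived algebra act
  nilpotently. Engel's theorem gives a chain of finite length, and each further term of the derived
  series lowers it by one more level.\<close>

theorem cartan_criterion:
  assumes \<rho>: "lie_rep \<rho>" and J: "subalg J"
    and t: "\<And>x y. x \<in> J \<Longrightarrow> y \<in> J \<Longrightarrow> tr (\<lambda>v. \<rho> x (\<rho> y v)) = 0"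
  obtains k where "\<And>x v. x \<in> (derived ^^ k) J \<Longrightarrow> \<rho> x v = 0"
proof -
  have sJ: "subspace J" and cJ: "\<And>x y. x \<in> J \<Longrightarrow> y \<in> J \<Longrightarrow> br x y \<in> J"
    using J unfolding subalg_def by auto
  have D: "subalg (derived J)" "derived J \<subseteq> J"
    using subalg_derived[OF J] subalg_derived_subset[OF J] by auto
  have nil: "\<exists>k. \<forall>v. (\<rho> x ^^ k) v = 0" if x: "x \<in> derived J" for x
  proof -
    obtain I :: "'v set" and a b where I: "finite I" "\<And>i. i \<in> I \<Longrightarrow> a i \<in> J" "\<And>i. i \<in> I \<Longrightarrow> b i \<in> J"
      "x = (\<Sum>i\<in>I. br (a i) (b i))"
      by (rule derived_sum[OF sJ x]) blast
    have iter: "(comm (\<rho> x) ^^ k) (\<rho> y) = \<rho> ((br x ^^ k) y)" for k y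
      by (induction k) (auto simp: comm_def rep_br[OF \<rho>] fun_eq_iff)
    have mem: "(br x ^^ k) y \<in> J" if "y \<in> J" for k y
      using that x D(2) cJ by (induction k) auto
    obtain k where "\<And>v. (\<rho> x ^^ k) v = 0"
    proof (rule nilpotent_if_traces_of_iterated_commutators_vanish[OF I(1), of "\<rho> x" "\<lambda>i. \<rho> (a i)" "\<lambda>i. \<rho> (b i)"])
      show "\<rho> x v = (\<Sum>i\<in>I. comm (\<rho> (a i)) (\<rho> (b i)) v)" for v
        unfolding I(4) lin_sumD[OF rep_lin2[OF \<rho>]] by (simp add: comm_def rep_br[OF \<rho>])
      show "tr (\<lambda>v. (comm (\<rho> x) ^^ k) (\<rho> (a i)) (\<rho> (b i) v)) = 0" if "i \<in> I" for i k
        unfolding iter using that by (intro t mem I)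
    qed (auto intro: rep_lin1[OF \<rho>])
    then show ?thesis by blast
  qed
  let ?Z = "ann_chain \<rho> (derived J)"
  obtain k where k: "?Z k = UNIV"
    by (rule engel_property_exhausts[OF \<rho> engel[OF \<rho> D(1) nil]])
  note sZ = ann_chain_subspace[OF \<rho>, of "derived J"]
  have "\<rho> x v \<in> ?Z (j - Suc m)" if "x \<in> (derived ^^ m) (derived J)" "v \<in> ?Z j" for x v j m
    using that
  proof (induction m arbitrary: x v j)
    case 0
    then show ?case using ann_chain_lower[OF \<rho>] by fastforce
  next
    case (Suc m)
    let ?S = "(derived ^^ m) (derived J)"
    have "x \<in> span {br a b |a b. a \<in> ?S \<and> b \<in> ?S}" using Suc.prems(1) unfolding derived_def by simp
    then show ?case
    proof (rule lin_span_mem[OF rep_lin2[OF \<rho>] _ sZ, rotated])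
      fix s assume "s \<in> {br a b |a b. a \<in> ?S \<and> b \<in> ?S}"
      then obtain a b where s: "s = br a b" "a \<in> ?S" "b \<in> ?S" by blast
      have sub: "?Z (j - Suc m - Suc m) \<subseteq> ?Z (j - Suc (Suc m))"
        by (rule ann_chain_mono[OF \<rho>]) simp
      have "\<rho> a (\<rho> b v) \<in> ?Z (j - Suc m - Suc m)" "\<rho> b (\<rho> a v) \<in> ?Z (j - Suc m - Suc m)"
        by (intro Suc.IH s Suc.prems(2))+
      then show "\<rho> s v \<in> ?Z (j - Suc (Suc m))"
        unfolding s(1) rep_br[OF \<rho>] using sub by (intro subspace_diff[OF sZ]) auto
    qed
  qed
  from this[of _ k _ k] have "\<rho> x v = 0" if "x \<in> (derived ^^ k) (derived J)" for x v
    using that k by fastforce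
  then show thesis by (intro that[of "Suc k"]) (simp add: funpow_swap1)
qed

end

section \<open>Cohomology of semisimple Lie algebras\<close>

subsection \<open>Symmetric bilinear forms and dual bases\<close>

context fin_dim_space
begin

definition sym_form :: "('v \<Rightarrow> 'v \<Rightarrow> 'k) \<Rightarrow> bool"
  where "sym_form \<beta> \<longleftrightarrow> (\<forall>x y. \<beta> x y = \<beta> y x) \<and> (\<forall>x y z. \<beta> (x + y) z = \<beta> x z + \<beta> y z) \<and>
    (\<forall>c x y. \<beta> (scale c x) y = c * \<beta> x y)"

context
  fixes \<beta> :: "'v \<Rightarrow> 'v \<Rightarrow> 'k"
  assumes \<beta>: "sym_form \<beta>"
begin

lemma form_sym: "\<beta> x y = \<beta> y x"
  using \<beta> unfolding sym_form_def by blast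

lemma form_add: "\<beta> (x + y) z = \<beta> x z + \<beta> y z" "\<beta> z (x + y) = \<beta> z x + \<beta> z y"
  using \<beta> unfolding sym_form_def by metis+

lemma form_scale: "\<beta> (scale c x) y = c * \<beta> x y" "\<beta> y (scale c x) = c * \<beta> y x"
  using \<beta> unfolding sym_form_def by metis+

lemma form_zero: "\<beta> 0 y = 0" "\<beta> y 0 = 0"
  using form_add(1)[of 0 0 y] form_add(2)[of y 0 0] by simp_all

lemma form_minus: "\<beta> (- x) y = - \<beta> x y" "\<beta> y (- x) = - \<beta> y x"
  using form_scale(1)[of "-1" x y] form_scale(2)[of y "-1" x] by simp_all

lemma form_diff: "\<beta> (x - y) z = \<beta> x z - \<beta> y z" "\<beta> z (x - y) = \<beta> z x - \<beta> z y"
  using form_add(1)[of x "- y" z] form_add(2)[of z x "- y"] form_minus(1)[of y z] form_minus(2)[of z y]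
  by simp_all

lemma form_sum: "\<beta> (sum g A) y = (\<Sum>a\<in>A. \<beta> (g a) y)" "\<beta> y (sum g A) = (\<Sum>a\<in>A. \<beta> y (g a))"
  by (induction A rule: infinite_finite_induct) (simp_all add: form_zero form_add)

lemma form_perp_subspace: "subspace {x. \<forall>y\<in>S. \<beta> x y = 0}"
  unfolding subspace_def by (auto simp: form_zero form_add form_scale)

text \<open>The families need not span \<open>S\<close>: the form may be degenerate there, and
  expansions then hold only up to its null vectors.\<close>

definition dual_pair :: "'v set \<Rightarrow> nat \<Rightarrow> (nat \<Rightarrow> 'v) \<Rightarrow> (nat \<Rightarrow> 'v) \<Rightarrow> bool"
  where "dual_pair S n e e' \<longleftrightarrow> (\<forall>i<n. e i \<in> S \<and> e' i \<in> S) \<and>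
    (\<forall>i<n. \<forall>j<n. \<beta> (e i) (e' j) = (if i = j then 1 else 0))"

lemma dual_pair_bound:
  assumes "dual_pair S n e e'"
  shows "n \<le> dimension"
proof -
  have b: "\<And>i j. i < n \<Longrightarrow> j < n \<Longrightarrow> \<beta> (e i) (e' j) = (if i = j then 1 else 0)"
    using assms unfolding dual_pair_def by blast
  have inj: "inj_on e {..<n}"
  proof (rule inj_onI)
    fix i j assume "i \<in> {..<n}" "j \<in> {..<n}" "e i = e j"
    then show "i = j" using b[of i j] b[of j j] by (auto split: if_splits)
  qed
  have "independent (e ` {..<n})"
  proof (rule independent_if_scalars_zero)
    fix f x assume s: "(\<Sum>x\<in>e ` {..<n}. scale (f x) x) = 0" and "x \<in> e ` {..<n}"
    then obtain j where j: "j < n" "x = e j" by auto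
    have "(\<Sum>i<n. scale (f (e i)) (e i)) = 0" using s by (simp add: sum.reindex[OF inj])
    then have "\<beta> (\<Sum>i<n. scale (f (e i)) (e i)) (e' j) = 0" by (simp add: form_zero)
    then have "(\<Sum>i<n. f (e i) * \<beta> (e i) (e' j)) = 0" by (simp add: form_sum form_scale)
    also have "(\<Sum>i<n. f (e i) * \<beta> (e i) (e' j)) = (\<Sum>i<n. if i = j then f (e i) else 0)"
      using b[OF _ j(1)] by (intro sum.cong) auto
    finally show "f x = 0" using j by simp
  qed simp
  then have "card (e ` {..<n}) \<le> dim UNIV" by (intro independent_card_le_dim) auto
  then show ?thesis using card_image[OF inj] by (simp add: dimension_def)
qed

text \<open>Take a dual pair of maximal length. If the remainder x' of some \<open>x\<close> paired
  nontrivially with some \<open>y\<close> in \<open>S\<close>, then x' and the remainder of a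
  multiple of \<open>y\<close> would extend the pair.\<close>

lemma dual_bases:
  assumes S: "subspace S"
  obtains n e e' where "dual_pair S n e e'"
    "\<And>x y. x \<in> S \<Longrightarrow> y \<in> S \<Longrightarrow> \<beta> (x - (\<Sum>i<n. scale (\<beta> x (e' i)) (e i))) y = 0"
    "\<And>x y. x \<in> S \<Longrightarrow> y \<in> S \<Longrightarrow> \<beta> (x - (\<Sum>i<n. scale (\<beta> x (e i)) (e' i))) y = 0"
proof -
  define P where "P n \<longleftrightarrow> (\<exists>e e'. dual_pair S n e e')" for n
  have "P 0" unfolding P_def dual_pair_def by simp
  moreover have "P n \<Longrightarrow> n \<le> dimension" for n unfolding P_def using dual_pair_bound by blast
  ultimately obtain n where n: "P n" "\<And>m. P m \<Longrightarrow> m \<le> n"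
    using ex_has_greatest_nat[of P 0 id "Suc dimension"] by (auto simp: less_Suc_eq_le)
  obtain e e' where ee: "dual_pair S n e e'" using n(1) unfolding P_def by blast
  have expand: "\<beta> (x - (\<Sum>i<n. scale (\<beta> x (e' i)) (e i))) y = 0"
    if d: "dual_pair S n e e'" and x: "x \<in> S" and y: "y \<in> S" for x y e e'
  proof (rule ccontr)
    define x' where "x' = x - (\<Sum>i<n. scale (\<beta> x (e' i)) (e i))"
    assume "\<beta> (x - (\<Sum>i<n. scale (\<beta> x (e' i)) (e i))) y \<noteq> 0"
    then have ne: "\<beta> x' y \<noteq> 0" unfolding x'_def .
    define z where "z = scale (inverse (\<beta> x' y)) y"
    define z' where "z' = z - (\<Sum>i<n. scale (\<beta> z (e i)) (e' i))"
    have mem: "e i \<in> S" "e' i \<in> S" if "i < n" for i using d that unfolding dual_pair_def by auto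
    have b: "\<And>i j. i < n \<Longrightarrow> j < n \<Longrightarrow> \<beta> (e i) (e' j) = (if i = j then 1 else 0)"
      using d unfolding dual_pair_def by blast
    have x'S: "x' \<in> S" unfolding x'_def using mem x
      by (intro subspace_diff subspace_sum subspace_scale S) auto
    have z'S: "z' \<in> S" unfolding z'_def z_def using mem y
      by (intro subspace_diff subspace_sum subspace_scale S) auto
    have x'e: "\<beta> x' (e' j) = 0" if j: "j < n" for j
    proof -
      have "(\<Sum>i<n. \<beta> x (e' i) * \<beta> (e i) (e' j)) = (\<Sum>i<n. if i = j then \<beta> x (e' i) else 0)"
        using b[OF _ j] by (intro sum.cong) auto
      then show ?thesis unfolding x'_def using j by (simp add: form_diff form_sum form_scale)
    qed
    have ez': "\<beta> (e j) z' = 0" if j: "j < n" for j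
    proof -
      have "(\<Sum>i<n. \<beta> z (e i) * \<beta> (e j) (e' i)) = (\<Sum>i<n. if i = j then \<beta> z (e i) else 0)"
        using b[OF j] by (intro sum.cong) auto
      then show ?thesis unfolding z'_def using j
        by (simp add: form_diff form_sum form_scale form_sym[of "e j" z])
    qed
    have xz: "\<beta> x' z' = 1"
      unfolding z'_def using ne x'e by (simp add: form_diff form_sum form_scale z_def)
    have "dual_pair S (Suc n) (e(n := x')) (e'(n := z'))"
      unfolding dual_pair_def using mem x'S z'S b x'e ez' xz by (auto simp: less_Suc_eq)
    then have "P (Suc n)" unfolding P_def by blast
    then show False using n(2) by fastforce
  qed
  have "dual_pair S n e' e" using ee form_sym unfolding dual_pair_def by metis
  then show thesis using that[OF ee expand[OF ee] expand] by blast
qed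

end

end

context lie_space
begin

subsection \<open>Trace forms\<close>

definition trace_form :: "('v \<Rightarrow> 'v \<Rightarrow> 'v) \<Rightarrow> 'v \<Rightarrow> 'v \<Rightarrow> 'k"
  where "trace_form \<rho> x y = tr (\<lambda>v. \<rho> x (\<rho> y v))"

lemma trace_form_sym_form:
  assumes \<rho>: "lie_rep \<rho>"
  shows "sym_form (trace_form \<rho>)"
  unfolding sym_form_def trace_form_def
  using tr_comm[OF rep_lin1[OF \<rho>] rep_lin1[OF \<rho>]]
  by (auto simp: lin_addD[OF rep_lin2[OF \<rho>]] lin_scaleD[OF rep_lin2[OF \<rho>]] tr_add tr_scale)

lemma trace_form_invariant:
  assumes \<rho>: "lie_rep \<rho>"
  shows "trace_form \<rho> (br x y) z = trace_form \<rho> x (br y z)"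
proof -
  have "tr (\<lambda>v. \<rho> y (\<rho> x (\<rho> z v))) = tr (\<lambda>v. \<rho> x (\<rho> z (\<rho> y v)))"
    by (rule tr_comm[OF rep_lin1[OF \<rho>] lin_comp[OF rep_lin1[OF \<rho>] rep_lin1[OF \<rho>]]])
  then show ?thesis
    unfolding trace_form_def rep_br[OF \<rho>] lin_diffD[OF rep_lin1[OF \<rho>]] tr_diff by simp
qed

lemma perp_ideal:
  assumes \<beta>: "sym_form \<beta>" and inv: "\<And>x y z. \<beta> (br x y) z = \<beta> x (br y z)" and S: "lie_ideal S"
  shows "lie_ideal {x. \<forall>y\<in>S. \<beta> x y = 0}"
  unfolding lie_ideal_def
proof (intro conjI allI ballI CollectI)
  show "subspace {x. \<forall>y\<in>S. \<beta> x y = 0}" by (rule form_perp_subspace[OF \<beta>])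
  fix x y z assume "y \<in> {x. \<forall>y\<in>S. \<beta> x y = 0}" "z \<in> S"
  then have "\<beta> y (br x z) = 0" using ideal_br[OF S] by blast
  then show "\<beta> (br x y) z = 0"
    using inv[of y x z] by (simp add: br_anti[of x y] form_minus[OF \<beta>])
qed

text \<open>By Cartan's criterion some derived algebra of \<open>J\<close> acts as zero, hence lies
  in \<open>r\<close>, and so \<open>J\<close> is solvable.\<close>

lemma trace_null_ideal:
  assumes r: "is_radical r" and \<rho>: "lie_rep \<rho>" and J: "lie_ideal J"
    and ker: "\<And>x. x \<in> J \<Longrightarrow> (\<And>v. \<rho> x v = 0) \<Longrightarrow> x \<in> r"
    and null: "\<And>x y. x \<in> J \<Longrightarrow> y \<in> J \<Longrightarrow> trace_form \<rho> x y = 0"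
  shows "J \<subseteq> r"
proof -
  obtain k where k: "\<And>x v. x \<in> (derived ^^ k) J \<Longrightarrow> \<rho> x v = 0"
    by (rule cartan_criterion[OF \<rho> ideal_subalg[OF J]]) (use null trace_form_def in auto)
  have "(derived ^^ k) J \<subseteq> J"
    using subalg_derived_subset[OF ideal_subalg[OF ideal_derived_pow[OF J]]]
    by (induction k) force+
  then have "(derived ^^ k) J \<subseteq> r" using k ker by blast
  then have "solvable J"
    using r unfolding is_radical_def by (intro solvable_if_derived_subset[OF ideal_subspace[OF J]]) auto
  then show ?thesis using r J unfolding is_radical_def by blast
qed

end

text \<open>The quotient by \<open>r\<close> in disguise: \<open>p\<close> projects along
  \<open>r\<close> onto a complement. With \<open>{0}\<close> for \<open>r\<close> and the identity
  for \<open>p\<close> this is a semisimple algebra itself.\<close>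

locale lie_radical = lie_space scale Basis br
  for scale :: "'k::field_char_0 \<Rightarrow> 'v::ab_group_add \<Rightarrow> 'v" and Basis br +
  fixes r :: "'v set" and p :: "'v \<Rightarrow> 'v"
  assumes r: "is_radical r"
    and p_lin: "lin p" and p_zero: "\<And>v. v \<in> r \<Longrightarrow> p v = 0" and p_diff: "\<And>v. v - p v \<in> r"
    and p_idem: "\<And>v. p (p v) = p v"
begin

lemma r_ideal: "lie_ideal r" and r_solv: "solvable r"
  and r_max: "lie_ideal I \<Longrightarrow> solvable I \<Longrightarrow> I \<subseteq> r"
  using r unfolding is_radical_def by auto

lemma r_subspace: "subspace r" by (rule ideal_subspace[OF r_ideal])

text \<open>The adjoint representation of the quotient by \<open>r\<close>, carried by the range of
  \<open>p\<close>.\<close>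

definition qad :: "'v \<Rightarrow> 'v \<Rightarrow> 'v" where "qad x v = p (br x (p v))"

lemma p_eq_zero_iff: "p v = 0 \<longleftrightarrow> v \<in> r"
  using p_zero[of v] p_diff[of v] by auto

lemma qad_rep: "lie_rep qad"
  unfolding qad_def
  by (rule lie_rep_subquotient[OF lie_rep_br p_lin, of UNIV r])
    (auto simp: p_zero p_diff p_idem ideal_br[OF r_ideal])

lemma qad_eq: "qad x v = p (br x v)"
proof -
  have "br x (v - p v) \<in> r" by (rule ideal_br[OF r_ideal p_diff])
  then have "p (br x (v - p v)) = 0" by (rule p_zero)
  then show ?thesis unfolding qad_def by (simp add: br_diff lin_diffD[OF p_lin])
qed

lemma qad_radical: "x \<in> r \<Longrightarrow> qad x v = 0"
  unfolding qad_eq by (intro p_zero ideal_br'[OF r_ideal])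

lemma mem_r_if_br_subset:
  assumes J: "lie_ideal J" and "\<And>x y. x \<in> J \<Longrightarrow> y \<in> J \<Longrightarrow> br x y \<in> r"
  shows "J \<subseteq> r"
proof (rule r_max[OF J])
  have "(derived ^^ 1) J \<subseteq> r" using derived_least[OF r_subspace assms(2)] by simp
  then show "solvable J" by (rule solvable_if_derived_subset[OF ideal_subspace[OF J] _ r_solv])
qed

text \<open>Modulo \<open>r\<close> the kernel is the center, so its brackets lie in
  \<open>r\<close> and it is a solvable ideal.\<close>

lemma qad_kernel:
  assumes "\<And>v. qad x v = 0"
  shows "x \<in> r"
proof -
  let ?K = "{x. \<forall>v. qad x v = 0}"
  have "lie_ideal ?K"
    unfolding lie_ideal_def subspace_def
    by (auto simp: lin_addD[OF rep_lin2[OF qad_rep]] lin_scaleD[OF rep_lin2[OF qad_rep]]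
        lin_zeroD[OF rep_lin2[OF qad_rep]] rep_br[OF qad_rep] lin_zeroD[OF rep_lin1[OF qad_rep]])
  then have "?K \<subseteq> r"
    by (rule mem_r_if_br_subset) (simp add: qad_eq p_eq_zero_iff)
  then show ?thesis using assms by blast
qed

text \<open>The Killing form of the quotient by \<open>r\<close>, pulled back to the whole
  algebra.\<close>

definition kappa :: "'v \<Rightarrow> 'v \<Rightarrow> 'k" where "kappa = trace_form qad"

lemma kappa_form: "sym_form kappa"
  unfolding kappa_def by (rule trace_form_sym_form[OF qad_rep])

lemma kappa_inv: "kappa (br x y) z = kappa x (br y z)"
  unfolding kappa_def by (rule trace_form_invariant[OF qad_rep])

lemma kappa_radical: "x \<in> r \<Longrightarrow> kappa x y = 0" "x \<in> r \<Longrightarrow> kappa y x = 0"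
  using qad_radical[of x] form_sym[OF kappa_form]
  by (simp_all add: kappa_def trace_form_def tr_0 lin_zeroD[OF rep_lin1[OF qad_rep]])

lemma kappa_null: "lie_ideal J \<Longrightarrow> (\<And>x y. x \<in> J \<Longrightarrow> y \<in> J \<Longrightarrow> kappa x y = 0) \<Longrightarrow> J \<subseteq> r"
  unfolding kappa_def by (rule trace_null_ideal[OF r qad_rep _ qad_kernel])

lemma UNIV_ideal: "lie_ideal UNIV"
  unfolding lie_ideal_def by (simp add: subspace_UNIV)

lemma kappa_nondegenerate: "(\<And>y. kappa x y = 0) \<Longrightarrow> x \<in> r"
proof -
  assume *: "\<And>y. kappa x y = 0"
  have "{x. \<forall>y\<in>UNIV. kappa x y = 0} \<subseteq> r"
    by (rule kappa_null[OF perp_ideal[OF kappa_form kappa_inv UNIV_ideal]]) auto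
  then show "x \<in> r" using * by blast
qed

text \<open>\<open>j\<close> is the expansion of \<open>x\<close> in a dual pair for
  \<open>J\<close>. By \<open>kappa_null\<close> the ideal meets its orthogonal only inside
  \<open>r\<close>, where \<open>kappa\<close> vanishes; so x - j is orthogonal to all of
  \<open>J\<close>, not just to the dual family.\<close>

lemma kappa_decomp:
  assumes J: "lie_ideal J"
  obtains j where "j \<in> J" "\<And>y. y \<in> J \<Longrightarrow> kappa (x - j) y = 0"
proof -
  obtain n e e' where d: "dual_pair kappa J n e e'"
    and ex: "\<And>x y. x \<in> J \<Longrightarrow> y \<in> J \<Longrightarrow> kappa (x - (\<Sum>i<n. scale (kappa x (e i)) (e' i))) y = 0"
    by (rule dual_bases[OF kappa_form ideal_subspace[OF J]]) blast
  have mem: "e i \<in> J" "e' i \<in> J" if "i < n" for i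
    using d that unfolding dual_pair_def[OF kappa_form] by auto
  have b: "\<And>i j. i < n \<Longrightarrow> j < n \<Longrightarrow> kappa (e i) (e' j) = (if i = j then 1 else 0)"
    using d unfolding dual_pair_def[OF kappa_form] by blast
  define j where "j = (\<Sum>i<n. scale (kappa x (e' i)) (e i))"
  note f = form_diff[OF kappa_form] form_sum[OF kappa_form] form_scale[OF kappa_form]
  show thesis
  proof (rule that[of j])
    show "j \<in> J" unfolding j_def using mem
      by (intro subspace_sum subspace_scale ideal_subspace[OF J]) auto
    fix y assume y: "y \<in> J"
    let ?y = "\<Sum>i<n. scale (kappa y (e i)) (e' i)"
    have xe: "kappa (x - j) (e' l) = 0" if l: "l < n" for l
    proof -
      have "(\<Sum>i<n. kappa x (e' i) * kappa (e i) (e' l)) = (\<Sum>i<n. if i = l then kappa x (e' i) else 0)"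
        using b[OF _ l] by (intro sum.cong) auto
      then show ?thesis unfolding j_def using l by (simp add: f)
    qed
    have "J \<inter> {x. \<forall>y\<in>J. kappa x y = 0} \<subseteq> r"
      by (rule kappa_null[OF ideal_Int[OF J perp_ideal[OF kappa_form kappa_inv J]]]) auto
    moreover have "y - ?y \<in> J" using y mem
      by (intro subspace_diff subspace_sum subspace_scale ideal_subspace[OF J]) auto
    ultimately have "y - ?y \<in> r" using ex[OF y] by blast
    then have "kappa (x - j) y = kappa (x - j) ?y"
      using kappa_radical(2)[of "y - ?y" "x - j"] by (simp add: f)
    also have "\<dots> = 0" using xe unfolding f(4) f(6) by simp
    finally show "kappa (x - j) y = 0" .
  qed
qed

subsection \<open>Casimir operators\<close>

definition bilin :: "('v \<Rightarrow> 'v \<Rightarrow> 'v) \<Rightarrow> bool"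
  where "bilin B \<longleftrightarrow> (\<forall>x. lin (B x)) \<and> (\<forall>y. lin (\<lambda>x. B x y))"

lemma bilin_rep_comp: "lie_rep \<rho> \<Longrightarrow> lin c \<Longrightarrow> bilin (\<lambda>a b. \<rho> a (c b))"
  unfolding bilin_def using rep_lin2 lin_comp[OF rep_lin1] by blast

text \<open>The tensor of the dual families is invariant because \<open>br x\<close> has negative
  transposed matrices in them. Expansions hold only modulo \<open>r\<close>, hence test maps
  \<open>B\<close> that kill \<open>r\<close> in both arguments.\<close>

lemma casimir_invariance:
  assumes \<beta>: "sym_form \<beta>" and inv: "\<And>x y z. \<beta> (br x y) z = \<beta> x (br y z)"
    and S: "lie_ideal S" and null: "\<And>x. x \<in> S \<Longrightarrow> (\<And>y. y \<in> S \<Longrightarrow> \<beta> x y = 0) \<Longrightarrow> x \<in> r"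
    and d: "dual_pair \<beta> S n e e'"
    and ex: "\<And>x y. x \<in> S \<Longrightarrow> y \<in> S \<Longrightarrow> \<beta> (x - (\<Sum>i<n. scale (\<beta> x (e' i)) (e i))) y = 0"
    and ex': "\<And>x y. x \<in> S \<Longrightarrow> y \<in> S \<Longrightarrow> \<beta> (x - (\<Sum>i<n. scale (\<beta> x (e i)) (e' i))) y = 0"
    and B: "bilin B" "\<And>a b. a \<in> r \<Longrightarrow> B a b = 0" "\<And>a b. b \<in> r \<Longrightarrow> B a b = 0"
  shows "(\<Sum>i<n. B (br x (e i)) (e' i) + B (e i) (br x (e' i))) = 0"
proof -
  note sS = ideal_subspace[OF S]
  have mem: "e i \<in> S" "e' i \<in> S" if "i < n" for i
    using d that unfolding dual_pair_def[OF \<beta>] by auto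
  have Bl: "lin (B a)" "lin (\<lambda>x. B x a)" for a using B(1) unfolding bilin_def by auto
  have 1: "B (br x (e i)) (e' i) = (\<Sum>j<n. scale (\<beta> (br x (e i)) (e' j)) (B (e j) (e' i)))" if i: "i < n" for i
  proof -
    let ?u = "br x (e i)"
    have u: "?u \<in> S" by (rule ideal_br[OF S mem(1)[OF i]])
    have "?u - (\<Sum>j<n. scale (\<beta> ?u (e' j)) (e j)) \<in> r"
      by (rule null[OF _ ex[OF u]]) (auto intro!: subspace_diff subspace_sum subspace_scale sS u mem)
    then have "B (?u - (\<Sum>j<n. scale (\<beta> ?u (e' j)) (e j))) (e' i) = 0" by (rule B(2))
    then show ?thesis by (simp add: lin_diffD[OF Bl(2)] lin_sumD[OF Bl(2)] lin_scaleD[OF Bl(2)])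
  qed
  have 2: "B (e i) (br x (e' i)) = (\<Sum>j<n. scale (\<beta> (br x (e' i)) (e j)) (B (e i) (e' j)))" if i: "i < n" for i
  proof -
    let ?u = "br x (e' i)"
    have u: "?u \<in> S" by (rule ideal_br[OF S mem(2)[OF i]])
    have "?u - (\<Sum>j<n. scale (\<beta> ?u (e j)) (e' j)) \<in> r"
      by (rule null[OF _ ex'[OF u]]) (auto intro!: subspace_diff subspace_sum subspace_scale sS u mem)
    then have "B (e i) (?u - (\<Sum>j<n. scale (\<beta> ?u (e j)) (e' j))) = 0" by (rule B(3))
    then show ?thesis by (simp add: lin_diffD[OF Bl(1)] lin_sumD[OF Bl(1)] lin_scaleD[OF Bl(1)])
  qed
  have "\<beta> (br x (e i)) (e' j) = - \<beta> (br x (e' j)) (e i)" for i j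
  proof -
    have "- \<beta> (br x (e i)) (e' j) = \<beta> (br (e i) x) (e' j)"
      unfolding br_anti[of "e i" x] form_minus[OF \<beta>] by simp
    also have "\<dots> = \<beta> (e i) (br x (e' j))" by (rule inv)
    also have "\<dots> = \<beta> (br x (e' j)) (e i)" by (rule form_sym[OF \<beta>])
    finally show ?thesis by (metis minus_minus)
  qed
  then have "(\<Sum>i<n. B (br x (e i)) (e' i)) = (\<Sum>i<n. \<Sum>j<n. - scale (\<beta> (br x (e' j)) (e i)) (B (e j) (e' i)))"
    using 1 by (simp add: scale_minus_left)
  also have "\<dots> = - (\<Sum>i<n. \<Sum>j<n. scale (\<beta> (br x (e' i)) (e j)) (B (e i) (e' j)))"
    by (subst sum.swap) (simp add: sum_negf)
  also have "\<dots> = - (\<Sum>i<n. B (e i) (br x (e' i)))" using 2 by simp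
  finally show ?thesis by (simp add: sum.distrib)
qed

text \<open>Quantifying over \<open>B\<close> keeps the invariance usable with the cocycles of both
  Whitehead lemmas.\<close>

definition casimir_family :: "nat \<Rightarrow> (nat \<Rightarrow> 'v) \<Rightarrow> (nat \<Rightarrow> 'v) \<Rightarrow> bool"
  where "casimir_family n e e' \<longleftrightarrow> (\<forall>B x. bilin B \<longrightarrow> (\<forall>a\<in>r. \<forall>b. B a b = 0 \<and> B b a = 0) \<longrightarrow>
    (\<Sum>i<n. B (br x (e i)) (e' i) + B (e i) (br x (e' i))) = 0)"

lemma casimir_familyD:
  assumes "casimir_family n e e'" "bilin B" "\<And>a b. a \<in> r \<Longrightarrow> B a b = 0" "\<And>a b. b \<in> r \<Longrightarrow> B a b = 0"
  shows "(\<Sum>i<n. B (br x (e i)) (e' i) + B (e i) (br x (e' i))) = 0"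
  using assms unfolding casimir_family_def by blast

text \<open>The induction measure for Whitehead's lemmas. All modules live on the same space, so the
  part reached by the action is measured instead.\<close>

definition action_dim :: "('v \<Rightarrow> 'v \<Rightarrow> 'v) \<Rightarrow> nat"
  where "action_dim \<rho> = dim (span {\<rho> x v |x v. True})"

lemma complement_rep:
  assumes \<rho>: "lie_rep \<rho>" and P: "lin P" "\<And>x v. P (\<rho> x v) = \<rho> x (P v)" "\<And>v. P (P v) = P v"
  shows "lie_rep (\<lambda>x v. \<rho> x (v - P v))"
proof -
  have l: "lin (\<lambda>v. v - P v)" by (intro lin_diff lin_id P)
  have *: "\<rho> x (\<rho> y (v - P v) - P (\<rho> y (v - P v))) = \<rho> x (\<rho> y (v - P v))" for x y v
    by (simp add: P lin_diffD[OF P(1)] lin_diffD[OF rep_lin1[OF \<rho>]])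
  show ?thesis
    unfolding lie_rep_def * using lin_comp[OF rep_lin1[OF \<rho>] l] rep_lin2[OF \<rho>] rep_br[OF \<rho>] by blast
qed

lemma action_dim_complement:
  assumes \<rho>: "lie_rep \<rho>" and P: "lin P" "\<And>x v. P (\<rho> x v) = \<rho> x (P v)" "\<And>v. P (P v) = P v"
    and v0: "P v0 \<noteq> 0" "P v0 \<in> span {\<rho> x v |x v. True}"
  shows "action_dim (\<lambda>x v. \<rho> x (v - P v)) < action_dim \<rho>"
proof -
  let ?M = "span {\<rho> x v |x v. True}" and ?M' = "span {\<rho> x (v - P v) |x v. True}"
  have "?M' \<subseteq> ?M" by (intro span_mono) auto
  moreover have "P m \<in> {0}" if "m \<in> ?M'" for m
    using that
    by (rule lin_span_mem[OF P(1) _ subspace_single_0, rotated])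
      (auto simp: P lin_diffD[OF P(1)] lin_zeroD[OF rep_lin1[OF \<rho>]])
  from this[of "P v0"] have "P v0 \<notin> ?M'" using v0(1) P(3)[of v0] by auto
  ultimately have "?M' \<subset> ?M" using v0(2) by blast
  then show ?thesis unfolding action_dim_def by (intro dim_psubset) (simp add: span_span)
qed

text \<open>The Casimir operator \<open>C\<close> is formed from the part of the Lie algebra on which \<open>\<rho>\<close> is
  faithful modulo the radical. Its trace is the number of dual basis vectors, so \<open>C\<close> is not
  nilpotent and its Fitting projection \<open>P\<close> does not vanish.\<close>

lemma casimir:
  assumes \<rho>: "lie_rep \<rho>" and \<rho>r: "\<And>x v. x \<in> r \<Longrightarrow> \<rho> x v = 0" and ne: "\<rho> x0 v0 \<noteq> 0"
  obtains n e e' C d P where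
    "casimir_family n e e'"
    "\<And>v. C v = (\<Sum>i<n. \<rho> (e i) (\<rho> (e' i) v))" "lin d" "\<And>x v. d (\<rho> x v) = \<rho> x (d v)"
    "\<And>v. P v = d (C v)" "lin P" "\<And>x v. P (\<rho> x v) = \<rho> x (P v)" "\<And>v. P (P v) = P v"
    "action_dim (\<lambda>x v. \<rho> x (v - P v)) < action_dim \<rho>"
proof -
  let ?R = "{x. \<forall>v. \<rho> x v = 0}"
  have R: "lie_ideal ?R"
    unfolding lie_ideal_def subspace_def
    by (auto simp: lin_addD[OF rep_lin2[OF \<rho>]] lin_scaleD[OF rep_lin2[OF \<rho>]]
        lin_zeroD[OF rep_lin2[OF \<rho>]] rep_br[OF \<rho>] lin_zeroD[OF rep_lin1[OF \<rho>]])
  \<comment> \<open>Modulo \<open>r\<close> the algebra is the sum of the kernel \<open>?R\<close>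
    and its orthogonal ideal.\<close>
  define S where "S = {x. \<forall>y\<in>?R. kappa x y = 0}"
  have S: "lie_ideal S" unfolding S_def by (rule perp_ideal[OF kappa_form kappa_inv R])
  have RS: "?R \<inter> S \<subseteq> r"
    by (rule kappa_null[OF ideal_Int[OF R S]]) (auto simp: S_def)
  have "\<not> S \<subseteq> r"
  proof
    assume Sr: "S \<subseteq> r"
    obtain j where j: "j \<in> ?R" "\<And>y. y \<in> ?R \<Longrightarrow> kappa (x0 - j) y = 0"
      by (rule kappa_decomp[OF R, of x0]) blast
    then have "x0 - j \<in> r" using Sr unfolding S_def by blast
    then have "\<rho> (x0 - j) v0 = 0" by (rule \<rho>r)
    then show False using ne j(1) by (simp add: lin_diffD[OF rep_lin2[OF \<rho>]])
  qed
  define \<beta> where "\<beta> = trace_form \<rho>"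
  have \<beta>: "sym_form \<beta>" and inv: "\<And>x y z. \<beta> (br x y) z = \<beta> x (br y z)"
    unfolding \<beta>_def using trace_form_sym_form[OF \<rho>] trace_form_invariant[OF \<rho>] by auto
  have "S \<inter> {x. \<forall>y\<in>S. \<beta> x y = 0} \<subseteq> r"
    by (rule trace_null_ideal[OF r \<rho> ideal_Int[OF S perp_ideal[OF \<beta> inv S]]])
      (use RS in \<open>auto simp: \<beta>_def\<close>)
  then have null: "x \<in> r" if "x \<in> S" "\<And>y. y \<in> S \<Longrightarrow> \<beta> x y = 0" for x using that by blast
  obtain n e e' where d: "dual_pair \<beta> S n e e'"
    and ex: "\<And>x y. x \<in> S \<Longrightarrow> y \<in> S \<Longrightarrow> \<beta> (x - (\<Sum>i<n. scale (\<beta> x (e' i)) (e i))) y = 0"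
    and ex': "\<And>x y. x \<in> S \<Longrightarrow> y \<in> S \<Longrightarrow> \<beta> (x - (\<Sum>i<n. scale (\<beta> x (e i)) (e' i))) y = 0"
    by (rule dual_bases[OF \<beta> ideal_subspace[OF S]]) blast
  have b: "\<And>i. i < n \<Longrightarrow> \<beta> (e i) (e' i) = 1"
    using d unfolding dual_pair_def[OF \<beta>] by simp
  have n: "n \<noteq> 0"
  proof
    assume "n = 0"
    then have "S \<subseteq> r" using null ex by auto
    then show False using \<open>\<not> S \<subseteq> r\<close> by blast
  qed
  note ci = casimir_invariance[OF \<beta> inv S null d ex ex']
  have fam: "casimir_family n e e'" unfolding casimir_family_def using ci by blast
  define C where "C v = (\<Sum>i<n. \<rho> (e i) (\<rho> (e' i) v))" for v
  have C: "lin C" unfolding C_def by (intro lin_sum lin_comp[OF rep_lin1[OF \<rho>] rep_lin1[OF \<rho>]])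
  have Ccomm: "C (\<rho> x v) = \<rho> x (C v)" for x v
  proof -
    have "(\<Sum>i<n. \<rho> (br x (e i)) (\<rho> (e' i) v) + \<rho> (e i) (\<rho> (br x (e' i)) v)) = 0"
      by (rule ci) (auto simp: bilin_rep_comp[OF \<rho> rep_lin2[OF \<rho>]] \<rho>r lin_zeroD[OF rep_lin1[OF \<rho>]])
    then have "(\<Sum>i<n. \<rho> x (\<rho> (e i) (\<rho> (e' i) v)) - \<rho> (e i) (\<rho> (e' i) (\<rho> x v))) = 0"
      by (simp add: rep_br[OF \<rho>] lin_diffD[OF rep_lin1[OF \<rho>]])
    then show ?thesis unfolding C_def lin_sumD[OF rep_lin1[OF \<rho>]] by (simp add: sum_subtractf)
  qed
  have trC: "tr C \<noteq> 0"
  proof -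
    have "tr C = (\<Sum>i<n. \<beta> (e i) (e' i))"
      unfolding C_def[abs_def] \<beta>_def trace_form_def by (simp add: tr_sum)
    also have "\<dots> = of_nat n" using b by simp
    finally show ?thesis using n by simp
  qed
  obtain d k where dk: "lin d" "\<And>h x. lin h \<Longrightarrow> (\<And>y. h (C y) = C (h y)) \<Longrightarrow> h (d x) = d (h x)"
    "\<And>x. C (d (C (d x))) = C (d x)" "\<And>x. (C ^^ k) (C (d x)) = (C ^^ k) x"
    by (rule fitting[OF C]) blast
  have "\<exists>v. C (d v) \<noteq> 0"
  proof (rule ccontr)
    assume "\<not> ?thesis"
    then have "(C ^^ k) x = 0" for x using dk(4)[of x] by (simp add: lin_zeroD[OF lin_funpow[OF C]])
    then show False using trC tr_nilpotent[OF C] by blast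
  qed
  then obtain w0 where w0: "C (d w0) \<noteq> 0" by blast
  have dcomm: "d (\<rho> x v) = \<rho> x (d v)" for x v
    using dk(2)[OF rep_lin1[OF \<rho>], of x v] Ccomm by simp
  define P where "P v = d (C v)" for v
  have PC: "P v = C (d v)" for v unfolding P_def using dk(2)[OF C, of v] by simp
  have P: "lin P" "\<And>x v. P (\<rho> x v) = \<rho> x (P v)" "\<And>v. P (P v) = P v"
    unfolding PC[abs_def] using lin_comp[OF C dk(1)] by (simp_all add: dcomm Ccomm dk(3))
  have "P w0 \<in> span {\<rho> x v |x v. True}" unfolding PC C_def by (intro span_sum span_base) auto
  from action_dim_complement[OF \<rho> P _ this]
  have "action_dim (\<lambda>x v. \<rho> x (v - P v)) < action_dim \<rho>" using w0 unfolding PC .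
  then show thesis
    using fam C_def dk(1) dcomm P_def P
    by (intro that[where n = n and e = e and e' = e' and C = C and d = d and P = P]) blast+
qed

text \<open>An element orthogonal to all brackets has, by invariance, brackets orthogonal to
  everything, which therefore lie in \<open>r\<close>. So the orthogonal of [V, V] + r is inside
  \<open>r\<close>, and \<open>kappa_decomp\<close> shows that this sum is everything.\<close>

lemma perfect_mod_radical:
  assumes "lin c" "\<And>x y. c (br x y) = 0" "\<And>x. x \<in> r \<Longrightarrow> c x = 0"
  shows "c x = 0"
proof -
  let ?D = "{x + y |x y. x \<in> derived UNIV \<and> y \<in> r}"
  have D: "lie_ideal ?D" by (rule ideal_sum[OF ideal_derived[OF UNIV_ideal] r_ideal])
  have brD: "br x y \<in> ?D" for x y
    using br_mem_derived[of x UNIV y] subspace_0[OF r_subspace] by force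
  let ?E = "{x. \<forall>y\<in>?D. kappa x y = 0}"
  have "br x y \<in> r" if "x \<in> ?E" for x y
  proof (rule kappa_nondegenerate)
    fix z show "kappa (br x y) z = 0" using that brD[of y z] unfolding kappa_inv by blast
  qed
  then have "?E \<subseteq> r" by (intro mem_r_if_br_subset perp_ideal[OF kappa_form kappa_inv D])
  obtain j where j: "j \<in> ?D" "\<And>y. y \<in> ?D \<Longrightarrow> kappa (x - j) y = 0" by (rule kappa_decomp[OF D, of x]) blast
  then have "x - j \<in> r" using \<open>?E \<subseteq> r\<close> by blast
  then have "c x = c j" using assms(1,3) lin_diffD[of c x j] by simp
  moreover obtain a b where "j = a + b" "a \<in> derived UNIV" "b \<in> r" using j(1) by blast
  moreover have "c a \<in> {0}" if "a \<in> derived UNIV" for a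
    using that unfolding derived_def
    by (rule lin_span_mem[OF assms(1) _ subspace_single_0, rotated]) (use assms(2) in auto)
  ultimately show ?thesis using assms(1,3) by (simp add: lin_addD)
qed

subsection \<open>Whitehead's lemmas\<close>

text \<open>By invariance of the Casimir tensor, the vector \<open>m1\<close> satisfies \<rho> x m1
  = C (c x). On the range of the Fitting projection \<open>P\<close>, where \<open>d\<close> inverts
  \<open>C\<close>, this makes d m1 a solution. On the complement the measure drops. In a trivial
  module a cocycle vanishes by perfectness.\<close>

theorem whitehead1:
  assumes "lie_rep \<rho>" "\<And>x v. x \<in> r \<Longrightarrow> \<rho> x v = 0" "lin c" "\<And>x. x \<in> r \<Longrightarrow> c x = 0"
    "\<And>x y. c (br x y) = \<rho> x (c y) - \<rho> y (c x)"
  shows "\<exists>m. \<forall>x. c x = \<rho> x m"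
  using assms
proof (induction "action_dim \<rho>" arbitrary: \<rho> c rule: less_induct)
  case (less \<rho> c)
  note \<rho> = less.prems(1) and \<rho>r = less.prems(2) and c = less.prems(3-5)
  show ?case
  proof (cases "\<forall>x v. \<rho> x v = 0")
    case True
    then have "c x = 0" for x using perfect_mod_radical[OF c(1) _ c(2)] c(3) by simp
    then show ?thesis using True by simp
  next
    case False
    then obtain x0 v0 where ne: "\<rho> x0 v0 \<noteq> 0" by blast
    obtain n e e' C d P where
      inv: "casimir_family n e e'" and C: "\<And>v. C v = (\<Sum>i<n. \<rho> (e i) (\<rho> (e' i) v))"
      and d: "lin d" "\<And>x v. d (\<rho> x v) = \<rho> x (d v)" "\<And>v. P v = d (C v)"
      and P: "lin P" "\<And>x v. P (\<rho> x v) = \<rho> x (P v)" "\<And>v. P (P v) = P v"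
      and lt: "action_dim (\<lambda>x v. \<rho> x (v - P v)) < action_dim \<rho>"
      by (rule casimir[OF \<rho> \<rho>r ne]) blast+
    define m1 where "m1 = (\<Sum>i<n. \<rho> (e i) (c (e' i)))"
    have m1: "\<rho> x m1 = C (c x)" for x
    proof -
      have "(\<Sum>i<n. \<rho> (br x (e i)) (c (e' i)) + \<rho> (e i) (c (br x (e' i)))) = 0"
        by (rule casimir_familyD[OF inv bilin_rep_comp[OF \<rho> c(1)]]) (auto simp: \<rho>r c(2) lin_zeroD[OF rep_lin1[OF \<rho>]])
      then have "(\<Sum>i<n. \<rho> x (\<rho> (e i) (c (e' i))) - \<rho> (e i) (\<rho> (e' i) (c x))) = 0"
        by (simp add: rep_br[OF \<rho>] c(3) lin_diffD[OF rep_lin1[OF \<rho>]])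
      then show ?thesis unfolding m1_def C lin_sumD[OF rep_lin1[OF \<rho>]] by (simp add: sum_subtractf)
    qed
    have Pc: "P (c x) = \<rho> x (d m1)" for x
      unfolding d(3) m1[symmetric] by (rule d(2))
    have "\<exists>m. \<forall>x. c x - P (c x) = \<rho> x (m - P m)"
    proof (rule less.hyps[OF lt complement_rep[OF \<rho> P], of "\<lambda>x. c x - P (c x)"])
      show "lin (\<lambda>x. c x - P (c x))" by (intro lin_diff c(1) lin_comp[OF P(1) c(1)])
      show "c (br x y) - P (c (br x y)) =
          \<rho> x (c y - P (c y) - P (c y - P (c y))) - \<rho> y (c x - P (c x) - P (c x - P (c x)))" for x y
        by (simp add: c(3) P lin_diffD[OF P(1)] lin_diffD[OF rep_lin1[OF \<rho>]])
    qed (auto simp: \<rho>r c(2) lin_zeroD[OF P(1)])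
    then obtain m where m: "\<And>x. c x - P (c x) = \<rho> x (m - P m)" by blast
    have "c x = \<rho> x (m - P m + d m1)" for x
      unfolding lin_addD[OF rep_lin1[OF \<rho>]] m[of x, symmetric] Pc[of x, symmetric] by simp
    then show ?thesis by blast
  qed
qed

text \<open>Write g x y = kappa (D x) y. The cocycle identity says that \<open>D\<close> is a
  derivation modulo \<open>r\<close>, and \<open>whitehead1\<close> for \<open>qad\<close> makes it
  inner there: D x is br x m modulo \<open>r\<close>. Invariance moves \<open>m\<close> to the
  front.\<close>

lemma trivial_cocycle_form:
  fixes g :: "'v \<Rightarrow> 'v \<Rightarrow> 'k"
  assumes add: "\<And>x y z. g (x + y) z = g x z + g y z" "\<And>x y z. g z (x + y) = g z x + g z y"
    and scale: "\<And>c x y. g (scale c x) y = c * g x y" "\<And>c x y. g y (scale c x) = c * g y x"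
    and r0: "\<And>x y. x \<in> r \<Longrightarrow> g x y = 0" "\<And>x y. x \<in> r \<Longrightarrow> g y x = 0"
    and anti: "\<And>x y. g x y = - g y x"
    and cyc: "\<And>x y z. g (br x y) z + g (br y z) x + g (br z x) y = 0"
  shows "\<exists>\<delta>. \<forall>x y. g x y = - kappa \<delta> (br x y)"
proof -
  note f = form_diff[OF kappa_form] form_sum[OF kappa_form] form_scale[OF kappa_form] form_add[OF kappa_form]
  obtain n e e' where dp: "dual_pair kappa UNIV n e e'"
    and ex: "\<And>x y. kappa (x - (\<Sum>i<n. scale (kappa x (e i)) (e' i))) y = 0"
    by (rule dual_bases[OF kappa_form subspace_UNIV]) simp
  have b: "\<And>i j. i < n \<Longrightarrow> j < n \<Longrightarrow> kappa (e i) (e' j) = (if i = j then 1 else 0)"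
    using dp unfolding dual_pair_def[OF kappa_form] by blast
  have gz: "g z 0 = 0" for z using add(2)[of z 0 0] by simp
  have gsum: "g z (sum h A) = (\<Sum>a\<in>A. g z (h a))" for z h and A :: "nat set"
    by (induction A rule: infinite_finite_induct) (simp_all add: gz add)
  have gdiff: "g z (x - y) = g z x - g z y" for x y z using add(2)[of z "x - y" y] by simp
  have gneg: "g z (- x) = - g z x" for x z using gdiff[of z 0 x] by (simp add: gz)
  have gneg1: "g (- x) z = - g x z" for x z using anti[of "- x" z] anti[of x z] by (simp add: gneg)
  define D where "D x = (\<Sum>i<n. scale (g x (e' i)) (e i))" for x
  have Dl: "lin D"
    unfolding D_def by (rule linI) (simp_all add: add scale scale_left_distrib sum.distrib scale_sum_right)
  have D: "kappa (D x) y = g x y" for x y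
  proof -
    let ?y = "\<Sum>i<n. scale (kappa y (e i)) (e' i)"
    have yr: "y - ?y \<in> r" by (rule kappa_nondegenerate) (rule ex)
    have De: "kappa (D x) (e' j) = g x (e' j)" if j: "j < n" for j
    proof -
      have "(\<Sum>i<n. g x (e' i) * kappa (e i) (e' j)) = (\<Sum>i<n. if i = j then g x (e' i) else 0)"
        using b[OF _ j] by (intro sum.cong) auto
      then show ?thesis unfolding D_def using j by (simp add: f)
    qed
    have "kappa (D x) y = kappa (D x) ?y" using kappa_radical(2)[OF yr, of "D x"] by (simp add: f)
    also have "\<dots> = g x ?y" using De by (simp add: f gsum scale)
    also have "\<dots> = g x y" using r0(2)[OF yr, of x] by (simp add: gdiff)
    finally show ?thesis .
  qed
  have Dr: "D x = 0" if "x \<in> r" for x unfolding D_def by (simp add: r0(1)[OF that])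
  have coc: "D (br x y) - br x (D y) + br y (D x) \<in> r" for x y
  proof (rule kappa_nondegenerate)
    fix z
    have "kappa (br x (D y)) z = - g y (br x z)" "kappa (br y (D x)) z = - g x (br y z)"
      by (simp_all add: br_anti[of x "D y"] br_anti[of y "D x"] form_minus[OF kappa_form] kappa_inv D
          br_anti[of x z] br_anti[of y z] gneg)
    then have k: "kappa (D (br x y) - br x (D y) + br y (D x)) z = g (br x y) z + g y (br x z) - g x (br y z)"
      by (simp add: f D)
    have g1: "g y (br x z) = g (br z x) y"
      using anti[of y "br x z"] by (simp add: br_anti[of x z] gneg1)
    have g2: "g x (br y z) = - g (br y z) x" by (rule anti)
    show "kappa (D (br x y) - br x (D y) + br y (D x)) z = 0"
      using cyc[of x y z] unfolding k g1 g2 by (simp add: algebra_simps)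
  qed
  have "\<exists>m. \<forall>x. p (D x) = qad x m"
  proof (rule whitehead1[OF qad_rep qad_radical])
    show "lin (\<lambda>x. p (D x))" by (rule lin_comp[OF p_lin Dl])
    show "p (D (br x y)) = qad x (p (D y)) - qad y (p (D x))" for x y
    proof -
      have "p (D (br x y) - br x (D y) + br y (D x)) = 0" by (rule p_zero[OF coc])
      then show ?thesis
        unfolding qad_def p_idem qad_eq[unfolded qad_def]
        by (simp add: lin_diffD[OF p_lin] lin_addD[OF p_lin] algebra_simps)
    qed
  qed (simp_all add: Dr lin_zeroD[OF p_lin])
  then obtain m where m: "\<And>x. p (D x) = qad x m" by blast
  have "g x y = - kappa m (br x y)" for x y
  proof -
    have "p (D x - br x m) = 0" using m[of x] by (simp add: qad_eq lin_diffD[OF p_lin])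
    then have "D x - br x m \<in> r" by (simp add: p_eq_zero_iff)
    then have "kappa (D x) y = kappa (br x m) y" using kappa_radical(1)[of "D x - br x m" y] by (simp add: f)
    also have "\<dots> = - kappa m (br x y)" by (simp add: br_anti[of x m] form_minus[OF kappa_form] kappa_inv)
    finally show ?thesis by (simp add: D)
  qed
  then show ?thesis by blast
qed

lemma trivial_cocycle_coboundary:
  assumes f: "bilin f" and fr: "\<And>x y. x \<in> r \<Longrightarrow> f x y = 0" and anti: "\<And>x y. f x y = - f y x"
    and cyc: "\<And>x y z. f (br x y) z + f (br y z) x + f (br z x) y = 0"
  shows "\<exists>h. lin h \<and> (\<forall>x\<in>r. h x = 0) \<and> (\<forall>x y. f x y = - h (br x y))"
proof -
  let ?rep = "representation Basis"
  note rp = lin_rep[OF basis_indep basis_span]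
  have fl: "lin (f x)" "lin (\<lambda>x. f x y)" for x y using f unfolding bilin_def by auto
  have rneg: "?rep (- v) b = - ?rep v b" for v b using rp(2)[of "-1" v b] by simp
  have fr': "f y x = 0" if "x \<in> r" for x y using fr[OF that, of y] anti[of y x] by simp
  have "\<exists>\<delta>. \<forall>x y. ?rep (f x y) b = - kappa \<delta> (br x y)" for b
  proof (rule trivial_cocycle_form)
    show "?rep (f x y) b = - ?rep (f y x) b" for x y using anti[of x y] rneg by metis
    show "?rep (f (br x y) z) b + ?rep (f (br y z) x) b + ?rep (f (br z x) y) b = 0" for x y z
      using cyc[of x y z] by (simp add: rp(4) flip: rp(1))
  qed (simp_all add: rp lin_addD[OF fl(1)] lin_addD[OF fl(2)] lin_scaleD[OF fl(1)] lin_scaleD[OF fl(2)] fr fr')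
  then obtain \<delta> where \<delta>: "\<And>b x y. ?rep (f x y) b = - kappa (\<delta> b) (br x y)" by metis
  define h where "h z = (\<Sum>b\<in>Basis. scale (kappa (\<delta> b) z) b)" for z
  note k = form_add[OF kappa_form] form_scale[OF kappa_form]
  have "lin h"
    unfolding h_def by (rule linI) (simp_all add: k scale_left_distrib sum.distrib scale_sum_right)
  moreover have "f x y = - h (br x y)" for x y
    using rep_expand[OF basis_indep basis_span, of "f x y"] unfolding \<delta> h_def by (simp add: sum_negf)
  ultimately show ?thesis by (intro exI[of _ h]) (auto simp: h_def kappa_radical)
qed

text \<open>\<open>h1\<close> is the Casimir contraction of \<open>f\<close>; its coboundary is C f,
  so d h1 settles the range of \<open>P\<close>. The complement follows by induction, and trivial
  coefficients by \<open>trivial_cocycle_coboundary\<close>.\<close>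

theorem whitehead2:
  assumes "lie_rep \<rho>" "\<And>x v. x \<in> r \<Longrightarrow> \<rho> x v = 0" "bilin f" "\<And>x y. x \<in> r \<Longrightarrow> f x y = 0"
    "\<And>x y. f x y = - f y x"
    "\<And>x y z. f (br x y) z + f (br y z) x + f (br z x) y = \<rho> x (f y z) + \<rho> y (f z x) + \<rho> z (f x y)"
  shows "\<exists>h. lin h \<and> (\<forall>x\<in>r. h x = 0) \<and> (\<forall>x y. f x y = \<rho> x (h y) - \<rho> y (h x) - h (br x y))"
  using assms
proof (induction "action_dim \<rho>" arbitrary: \<rho> f rule: less_induct)
  case (less \<rho> f)
  note \<rho> = less.prems(1) and \<rho>r = less.prems(2) and f = less.prems(3-6)
  have fl: "lin (f x)" "lin (\<lambda>x. f x y)" for x y using f(1) unfolding bilin_def by auto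
  have fr': "f y x = 0" if "x \<in> r" for x y using f(2)[OF that, of y] f(3)[of y x] by simp
  show ?case
  proof (cases "\<forall>x v. \<rho> x v = 0")
    case True
    then show ?thesis using trivial_cocycle_coboundary[OF f(1-3)] f(4) by simp
  next
    case False
    then obtain x0 v0 where ne: "\<rho> x0 v0 \<noteq> 0" by blast
    obtain n e e' C d P where
      inv: "casimir_family n e e'" and C: "\<And>v. C v = (\<Sum>i<n. \<rho> (e i) (\<rho> (e' i) v))"
      and d: "lin d" "\<And>x v. d (\<rho> x v) = \<rho> x (d v)" "\<And>v. P v = d (C v)"
      and P: "lin P" "\<And>x v. P (\<rho> x v) = \<rho> x (P v)" "\<And>v. P (P v) = P v"
      and lt: "action_dim (\<lambda>x v. \<rho> x (v - P v)) < action_dim \<rho>"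
      by (rule casimir[OF \<rho> \<rho>r ne]) blast+
    define h1 where "h1 y = (\<Sum>i<n. \<rho> (e i) (f (e' i) y))" for y
    have h1l: "lin h1" unfolding h1_def by (intro lin_sum lin_comp[OF rep_lin1[OF \<rho>] fl(1)])
    have h1r: "h1 y = 0" if "y \<in> r" for y
      unfolding h1_def by (simp add: fr'[OF that] lin_zeroD[OF rep_lin1[OF \<rho>]])
    have Bf: "(\<Sum>i<n. \<rho> (br x (e i)) (f (e' i) y) + \<rho> (e i) (f (br x (e' i)) y)) = 0" for x y
      by (rule casimir_familyD[OF inv bilin_rep_comp[OF \<rho> fl(2)]]) (auto simp: \<rho>r f(2) lin_zeroD[OF rep_lin1[OF \<rho>]])
    have h1: "\<rho> x (h1 y) - \<rho> y (h1 x) - h1 (br x y) = C (f x y)" for x y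
    proof -
      \<comment> \<open>Termwise, the gap between the coboundary of \<open>h1\<close> and C f is a
        difference of two Casimir expressions, one for \<open>x\<close> and one for
        \<open>y\<close>; each sums to zero.\<close>
      have summand: "\<rho> x (\<rho> a (f b y)) - \<rho> y (\<rho> a (f b x)) - \<rho> a (f b (br x y)) - \<rho> a (\<rho> b (f x y)) =
        (\<rho> (br x a) (f b y) + \<rho> a (f (br x b) y)) - (\<rho> (br y a) (f b x) + \<rho> a (f (br y b) x))" for a b
      proof -
        have 1: "f (br x b) y = - f (br b x) y" using br_anti[of x b] by (simp add: lin_minusD[OF fl(2)])
        have 2: "f b (br x y) = - f (br x y) b" by (rule f(3))
        have 3: "f y b = - f b y" by (rule f(3))
        have "\<rho> x (f b y) - \<rho> y (f b x) - f b (br x y) - \<rho> b (f x y) = f (br x b) y - f (br y b) x"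
          using f(4)[of x y b] unfolding 1 2 3 by (simp add: lin_minusD[OF rep_lin1[OF \<rho>]] algebra_simps)
        then have "\<rho> a (\<rho> x (f b y) - \<rho> y (f b x) - f b (br x y) - \<rho> b (f x y)) = \<rho> a (f (br x b) y - f (br y b) x)"
          by simp
        then show ?thesis
          unfolding rep_br[OF \<rho>] lin_diffD[OF rep_lin1[OF \<rho>]] by (simp add: algebra_simps)
      qed
      have "\<rho> x (h1 y) - \<rho> y (h1 x) - h1 (br x y) - C (f x y) =
        (\<Sum>i<n. \<rho> x (\<rho> (e i) (f (e' i) y)) - \<rho> y (\<rho> (e i) (f (e' i) x)) - \<rho> (e i) (f (e' i) (br x y))
          - \<rho> (e i) (\<rho> (e' i) (f x y)))"
        unfolding h1_def C lin_sumD[OF rep_lin1[OF \<rho>]] by (simp add: sum_subtractf)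
      also have "\<dots> = 0" unfolding summand sum_subtractf Bf by simp
      finally show ?thesis by simp
    qed
    have Pf: "P (f x y) = \<rho> x (d (h1 y)) - \<rho> y (d (h1 x)) - d (h1 (br x y))" for x y
      unfolding d(3) h1[symmetric] by (simp add: lin_diffD[OF d(1)] d(2))
    have idm: "\<rho> x (f y z - P (f y z) - P (f y z - P (f y z))) = \<rho> x (f y z) - \<rho> x (P (f y z))" for x y z
      by (simp add: P lin_diffD[OF P(1)] lin_diffD[OF rep_lin1[OF \<rho>]])
    have "\<exists>h. lin h \<and> (\<forall>x\<in>r. h x = 0) \<and>
      (\<forall>x y. f x y - P (f x y) = \<rho> x (h y - P (h y)) - \<rho> y (h x - P (h x)) - h (br x y))"
    proof (rule less.hyps[OF lt complement_rep[OF \<rho> P], of "\<lambda>x y. f x y - P (f x y)"])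
      show "bilin (\<lambda>x y. f x y - P (f x y))"
        unfolding bilin_def
        using lin_diff[OF fl(1) lin_comp[OF P(1) fl(1)]] lin_diff[OF fl(2) lin_comp[OF P(1) fl(2)]] by blast
      show "f x y - P (f x y) = - (f y x - P (f y x))" for x y
        using f(3)[of x y] by (simp add: lin_minusD[OF P(1)])
      show "f (br x y) z - P (f (br x y) z) + (f (br y z) x - P (f (br y z) x)) + (f (br z x) y - P (f (br z x) y)) =
         \<rho> x (f y z - P (f y z) - P (f y z - P (f y z))) + \<rho> y (f z x - P (f z x) - P (f z x - P (f z x))) +
         \<rho> z (f x y - P (f x y) - P (f x y - P (f x y)))" for x y z
      proof -
        have "P (f (br x y) z + f (br y z) x + f (br z x) y) = P (\<rho> x (f y z) + \<rho> y (f z x) + \<rho> z (f x y))"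
          by (simp only: f(4))
        then have "P (f (br x y) z) + P (f (br y z) x) + P (f (br z x) y) =
          \<rho> x (P (f y z)) + \<rho> y (P (f z x)) + \<rho> z (P (f x y))"
          by (simp add: lin_addD[OF P(1)] P(2))
        with f(4)[of x y z] show ?thesis unfolding idm by (simp add: algebra_simps)
      qed
    qed (auto simp: \<rho>r f(2) lin_zeroD[OF P(1)])
    then obtain h2 where h2: "lin h2" "\<And>x. x \<in> r \<Longrightarrow> h2 x = 0"
      "\<And>x y. f x y - P (f x y) = \<rho> x (h2 y - P (h2 y)) - \<rho> y (h2 x - P (h2 x)) - h2 (br x y)" by blast
    \<comment> \<open>The induction hypothesis does not place \<open>h2\<close> in the complement.
      Applying \<open>P\<close> to its equation shows that P h2 vanishes on brackets, so h2 - P h2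
      serves as well.\<close>
    have Ph2: "f x y - P (f x y) = \<rho> x (h2 y - P (h2 y)) - \<rho> y (h2 x - P (h2 x)) - (h2 (br x y) - P (h2 (br x y)))"
      for x y
    proof -
      have "P (f x y - P (f x y)) = P (\<rho> x (h2 y - P (h2 y)) - \<rho> y (h2 x - P (h2 x)) - h2 (br x y))"
        by (simp only: h2(3))
      then have "P (h2 (br x y)) = 0" by (simp add: lin_diffD[OF P(1)] P lin_zeroD[OF rep_lin1[OF \<rho>]])
      then show ?thesis using h2(3)[of x y] by simp
    qed
    define h where "h z = d (h1 z) + (h2 z - P (h2 z))" for z
    have "lin h"
      unfolding h_def by (intro lin_add lin_diff lin_comp[OF d(1) h1l] h2(1) lin_comp[OF P(1) h2(1)])
    moreover have "h x = 0" if "x \<in> r" for x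
      unfolding h_def by (simp add: h1r[OF that] h2(2)[OF that] lin_zeroD[OF P(1)] lin_zeroD[OF d(1)])
    moreover have "f x y = \<rho> x (h y) - \<rho> y (h x) - h (br x y)" for x y
      using Ph2[of x y] Pf[of x y] unfolding h_def lin_addD[OF rep_lin1[OF \<rho>]]
      by (simp add: algebra_simps)
    ultimately show ?thesis by blast
  qed
qed

end

context lie_space
begin

subsection \<open>The radical of a perfect Lie algebra acts nilpotently\<close>

text \<open>Equality with the derived algebra in dual form, ready for maps such as traces that
  vanish on brackets.\<close>

definition perfect :: bool
  where "perfect \<longleftrightarrow> (\<forall>c. lin c \<longrightarrow> (\<forall>x y. c (br x y) = 0) \<longrightarrow> (\<forall>x. c x = 0))"

text \<open>\<open>lin\<close> covers only maps into the space itself, so the functional is encoded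
  as y \<mapsto> t y x; its value at \<open>x\<close> is t x times x.\<close>

lemma perfect_functional:
  fixes t :: "'v \<Rightarrow> 'k"
  assumes perfect "\<And>x y. t (x + y) = t x + t y" "\<And>c x. t (scale c x) = c * t x" "\<And>x y. t (br x y) = 0"
  shows "t x = 0"
proof -
  have "lin (\<lambda>y. scale (t y) x)" by (rule linI) (simp_all add: assms scale_left_distrib)
  from assms(1)[unfolded perfect_def, rule_format, OF this, of x] have "scale (t x) x = 0"
    by (simp add: assms(4))
  moreover have "t 0 = 0" using assms(3)[of 0 0] by simp
  ultimately show ?thesis by auto
qed

lemma tr_rep_perfect:
  assumes perfect and \<rho>: "lie_rep \<rho>" and d: "lin d" "\<And>x v. \<rho> x (d v) = d (\<rho> x v)"
  shows "tr (\<lambda>v. \<rho> x (d v)) = 0"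
proof (rule perfect_functional[OF assms(1)])
  fix x y
  have "tr (\<lambda>v. \<rho> x (\<rho> y (d v))) = tr (\<lambda>v. \<rho> y (\<rho> x (d v)))"
    using tr_comm[OF rep_lin1[OF \<rho>] lin_comp[OF rep_lin1[OF \<rho>] d(1)], of x y] by (simp add: d(2))
  then show "tr (\<lambda>v. \<rho> (br x y) (d v)) = 0" by (simp add: rep_br[OF \<rho>] tr_diff)
qed (simp_all add: lin_addD[OF rep_lin2[OF \<rho>]] lin_scaleD[OF rep_lin2[OF \<rho>]] tr_add tr_scale)

lemma perfect_tr_zero: "perfect \<Longrightarrow> lie_rep \<rho> \<Longrightarrow> tr (\<rho> x) = 0"
  using tr_rep_perfect[OF _ _ lin_id, of \<rho> x] by simp

text \<open>Take \<open>U\<close> minimal above \<open>W\<close>, so that U/W is irreducible, and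
  climb the derived series of \<open>r\<close>. If the derived ideal of \<open>A\<close> acts as
  zero, \<open>A\<close> acts by commuting operators. Then [A, V] acts with vanishing traces, hence
  nilpotently, hence as zero. So \<open>A\<close> commutes with the whole action; now perfectness
  makes the traces vanish, and \<open>A\<close> too acts as zero.\<close>

lemma solvable_ideal_fixes_vector:
  assumes perf: perfect and r: "lie_ideal r" "solvable r" and W: "lie_ideal W" "W \<noteq> UNIV"
  shows "\<exists>u. u \<notin> W \<and> (\<forall>x\<in>r. br x u \<in> W)"
proof -
  have UNIV: "lie_ideal UNIV" unfolding lie_ideal_def by (simp add: subspace_UNIV)
  define A where "A = {U. lie_ideal U \<and> W \<subset> U}"
  have "UNIV \<in> A" unfolding A_def using W UNIV by auto
  then obtain U where U: "U \<in> A" "\<And>U'. U' \<in> A \<Longrightarrow> dim U \<le> dim U'"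
    using arg_min_natI[of "\<lambda>U. U \<in> A" UNIV dim] arg_min_nat_le[of "\<lambda>U. U \<in> A" _ dim] by blast
  then have UI: "lie_ideal U" and WU: "W \<subset> U" unfolding A_def by auto
  have irr: "M = U" if M: "lie_ideal M" "W \<subset> M" "M \<subseteq> U" for M
  proof (rule subspace_dim_equal)
    show "dim U \<le> dim M" using M by (intro U(2)) (simp add: A_def)
  qed (use M UI ideal_subspace in auto)
  note sW = ideal_subspace[OF W(1)] and sU = ideal_subspace[OF UI]
  obtain q where q: "lin q" "\<And>v. q v \<in> U" "\<And>w. w \<in> W \<Longrightarrow> q w = 0" "\<And>u. u \<in> U \<Longrightarrow> u - q u \<in> W" "\<And>v. q (q v) = q v"
    by (rule subquotient_projection[OF sU sW]) (use WU in auto)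
  define \<rho> where "\<rho> x v = q (br x (q v))" for x v
  have \<rho>: "lie_rep \<rho>"
    unfolding \<rho>_def
    by (rule lie_rep_subquotient[OF lie_rep_br q(1-4)]) (auto simp: q(5) ideal_br[OF UI] ideal_br[OF W(1)])
  have \<rho>0: "\<rho> x u = 0 \<longleftrightarrow> br x u \<in> W" if u: "u \<in> U" for x u
  proof -
    have "br x (u - q u) \<in> W" by (rule ideal_br[OF W(1) q(4)[OF u]])
    then have "q (br x (u - q u)) = 0" by (rule q(3))
    then have "\<rho> x u = q (br x u)" unfolding \<rho>_def by (simp add: br_diff lin_diffD[OF q(1)])
    moreover have "br x u \<in> W" if "q (br x u) = 0" using q(4)[OF ideal_br[OF UI u], of x] that by simp
    ultimately show ?thesis using q(3) by auto
  qed
  have \<rho>q: "\<rho> x (q v) = \<rho> x v" for x v unfolding \<rho>_def q(5) ..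
  \<comment> \<open>An ideal acting nilpotently kills a nonzero vector of U/W by Engel. The vectors
    so killed form an ideal strictly above \<open>W\<close>, which by minimality is
    \<open>U\<close>.\<close>
  have vanish: "\<rho> a v = 0" if A: "lie_ideal A" and nil: "\<And>a. a \<in> A \<Longrightarrow> \<exists>k. \<forall>v. (\<rho> a ^^ k) v = 0" and a: "a \<in> A"
    for A a v
  proof -
    have eng: "engel_property \<rho> A" by (rule engel[OF \<rho> ideal_subalg[OF A] nil])
    have sq: "subspace (range q)" by (rule subspace_image[OF q(1) subspace_UNIV])
    have "range q \<noteq> {0}"
    proof
      assume *: "range q = {0}"
      obtain u where u: "u \<in> U" "u \<notin> W" using WU by blast
      have "q u = 0" using * by auto
      then show False using q(4)[OF u(1)] u(2) by simp
    qed
    then have sub: "{0} \<subset> range q" using subspace_0[OF sq] by auto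
    obtain u where u: "u \<in> range q" "u \<noteq> 0" "\<And>a. a \<in> A \<Longrightarrow> \<rho> a u = 0"
      by (rule engel_propertyD[OF eng subspace_single_0 sq sub])
        (auto simp: \<rho>_def lin_zeroD[OF q(1)] br_zero)
    have uU: "u \<in> U" "u \<notin> W" using u(1,2) q(2,3,5) by force+
    let ?M = "{u\<in>U. \<forall>a\<in>A. br a u \<in> W}"
    have "lie_ideal ?M"
      unfolding lie_ideal_def
    proof (intro conjI allI ballI)
      have "?M = U \<inter> \<Inter> ((\<lambda>a. {u. br a u \<in> W}) ` A)" by auto
      moreover have "subspace \<dots>"
        by (intro subspace_inter sU subspace_Inter) (auto intro: subspace_vimage[OF br_lin(1) sW])
      ultimately show "subspace ?M" by simp
      fix y u assume u: "u \<in> ?M"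
      have "br a (br y u) \<in> W" if a: "a \<in> A" for a
      proof -
        have "br (br a y) u \<in> W" using u ideal_br'[OF A a] by blast
        moreover have "br y (br a u) \<in> W" using u a by (intro ideal_br[OF W(1), of "br a u"]) blast
        ultimately show ?thesis unfolding br_br_right[of a y u] by (rule subspace_add[OF sW])
      qed
      then show "br y u \<in> ?M" using u ideal_br[OF UI] by blast
    qed
    moreover have "W \<subseteq> ?M" using WU ideal_br[OF W(1)] by blast
    moreover have "u \<in> ?M" using u(3) uU(1) \<rho>0 by auto
    ultimately have "?M = U" using uU(2) by (intro irr) blast+
    then have "\<rho> a (q v) = 0" using q(2)[of v] a \<rho>0 by blast
    then show ?thesis by (simp add: \<rho>q)
  qed
  have step: "\<forall>a\<in>A. \<forall>v. \<rho> a v = 0" if A: "lie_ideal A" and A': "\<And>a v. a \<in> derived A \<Longrightarrow> \<rho> a v = 0" for A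
  proof -
    let ?E = "span {br a b |a b. a \<in> A}"
    have EA: "?E \<subseteq> A" by (intro span_minimal ideal_subspace[OF A]) (auto intro: ideal_br'[OF A])
    have E: "lie_ideal ?E"
      unfolding lie_ideal_def
    proof (intro conjI allI ballI subspace_span)
      fix x y assume "y \<in> ?E"
      then have "y \<in> A" using EA by blast
      then have "br y (- x) \<in> ?E" by (intro span_base) blast
      then show "br x y \<in> ?E" by (simp add: br_minus br_anti[of y x])
    qed
    have comm: "\<rho> a (\<rho> b v) = \<rho> b (\<rho> a v)" if "a \<in> A" "b \<in> A" for a b v
      using A'[OF br_mem_derived[OF that], of v] by (simp add: rep_br[OF \<rho>])
    have nilE: "\<exists>k. \<forall>v. (\<rho> z ^^ k) v = 0" if z: "z \<in> ?E" for z
    proof -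
      have zA: "z \<in> A" using z EA by blast
      obtain k where "\<And>v. (\<rho> z ^^ k) v = 0"
      proof (rule nilpotent_if_traces_vanish[OF rep_lin1[OF \<rho>, of z]])
        fix d assume d: "lin d" and dc: "\<And>h x. lin h \<Longrightarrow> (\<And>y. h (\<rho> z y) = \<rho> z (h y)) \<Longrightarrow> h (d x) = d (h x)"
        have da: "\<rho> a (d v) = d (\<rho> a v)" if "a \<in> A" for a v
          using comm[OF that zA] by (intro dc rep_lin1[OF \<rho>])
        have "?E \<subseteq> {y. tr (\<lambda>v. \<rho> y (d v)) = 0}"
        proof (rule span_minimal)
          show "subspace {y. tr (\<lambda>v. \<rho> y (d v)) = 0}"
            unfolding subspace_def
            by (auto simp: lin_addD[OF rep_lin2[OF \<rho>]] lin_scaleD[OF rep_lin2[OF \<rho>]]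
                lin_zeroD[OF rep_lin2[OF \<rho>]] tr_add tr_scale tr_0)
          have "tr (\<lambda>v. \<rho> (br a b) (d v)) = 0" if "a \<in> A" for a b
            using tr_comm[OF rep_lin1[OF \<rho>] lin_comp[OF rep_lin1[OF \<rho>] d], of a b]
            by (simp add: rep_br[OF \<rho>] tr_diff da[OF that])
          then show "{br a b |a b. a \<in> A} \<subseteq> {y. tr (\<lambda>v. \<rho> y (d v)) = 0}" by auto
        qed
        then show "tr (\<lambda>v. \<rho> z (d v)) = 0" using z by blast
      qed blast
      then show ?thesis by blast
    qed
    have central: "\<rho> a (\<rho> b v) = \<rho> b (\<rho> a v)" if "a \<in> A" for a b v
    proof -
      have "br a b \<in> ?E" using that by (intro span_base) blast
      then have "\<rho> (br a b) v = 0" using vanish[OF E] nilE by blast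
      then show ?thesis by (simp add: rep_br[OF \<rho>])
    qed
    have "\<exists>k. \<forall>v. (\<rho> a ^^ k) v = 0" if a: "a \<in> A" for a
    proof -
      obtain k where "\<And>v. (\<rho> a ^^ k) v = 0"
      proof (rule nilpotent_if_traces_vanish[OF rep_lin1[OF \<rho>, of a]])
        fix d assume d: "lin d" and dc: "\<And>h x. lin h \<Longrightarrow> (\<And>y. h (\<rho> a y) = \<rho> a (h y)) \<Longrightarrow> h (d x) = d (h x)"
        show "tr (\<lambda>v. \<rho> a (d v)) = 0"
          by (rule tr_rep_perfect[OF perf \<rho> d]) (intro dc rep_lin1[OF \<rho>] central[OF a, symmetric])
      qed blast
      then show ?thesis by blast
    qed
    then show ?thesis using vanish[OF A] by blast
  qed
  obtain K where K: "(derived ^^ K) r = {0}" using r(2) unfolding solvable_def by blast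
  have "\<forall>a\<in>(derived ^^ (K - i)) r. \<forall>v. \<rho> a v = 0" for i
  proof (induction i)
    case 0
    then show ?case using K by (simp add: lin_zeroD[OF rep_lin2[OF \<rho>]])
  next
    case (Suc i)
    show ?case
    proof (cases "i < K")
      case True
      then have "K - i = Suc (K - Suc i)" by simp
      then show ?thesis using Suc by (intro step ideal_derived_pow r(1)) simp
    next
      case False
      then show ?thesis using Suc by simp
    qed
  qed
  from this[of K] have "\<rho> a v = 0" if "a \<in> r" for a v using that by simp
  moreover obtain u where "u \<in> U" "u \<notin> W" using WU by blast
  ultimately show ?thesis using \<rho>0 by blast
qed

lemma ann_chain_ideal:
  assumes r: "lie_ideal r"
  shows "lie_ideal (ann_chain br r j)"
proof (induction j)
  case 0
  then show ?case unfolding lie_ideal_def by (simp add: subspace_single_0 br_zero)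
next
  case (Suc j)
  show ?case
    unfolding lie_ideal_def
  proof (intro conjI allI ballI ann_chain_subspace[OF lie_rep_br])
    fix x y assume y: "y \<in> ann_chain br r (Suc j)"
    have "br z (br x y) \<in> ann_chain br r j" if z: "z \<in> r" for z
    proof -
      have "br (br z x) y \<in> ann_chain br r j" using y ideal_br'[OF r z] by simp
      moreover have "br x (br z y) \<in> ann_chain br r j" using y z by (intro ideal_br[OF Suc, of "br z y"]) simp
      ultimately show ?thesis
        unfolding br_br_right[of z x y] by (rule subspace_add[OF ideal_subspace[OF Suc]])
    qed
    then show "br x y \<in> ann_chain br r (Suc j)" by simp
  qed
qed

theorem radical_chain_exhausts:
  assumes perfect "lie_ideal r" "solvable r"
  obtains k where "ann_chain br r k = UNIV"
  by (rule ann_chain_exhausts[OF lie_rep_br, of r])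
    (use solvable_ideal_fixes_vector[OF assms ann_chain_ideal[OF assms(2)]] in auto)

subsection \<open>Exponentials of nilpotent inner derivations\<close>

text \<open>exp(ad w), truncated after degree \<open>N\<close>. One \<open>N\<close> serves all
  \<open>w\<close> in the radical, since the length of the chain bounds all nilpotency
  indices.\<close>

definition expo :: "nat \<Rightarrow> 'v \<Rightarrow> 'v \<Rightarrow> 'v"
  where "expo N w v = (\<Sum>i\<le>N. scale (1 / fact i) ((br w ^^ i) v))"

lemma lin_br_pow: "lin (br w ^^ i)"
  by (rule lin_funpow[OF br_lin(1)])

lemma lin_expo: "lin (expo N w)"
  unfolding expo_def by (intro lin_sum lin_scale lin_br_pow)

lemma br_pow_leibniz:
  "scale (1 / fact m) ((br w ^^ m) (br x y)) =
    (\<Sum>i\<le>m. br (scale (1 / fact i) ((br w ^^ i) x)) (scale (1 / fact (m - i)) ((br w ^^ (m - i)) y)))"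
proof (induction m)
  case (Suc m)
  define d where "d i v = scale (1 / fact i) ((br w ^^ i) v)" for i v
  have D: "br w (d i v) = scale (of_nat (Suc i)) (d (Suc i) v)" for i v
    unfolding d_def by (simp add: br_scale field_simps del: of_nat_Suc)
  have "scale (of_nat (Suc m)) (d (Suc m) (br x y)) = br w (d m (br x y))" by (rule D[symmetric])
  also have "d m (br x y) = (\<Sum>i\<le>m. br (d i x) (d (m - i) y))" using Suc unfolding d_def .
  also have "br w \<dots> = (\<Sum>i\<le>m. br (br w (d i x)) (d (m - i) y)) + (\<Sum>i\<le>m. br (d i x) (br w (d (m - i) y)))"
    by (simp add: lin_sumD[OF br_lin(1)] br_br_right[of w] sum.distrib)
  also have "(\<Sum>i\<le>m. br (br w (d i x)) (d (m - i) y)) =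
      (\<Sum>i\<le>m. scale (of_nat (Suc i)) (br (d (Suc i) x) (d (Suc m - Suc i) y)))"
    by (simp add: D br_scale del: of_nat_Suc)
  also have "\<dots> = (\<Sum>i\<le>Suc m. scale (of_nat i) (br (d i x) (d (Suc m - i) y)))"
    by (subst sum.atMost_Suc_shift) simp
  also have "(\<Sum>i\<le>m. br (d i x) (br w (d (m - i) y))) =
      (\<Sum>i\<le>m. scale (of_nat (Suc m - i)) (br (d i x) (d (Suc m - i) y)))"
    by (intro sum.cong refl) (simp add: D br_scale Suc_diff_le del: of_nat_Suc)
  also have "\<dots> = (\<Sum>i\<le>Suc m. scale (of_nat (Suc m - i)) (br (d i x) (d (Suc m - i) y)))"
    by simp
  also have "(\<Sum>i\<le>Suc m. scale (of_nat i) (br (d i x) (d (Suc m - i) y))) + \<dots> =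
      (\<Sum>i\<le>Suc m. scale (of_nat (Suc m)) (br (d i x) (d (Suc m - i) y)))"
    unfolding sum.distrib[symmetric] scale_left_distrib[symmetric] of_nat_add[symmetric]
    by (intro sum.cong refl) simp
  also have "\<dots> = scale (of_nat (Suc m)) (\<Sum>i\<le>Suc m. br (d i x) (d (Suc m - i) y))"
    by (rule scale_sum_right[symmetric])
  finally have "d (Suc m) (br x y) = (\<Sum>i\<le>Suc m. br (d i x) (d (Suc m - i) y))"
    by (simp del: of_nat_Suc sum.atMost_Suc)
  then show ?case unfolding d_def .
qed simp

text \<open>The Leibniz rule gives the terms with i + j at most N, the product of exponentials those
  of the whole square. Outside the triangle i + j exceeds 2k, so \<open>i\<close> or
  \<open>j\<close> reaches \<open>k\<close> and the term vanishes.\<close>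

lemma expo_hom:
  assumes nil: "\<And>v. (br w ^^ k) v = 0" and N: "2 * k \<le> N"
  shows "expo N w (br x y) = br (expo N w x) (expo N w y)"
proof -
  define d where "d i v = scale (1 / fact i) ((br w ^^ i) v)" for i v
  have d0: "d i v = 0" if "k \<le> i" for i v
  proof -
    have "(br w ^^ i) v = (br w ^^ (i - k)) ((br w ^^ k) v)" using that by (simp flip: funpow_add[THEN fun_cong, unfolded o_def])
    then show ?thesis unfolding d_def by (simp add: nil lin_zeroD[OF lin_br_pow])
  qed
  have "expo N w (br x y) = (\<Sum>m\<le>N. \<Sum>i\<le>m. br (d i x) (d (m - i) y))"
    unfolding expo_def br_pow_leibniz d_def ..
  also have "\<dots> = (\<Sum>(i, j)\<in>{(i, j). i + j \<le> N}. br (d i x) (d j y))"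
    by (rule sum.triangle_reindex_eq[symmetric])
  also have "\<dots> = (\<Sum>(i, j)\<in>{..N} \<times> {..N}. br (d i x) (d j y))"
  proof (rule sum.mono_neutral_left, goal_cases)
    case 3
    have "br (d i x) (d j y) = 0" if "\<not> i + j \<le> N" for i j
    proof -
      have "k \<le> i \<or> k \<le> j" using that N by linarith
      then show ?thesis using d0 by (auto simp: br_zero)
    qed
    then show ?case by auto
  qed auto
  also have "\<dots> = (\<Sum>i\<le>N. \<Sum>j\<le>N. br (d i x) (d j y))" by (rule sum.cartesian_product[symmetric])
  also have "\<dots> = br (expo N w x) (expo N w y)"
    unfolding expo_def d_def lin_sumD[OF br_lin(2)] lin_sumD[OF br_lin(1)] by (rule sum.swap)
  finally show ?thesis .
qed

end

section \<open>The radical of the complete Lie algebra\<close>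

text \<open>The bracket of \<open>g\<close> is recovered from axiom (1) with \<open>x \<cdot> y = {\<phi> x, y}\<close>: such a \<open>\<phi>\<close> is a
  Rota--Baxter operator of weight one on \<open>n\<close>.\<close>

locale rota_baxter_pair = fin_dim_space scale Basis + g: lie_space scale Basis brg + n: lie_space scale Basis brn
  for scale :: "'k::field_char_0 \<Rightarrow> 'v::ab_group_add \<Rightarrow> 'v" and Basis and brg brn :: "'v \<Rightarrow> 'v \<Rightarrow> 'v" +
  fixes \<phi> \<psi> :: "'v \<Rightarrow> 'v" and r :: "'v set" and p :: "'v \<Rightarrow> 'v"
  assumes \<phi>_lin: "lin \<phi>"
    and \<phi>_hom: "\<phi> (brg x y) = brn (\<phi> x) (\<phi> y)"
    and \<psi>_def: "\<psi> x = \<phi> x + x"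
    and brg_eq: "brg x y = brn (\<phi> x) y - brn (\<phi> y) x + brn x y"
    and g_semisimple: "g.is_radical {0}"
    and r_radical: "n.is_radical r"
    and p_lin: "lin p" and p_mem: "p v \<in> r" and p_id: "v \<in> r \<Longrightarrow> p v = v"
begin

lemma \<psi>_lin: "lin \<psi>"
  unfolding \<psi>_def[abs_def] by (intro lin_add \<phi>_lin lin_id)

lemma \<psi>_hom: "\<psi> (brg x y) = brn (\<psi> x) (\<psi> y)"
proof -
  have "\<psi> (brg x y) = brn (\<phi> x) (\<phi> y) + brg x y" unfolding \<psi>_def \<phi>_hom ..
  also have "\<dots> = brn (\<psi> x) (\<psi> y)"
    unfolding \<psi>_def brg_eq n.br_add n.br_anti[of x "\<phi> y"] by (simp add: algebra_simps)
  finally show ?thesis .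
qed

sublocale gr: lie_radical scale Basis brg "{0}" "\<lambda>v. v"
  by unfold_locales (simp_all add: g_semisimple lin_id)

sublocale nr: lie_radical scale Basis brn r "\<lambda>v. v - p v"
proof (rule lie_radical.intro[OF n.lie_space_axioms], rule lie_radical_axioms.intro)
  have "p (p v) = p v" for v by (rule p_id[OF p_mem])
  then show "v - p v - p (v - p v) = v - p v" for v by (simp add: lin_diffD[OF p_lin])
  show "lin (\<lambda>v. v - p v)" by (intro lin_diff lin_id p_lin)
qed (simp_all add: r_radical p_id p_mem)

lemma r_ideal: "n.lie_ideal r" and r_solvable: "n.solvable r"
  using r_radical unfolding n.is_radical_def by auto

lemma g_perfect: "g.perfect"
  unfolding g.perfect_def
proof (intro allI impI)
  fix c x assume c: "lin c" "\<forall>x y. c (brg x y) = 0"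
  show "c x = 0" by (rule gr.perfect_mod_radical[OF c(1)]) (simp_all add: c(2) lin_zeroD[OF c(1)])
qed

lemma n_perfect: "n.perfect"
  unfolding n.perfect_def
proof (intro allI impI)
  fix c x assume c: "lin c" and b: "\<forall>x y. c (brn x y) = 0"
  have "c (\<phi> x) = 0" "c (\<psi> x) = 0" for x
    using g_perfect[unfolded g.perfect_def, rule_format, OF lin_comp[OF c \<phi>_lin], of x]
      g_perfect[unfolded g.perfect_def, rule_format, OF lin_comp[OF c \<psi>_lin], of x] b
    by (simp_all add: \<phi>_hom \<psi>_hom)
  then show "c x = 0" using lin_addD[OF c, of "\<phi> x" x] by (simp add: \<psi>_def)
qed

text \<open>A chain of ideals from \<open>{0}\<close> up to \<open>r\<close> on whose layers
  \<open>r\<close> acts as zero. Layers are thus modules over n/r, and quadratic error terms drop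
  one level and can be ignored.\<close>

abbreviation Y :: "nat \<Rightarrow> 'v set"
  where "Y j \<equiv> n.ann_chain brn r j \<inter> r"

lemma Y_ideal: "n.lie_ideal (Y j)"
  by (intro n.ideal_Int n.ann_chain_ideal r_ideal)

lemma Y_subspace: "subspace (Y j)"
  by (rule n.ideal_subspace[OF Y_ideal])

lemma Y_Suc: "Y j \<subseteq> Y (Suc j)"
  using n.ann_chain_Suc[OF n.lie_rep_br] by blast

lemma Y_lower: "x \<in> r \<Longrightarrow> y \<in> Y (Suc j) \<Longrightarrow> brn x y \<in> Y j"
  using n.ideal_br[OF r_ideal, of y x] by auto

lemma Y_lower': "x \<in> r \<Longrightarrow> y \<in> Y (Suc j) \<Longrightarrow> brn y x \<in> Y j"
  using Y_lower[of x y j] subspace_neg[OF Y_subspace] unfolding n.br_anti[of y x] by blast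

lemma Y_zero: "Y 0 = {0}"
  using subspace_0[OF nr.r_subspace] by auto

lemma layer_projection:
  obtains q where "lin q" "\<And>v. q v \<in> Y (Suc j)" "\<And>w. w \<in> Y j \<Longrightarrow> q w = 0"
    "\<And>u. u \<in> Y (Suc j) \<Longrightarrow> u - q u \<in> Y j" "\<And>v. q (q v) = q v"
    "n.lie_rep (\<lambda>x v. q (brn x (q v)))" "\<And>z v. v \<in> Y (Suc j) \<Longrightarrow> q (brn z (q v)) = q (brn z v)"
proof -
  obtain q where q: "lin q" "\<And>v. q v \<in> Y (Suc j)" "\<And>w. w \<in> Y j \<Longrightarrow> q w = 0"
    "\<And>u. u \<in> Y (Suc j) \<Longrightarrow> u - q u \<in> Y j" "\<And>v. q (q v) = q v"
    by (rule subquotient_projection[OF Y_subspace[of "Suc j"] Y_subspace[of j] Y_Suc]) blast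
  have "n.lie_rep (\<lambda>x v. q (brn x (q v)))"
    by (rule n.lie_rep_subquotient[OF n.lie_rep_br q])
      ((assumption | (rule n.ideal_br[OF Y_ideal], assumption))+)
  moreover have "q (brn z (q v)) = q (brn z v)" if "v \<in> Y (Suc j)" for z v
  proof -
    have "q (brn z (v - q v)) = 0" by (intro q(3) n.ideal_br[OF Y_ideal] q(4) that)
    then show ?thesis by (simp add: n.br_diff lin_diffD[OF q(1)])
  qed
  ultimately show thesis using that[OF q] by blast
qed

text \<open>Whitehead's first lemma for g acting on a layer through a homomorphism \<chi> into n. It
  is used with \<chi> = \<phi> for the Levi projection and with the current approximation of \<psi>
  for the conjugation.\<close>

lemma layer_coboundary:
  assumes \<chi>: "lin \<chi>" "\<And>x y. \<chi> (brg x y) = brn (\<chi> x) (\<chi> y)"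
    and c: "lin c" "\<And>x. c x \<in> Y (Suc j)"
    and coc: "\<And>x y. c (brg x y) - (brn (\<chi> x) (c y) - brn (\<chi> y) (c x)) \<in> Y j"
  obtains u where "u \<in> Y (Suc j)" "\<And>x. c x - brn (\<chi> x) u \<in> Y j"
proof -
  obtain q where q: "lin q" "\<And>v. q v \<in> Y (Suc j)" "\<And>w. w \<in> Y j \<Longrightarrow> q w = 0"
    "\<And>u. u \<in> Y (Suc j) \<Longrightarrow> u - q u \<in> Y j" "\<And>v. q (q v) = q v"
    and nrep: "n.lie_rep (\<lambda>x v. q (brn x (q v)))"
    and qbr: "\<And>z v. v \<in> Y (Suc j) \<Longrightarrow> q (brn z (q v)) = q (brn z v)"
    by (rule layer_projection[of j]) blast
  have rep: "g.lie_rep (\<lambda>x v. q (brn (\<chi> x) (q v)))"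
    unfolding g.lie_rep_def
  proof (intro conjI allI)
    show "lin (\<lambda>v. q (brn (\<chi> x) (q v)))" for x by (rule n.rep_lin1[OF nrep])
    show "lin (\<lambda>x. q (brn (\<chi> x) (q v)))" for v by (rule lin_comp[OF n.rep_lin2[OF nrep] \<chi>(1)])
    show "q (brn (\<chi> (brg x y)) (q v)) = q (brn (\<chi> x) (q (q (brn (\<chi> y) (q v))))) - q (brn (\<chi> y) (q (q (brn (\<chi> x) (q v)))))"
      for x y v unfolding \<chi>(2) by (rule n.rep_br[OF nrep])
  qed
  have "\<exists>m. \<forall>x. q (c x) = q (brn (\<chi> x) (q m))"
  proof (rule gr.whitehead1[OF rep])
    show "lin (\<lambda>x. q (c x))" by (rule lin_comp[OF q(1) c(1)])
    show "q (c (brg x y)) = q (brn (\<chi> x) (q (q (c y)))) - q (brn (\<chi> y) (q (q (c x))))" for x y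
      using q(3)[OF coc[of x y]] by (simp add: q(5) qbr[OF c(2)] lin_diffD[OF q(1)])
  qed (simp_all add: lin_zeroD[OF q(1)] lin_zeroD[OF c(1)] lin_zeroD[OF \<chi>(1)] n.br_zero)
  then obtain m where m: "\<And>x. q (c x) = q (brn (\<chi> x) (q m))" by blast
  show thesis
  proof (rule that[of "q m"])
    show "q m \<in> Y (Suc j)" by (rule q(2))
    fix x
    let ?b = "brn (\<chi> x) (q m)"
    have "?b \<in> Y (Suc j)" by (rule n.ideal_br[OF Y_ideal q(2)])
    then have "(c x - q (c x)) - (?b - q ?b) \<in> Y j" by (intro subspace_diff[OF Y_subspace] q(4) c(2))
    then show "c x - ?b \<in> Y j" unfolding m by simp
  qed
qed

subsection \<open>A Levi projection fixing the image of \<open>\<phi>\<close>\<close>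

text \<open>\<open>levi_map j\<close> describes a linear projection along \<open>r\<close> that is a homomorphism fixing
  \<open>\<phi>(g)\<close> up to errors in \<open>Y j\<close>.\<close>

definition levi_map :: "nat \<Rightarrow> ('v \<Rightarrow> 'v) \<Rightarrow> bool"
  where "levi_map j \<tau> \<longleftrightarrow> lin \<tau> \<and> (\<forall>x\<in>r. \<tau> x = 0) \<and> (\<forall>v. v - \<tau> v \<in> r) \<and>
    (\<forall>x y. brn (\<tau> x) (\<tau> y) - \<tau> (brn x y) \<in> Y j) \<and> (\<forall>x. \<phi> x - \<tau> (\<phi> x) \<in> Y j)"

text \<open>Modulo \<open>Y j\<close> the failure of \<tau> to be a homomorphism is a 2-cocycle of
  n/r in the layer; subtracting a cochain that it bounds removes it. The condition on \<phi> keeps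
  its old level here and is repaired in \<open>levi_step\<close>.\<close>

lemma levi_step_hom:
  assumes "levi_map (Suc j) \<tau>"
  obtains \<tau>' where "lin \<tau>'" "\<And>x. x \<in> r \<Longrightarrow> \<tau>' x = 0" "\<And>v. v - \<tau>' v \<in> r"
    "\<And>x y. brn (\<tau>' x) (\<tau>' y) - \<tau>' (brn x y) \<in> Y j" "\<And>x. \<phi> x - \<tau>' (\<phi> x) \<in> Y (Suc j)"
proof -
  have \<tau>: "lin \<tau>" "\<And>x. x \<in> r \<Longrightarrow> \<tau> x = 0" "\<And>v. v - \<tau> v \<in> r"
    and hom: "\<And>x y. brn (\<tau> x) (\<tau> y) - \<tau> (brn x y) \<in> Y (Suc j)"
    and fix\<phi>: "\<And>x. \<phi> x - \<tau> (\<phi> x) \<in> Y (Suc j)"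
    using assms unfolding levi_map_def by auto
  obtain q where q: "lin q" "\<And>v. q v \<in> Y (Suc j)" "\<And>w. w \<in> Y j \<Longrightarrow> q w = 0"
    "\<And>u. u \<in> Y (Suc j) \<Longrightarrow> u - q u \<in> Y j" "\<And>v. q (q v) = q v"
    and rep: "n.lie_rep (\<lambda>x v. q (brn x (q v)))"
    and qbr: "\<And>z v. v \<in> Y (Suc j) \<Longrightarrow> q (brn z (q v)) = q (brn z v)"
    by (rule layer_projection[of j]) blast
  \<comment> \<open>\<tau> x and x differ by an element of \<open>r\<close>, so they act alike on
    the layer.\<close>
  have q\<tau>: "q (brn (\<tau> x) v) = q (brn x v)" if "v \<in> Y (Suc j)" for x v
  proof -
    have "q (brn (x - \<tau> x) v) = 0" by (intro q(3) Y_lower \<tau>(3) that)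
    then show ?thesis by (simp add: n.br_diff lin_diffD[OF q(1)])
  qed
  define f where "f x y = brn (\<tau> x) (\<tau> y) - \<tau> (brn x y)" for x y
  have fY: "f x y \<in> Y (Suc j)" for x y unfolding f_def by (rule hom)
  have "\<exists>h. lin h \<and> (\<forall>x\<in>r. h x = 0) \<and> (\<forall>x y. q (f x y) = q (brn x (q (h y))) - q (brn y (q (h x))) - h (brn x y))"
  proof (rule nr.whitehead2[OF rep])
    show "q (brn x (q v)) = 0" if "x \<in> r" for x v by (intro q(3) Y_lower that q(2))
    show "nr.bilin (\<lambda>x y. q (f x y))"
      unfolding nr.bilin_def f_def
      using lin_comp[OF q(1) lin_diff[OF lin_comp[OF n.br_lin(1) \<tau>(1)] lin_comp[OF \<tau>(1) n.br_lin(1)]]]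
        lin_comp[OF q(1) lin_diff[OF lin_comp[OF n.br_lin(2) \<tau>(1)] lin_comp[OF \<tau>(1) n.br_lin(2)]]]
      by blast
    show "q (f x y) = 0" if "x \<in> r" for x y
      using n.ideal_br'[OF r_ideal that] that
      unfolding f_def by (simp add: \<tau>(2) n.br_zero lin_zeroD[OF q(1)])
    show "q (f x y) = - q (f y x)" for x y
      unfolding f_def n.br_anti[of "\<tau> x" "\<tau> y"] n.br_anti[of x y]
      by (simp add: lin_minusD[OF \<tau>(1)] lin_diffD[OF q(1)] lin_minusD[OF q(1)] lin_addD[OF q(1)])
    show "q (f (brn x y) z) + q (f (brn y z) x) + q (f (brn z x) y) =
        q (brn x (q (q (f y z)))) + q (brn y (q (q (f z x)))) + q (brn z (q (q (f x y))))" for x y z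
    proof -
      have s: "f (brn x y) z + f (brn y z) x + f (brn z x) y =
        brn (\<tau> x) (f y z) + brn (\<tau> y) (f z x) + brn (\<tau> z) (f x y)"
      proof -
        have 1: "brn (\<tau> (brn a b)) (\<tau> c) = - brn (\<tau> c) (\<tau> (brn a b))" for a b c by (rule n.br_anti)
        have "brn (brn x y) z + brn (brn y z) x + brn (brn z x) y
            = - (brn x (brn y z) + brn y (brn z x) + brn z (brn x y))"
          by (simp add: n.br_anti[of z "brn x y"] n.br_anti[of x "brn y z"] n.br_anti[of y "brn z x"]
              algebra_simps)
        then have "\<tau> (brn (brn x y) z + brn (brn y z) x + brn (brn z x) y) = 0"
          using n.jacobi[of x y z] lin_zeroD[OF \<tau>(1)] by simp
        then have 2: "\<tau> (brn (brn x y) z) + \<tau> (brn (brn y z) x) + \<tau> (brn (brn z x) y) = 0"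
          by (simp add: lin_addD[OF \<tau>(1)])
        show ?thesis
          unfolding f_def 1 n.br_diff
          using 2 n.jacobi[of "\<tau> x" "\<tau> y" "\<tau> z"] by (simp add: algebra_simps eq_neg_iff_add_eq_0)
      qed
      have "q (f (brn x y) z) + q (f (brn y z) x) + q (f (brn z x) y) =
        q (brn (\<tau> x) (f y z)) + q (brn (\<tau> y) (f z x)) + q (brn (\<tau> z) (f x y))"
        unfolding lin_addD[OF q(1), symmetric] s ..
      then show ?thesis unfolding q(5) qbr[OF fY] q\<tau>[OF fY] .
    qed
  qed
  then obtain h where h: "lin h" "\<And>x. x \<in> r \<Longrightarrow> h x = 0"
    "\<And>x y. q (f x y) = q (brn x (q (h y))) - q (brn y (q (h x))) - h (brn x y)" by blast
  define \<tau>' where "\<tau>' x = \<tau> x - q (h x)" for x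
  show thesis
  proof (rule that[of \<tau>'])
    show "lin \<tau>'" unfolding \<tau>'_def by (intro lin_diff \<tau>(1) lin_comp[OF q(1) h(1)])
    show "\<tau>' x = 0" if "x \<in> r" for x
      unfolding \<tau>'_def using that by (simp add: \<tau>(2) h(2) lin_zeroD[OF q(1)])
    have qr: "q v \<in> r" for v using q(2) by blast
    show "v - \<tau>' v \<in> r" for v
    proof -
      have "(v - \<tau> v) + q (h v) \<in> r" by (intro subspace_add[OF nr.r_subspace] \<tau>(3) qr)
      then show ?thesis unfolding \<tau>'_def by (simp add: algebra_simps)
    qed
    show "\<phi> x - \<tau>' (\<phi> x) \<in> Y (Suc j)" for x
    proof -
      have "(\<phi> x - \<tau> (\<phi> x)) + q (h (\<phi> x)) \<in> Y (Suc j)" by (intro subspace_add[OF Y_subspace] fix\<phi> q(2))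
      then show ?thesis unfolding \<tau>'_def by (simp add: algebra_simps)
    qed
    show "brn (\<tau>' x) (\<tau>' y) - \<tau>' (brn x y) \<in> Y j" for x y
    proof -
      let ?e = "brn (\<tau>' x) (\<tau>' y) - \<tau>' (brn x y)"
      have e: "?e = f x y - brn (\<tau> x) (q (h y)) + brn (\<tau> y) (q (h x)) + brn (q (h x)) (q (h y)) + q (h (brn x y))"
        unfolding \<tau>'_def f_def n.br_diff n.br_anti[of "q (h x)" "\<tau> y"] by (simp add: algebra_simps)
      have "?e \<in> Y (Suc j)"
        unfolding e by (intro subspace_add subspace_diff Y_subspace fY q(2) n.ideal_br[OF Y_ideal])
      then have "?e - q ?e \<in> Y j" by (rule q(4))
      moreover have "q ?e = 0"
      proof -
        have "q (brn (q (h x)) (q (h y))) = 0" by (intro q(3) Y_lower qr q(2))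
        moreover have "q (q (f x y)) = q (brn x (q (h y))) - q (brn y (q (h x))) - q (h (brn x y))"
          unfolding h(3) by (simp add: lin_diffD[OF q(1)] q(5))
        ultimately show ?thesis
          unfolding e by (simp add: lin_diffD[OF q(1)] lin_addD[OF q(1)] q\<tau>[OF q(2)] q(5))
      qed
      ultimately show ?thesis by simp
    qed
  qed
qed

text \<open>Once \<sigma> is a homomorphism modulo \<open>Y j\<close>, the error \<phi> - \<sigma>
  \<phi> is a 1-cocycle of g, so it is {\<phi> x, u} modulo \<open>Y j\<close>. Following \<sigma>
  by 1 - ad u, the linear part of exp(- ad u), absorbs it; ad u is a derivation, so the homomorphism
  property survives up to terms in \<open>Y j\<close>.\<close>

lemma levi_step:
  assumes "levi_map (Suc j) \<tau>"
  obtains \<tau>' where "levi_map j \<tau>'"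
proof -
  obtain \<sigma> where \<sigma>: "lin \<sigma>" "\<And>x. x \<in> r \<Longrightarrow> \<sigma> x = 0" "\<And>v. v - \<sigma> v \<in> r"
    and hom: "\<And>x y. brn (\<sigma> x) (\<sigma> y) - \<sigma> (brn x y) \<in> Y j" and fix\<phi>: "\<And>x. \<phi> x - \<sigma> (\<phi> x) \<in> Y (Suc j)"
    by (rule levi_step_hom[OF assms]) blast
  define \<epsilon> where "\<epsilon> x = \<phi> x - \<sigma> (\<phi> x)" for x
  have \<epsilon>Y: "\<epsilon> x \<in> Y (Suc j)" for x unfolding \<epsilon>_def by (rule fix\<phi>)
  have \<epsilon>r: "\<epsilon> x \<in> r" for x using \<epsilon>Y[of x] by blast
  obtain u where u: "u \<in> Y (Suc j)" "\<And>x. \<epsilon> x - brn (\<phi> x) u \<in> Y j"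
  proof (rule layer_coboundary[OF \<phi>_lin \<phi>_hom, of \<epsilon> j])
    show "lin \<epsilon>" unfolding \<epsilon>_def by (intro lin_diff \<phi>_lin lin_comp[OF \<sigma>(1) \<phi>_lin])
    show "\<epsilon> x \<in> Y (Suc j)" for x by (rule \<epsilon>Y)
    show "\<epsilon> (brg x y) - (brn (\<phi> x) (\<epsilon> y) - brn (\<phi> y) (\<epsilon> x)) \<in> Y j" for x y
    proof -
      have s: "\<sigma> (\<phi> x) = \<phi> x - \<epsilon> x" for x unfolding \<epsilon>_def by simp
      have "\<epsilon> (brg x y) - (brn (\<phi> x) (\<epsilon> y) - brn (\<phi> y) (\<epsilon> x)) =
        (brn (\<sigma> (\<phi> x)) (\<sigma> (\<phi> y)) - \<sigma> (brn (\<phi> x) (\<phi> y))) - brn (\<epsilon> x) (\<epsilon> y)"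
        unfolding s n.br_diff n.br_anti[of "\<epsilon> x" "\<phi> y"] unfolding \<epsilon>_def[of "brg x y"] \<phi>_hom by (simp add: algebra_simps)
      also have "\<dots> \<in> Y j" by (intro subspace_diff[OF Y_subspace] hom Y_lower \<epsilon>r \<epsilon>Y)
      finally show ?thesis .
    qed
  qed blast
  have ur: "u \<in> r" using u(1) by blast
  define \<tau>' where "\<tau>' v = \<sigma> v + brn (\<sigma> v) u" for v
  have "levi_map j \<tau>'"
    unfolding levi_map_def
  proof (intro conjI allI ballI)
    show "lin \<tau>'" unfolding \<tau>'_def by (intro lin_add \<sigma>(1) lin_comp[OF n.br_lin(2) \<sigma>(1)])
    show "\<tau>' x = 0" if "x \<in> r" for x unfolding \<tau>'_def using that by (simp add: \<sigma>(2) n.br_zero)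
    show "v - \<tau>' v \<in> r" for v
    proof -
      have "(v - \<sigma> v) - brn (\<sigma> v) u \<in> r" by (intro subspace_diff[OF nr.r_subspace] \<sigma>(3) n.ideal_br[OF r_ideal] ur)
      then show ?thesis unfolding \<tau>'_def by (simp add: algebra_simps)
    qed
    show "\<phi> x - \<tau>' (\<phi> x) \<in> Y j" for x
    proof -
      have "(\<epsilon> x - brn (\<phi> x) u) + brn (\<epsilon> x) u \<in> Y j"
        by (intro subspace_add[OF Y_subspace] u Y_lower \<epsilon>r)
      then show ?thesis unfolding \<tau>'_def \<epsilon>_def by (simp add: n.br_diff algebra_simps)
    qed
    show "brn (\<tau>' x) (\<tau>' y) - \<tau>' (brn x y) \<in> Y j" for x y
    proof -
      let ?a = "\<sigma> x" and ?b = "\<sigma> y" and ?d = "brn (\<sigma> x) (\<sigma> y) - \<sigma> (brn x y)"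
      have "brn ?a (brn ?b u) = brn (brn ?a ?b) u + brn ?b (brn ?a u)" by (rule n.br_br_right)
      moreover have "brn (brn ?a u) ?b = - brn ?b (brn ?a u)" by (rule n.br_anti)
      ultimately have "brn (\<tau>' x) (\<tau>' y) - \<tau>' (brn x y) = ?d + brn ?d u + brn (brn ?a u) (brn ?b u)"
        unfolding \<tau>'_def by (simp add: n.br_add n.br_diff algebra_simps)
      also have "\<dots> \<in> Y j"
        by (intro subspace_add[OF Y_subspace] hom n.ideal_br'[OF Y_ideal] Y_lower
            n.ideal_br[OF r_ideal ur] n.ideal_br[OF Y_ideal u(1)])
      finally show ?thesis .
    qed
  qed
  then show thesis by (rule that)
qed

lemma levi_exists:
  assumes k: "n.ann_chain brn r k = UNIV"
  obtains \<tau> where "levi_map 0 \<tau>"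
proof -
  \<comment> \<open>\<open>Y k\<close> is all of \<open>r\<close>, so any linear projection along
    \<open>r\<close> is a valid start.\<close>
  have "levi_map k (\<lambda>v. v - p v)"
  proof -
    have b: "brn (x - p x) (y - p y) - (brn x y - p (brn x y)) \<in> r" for x y
    proof -
      have "brn (x - p x) (y - p y) - (brn x y - p (brn x y)) = p (brn x y) - brn (x - p x) (p y) - brn (p x) y"
        by (simp add: n.br_diff algebra_simps)
      also have "\<dots> \<in> r"
        by (intro subspace_diff[OF nr.r_subspace] p_mem n.ideal_br[OF r_ideal] n.ideal_br'[OF r_ideal])
      finally show ?thesis .
    qed
    show ?thesis
      unfolding levi_map_def k using b p_id p_mem by (auto intro: lin_diff lin_id p_lin)
  qed
  then have "\<exists>\<tau>. levi_map (k - i) \<tau>" for i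
  proof (induction i)
    case (Suc i)
    show ?case
    proof (cases "i < k")
      case True
      then have "k - i = Suc (k - Suc i)" by simp
      then show ?thesis using Suc levi_step by metis
    next
      case False
      then show ?thesis using Suc by simp
    qed
  qed auto
  from this[of k] show thesis using that by auto
qed

subsection \<open>Conjugating \<open>\<psi>\<close> into the Levi factor\<close>

lemma br_pow_mem:
  assumes "w \<in> r"
  shows "(brn w ^^ Suc i) v \<in> r"
  by (induction i) (auto intro: n.ideal_br'[OF r_ideal assms])

text \<open>From the second bracket on, everything inside lies in \<open>r\<close>, so a factor
  \<open>u\<close> or an earlier error from \<open>Y (Suc j)\<close> drops into \<open>Y j\<close>.
  Only the linear term shows.\<close>

lemma br_pow_perturb:
  assumes w: "w \<in> r" and u: "u \<in> Y (Suc j)"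
  shows "(brn (w + u) ^^ i) y - (brn w ^^ i) y - (if i = 1 then brn u y else 0) \<in> Y j"
proof (induction i)
  case 0
  then show ?case using subspace_0[OF Y_subspace] by simp
next
  case (Suc i)
  have wu: "w + u \<in> r" using u w subspace_add[OF nr.r_subspace] by auto
  show ?case
  proof (cases i)
    case 0
    then show ?thesis using subspace_0[OF Y_subspace] by (simp add: n.br_add)
  next
    case (Suc m)
    let ?a = "(brn (w + u) ^^ i) y" and ?b = "(brn w ^^ i) y"
    have br: "?b \<in> r" unfolding Suc by (rule br_pow_mem[OF w])
    let ?e = "?a - ?b - (if i = 1 then brn u y else 0)"
    have "?e \<in> Y (Suc j)" using Suc.IH Y_Suc by blast
    moreover have "(if i = 1 then brn u y else 0) \<in> Y (Suc j)"
      using n.ideal_br'[OF Y_ideal u] subspace_0[OF Y_subspace] by (cases "i = 1") (simp_all del: n.ann_chain.simps)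
    ultimately have "?e + (if i = 1 then brn u y else 0) \<in> Y (Suc j)" by (rule subspace_add[OF Y_subspace])
    then have ab: "?a - ?b \<in> Y (Suc j)" by simp
    have "brn (w + u) ?a - brn w ?b = brn (w + u) (?a - ?b) + brn u ?b"
      by (simp add: n.br_add n.br_diff)
    also have "\<dots> \<in> Y j"
      by (intro subspace_add[OF Y_subspace] Y_lower[OF wu ab] Y_lower'[OF br u])
    finally show ?thesis using Suc by simp
  qed
qed

lemma expo_perturb:
  assumes w: "w \<in> r" and u: "u \<in> Y (Suc j)" and N: "1 \<le> N"
  shows "n.expo N (w + u) y - n.expo N w y - brn u y \<in> Y j"
proof -
  have "(\<Sum>i\<le>N. scale (1 / fact i) (if i = 1 then brn u y else 0)) = (\<Sum>i\<le>N. if i = 1 then brn u y else 0)"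
    by (intro sum.cong) auto
  also have "\<dots> = brn u y" using N by simp
  finally have "n.expo N (w + u) y - n.expo N w y - brn u y =
      (\<Sum>i\<le>N. scale (1 / fact i) ((brn (w + u) ^^ i) y - (brn w ^^ i) y - (if i = 1 then brn u y else 0)))"
    unfolding n.expo_def by (simp add: scale_right_diff_distrib sum_subtractf)
  also have "\<dots> \<in> Y j" by (intro subspace_sum subspace_scale Y_subspace br_pow_perturb[OF w u])
  finally show ?thesis .
qed

lemma expo_minus_id:
  assumes "w \<in> r"
  shows "n.expo N w y - y \<in> r"
proof -
  have "n.expo N w y = y + (\<Sum>i<N. scale (1 / fact (Suc i)) ((brn w ^^ Suc i) y))"
    unfolding n.expo_def by (subst sum.atMost_shift) simp
  then have "n.expo N w y - y = (\<Sum>i<N. scale (1 / fact (Suc i)) ((brn w ^^ Suc i) y))" by simp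
  also have "\<dots> \<in> r" by (intro subspace_sum subspace_scale nr.r_subspace br_pow_mem assms)
  finally show ?thesis .
qed

lemma br_pow_nilpotent:
  assumes k: "n.ann_chain brn r k = UNIV" and w: "w \<in> r"
  shows "(brn w ^^ k) v = 0"
proof -
  have "(brn w ^^ i) v \<in> n.ann_chain brn r (k - i)" for i
  proof (induction i)
    case (Suc i)
    then show ?case using n.ann_chain_lower[OF n.lie_rep_br w] by fastforce
  qed (simp add: k)
  from this[of k] show ?thesis by simp
qed

text \<open>Successive approximation from w = 0. If exp(ad w) \<tau> \<psi> = \<chi> misses \<psi>
  by \<open>c\<close> in \<open>Y (Suc j)\<close>, then \<open>c\<close> is a cocycle for \<chi>, so
  c x is {\<chi> x, u} modulo \<open>Y j\<close>. Replacing \<open>w\<close> by w - u adds {\<tau>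
  \<psi> x, u}, which agrees with it since \<chi> x - \<tau> \<psi> x lies in
  \<open>r\<close>.\<close>

lemma malcev_exists:
  assumes k: "n.ann_chain brn r k = UNIV" and N: "2 * k \<le> N" "1 \<le> N" and \<tau>: "levi_map 0 \<tau>"
  obtains w where "w \<in> r" "\<And>x. \<psi> x = n.expo N w (\<tau> (\<psi> x))"
proof -
  have \<tau>l: "lin \<tau>" "\<And>v. v - \<tau> v \<in> r" and hom: "\<And>x y. \<tau> (brn x y) = brn (\<tau> x) (\<tau> y)"
    using \<tau> unfolding levi_map_def Y_zero by auto
  let ?s = "\<lambda>x. \<tau> (\<psi> x)"
  have "\<exists>w\<in>r. \<forall>x. \<psi> x - n.expo N w (?s x) \<in> Y (k - i)" for i
  proof (induction i)
    case 0
    have "n.expo N 0 v = v" for v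
    proof -
      have "(brn 0 ^^ i) v = (if i = 0 then v else 0)" for i by (cases i) (simp_all add: n.br_zero)
      then have "n.expo N 0 v = (\<Sum>i\<le>N. if i = 0 then v else 0)"
        unfolding n.expo_def by (intro sum.cong) auto
      then show ?thesis by simp
    qed
    then show ?case using k \<tau>l(2) subspace_0[OF nr.r_subspace] by (intro bexI[of _ 0]) auto
  next
    case (Suc i)
    show ?case
    proof (cases "i < k")
      case False
      then show ?thesis using Suc by simp
    next
      case True
      define j where "j = k - Suc i"
      have kj: "k - i = Suc j" using True unfolding j_def by simp
      obtain w where w: "w \<in> r" and c: "\<And>x. \<psi> x - n.expo N w (?s x) \<in> Y (Suc j)"
        using Suc unfolding kj by blast
      define \<chi> where "\<chi> x = n.expo N w (?s x)" for x
      define c where "c x = \<psi> x - \<chi> x" for x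
      have \<chi>l: "lin \<chi>" unfolding \<chi>_def by (intro lin_comp[OF n.lin_expo lin_comp[OF \<tau>l(1) \<psi>_lin]])
      have \<chi>h: "\<chi> (brg x y) = brn (\<chi> x) (\<chi> y)" for x y
        unfolding \<chi>_def \<psi>_hom hom by (rule n.expo_hom[OF br_pow_nilpotent[OF k w] N(1)])
      have cY: "c x \<in> Y (Suc j)" for x unfolding c_def \<chi>_def by (rule c)
      obtain u where u: "u \<in> Y (Suc j)" "\<And>x. c x - brn (\<chi> x) u \<in> Y j"
      proof (rule layer_coboundary[OF \<chi>l \<chi>h, of c j])
        show "lin c" unfolding c_def by (intro lin_diff \<psi>_lin \<chi>l)
        show "c (brg x y) - (brn (\<chi> x) (c y) - brn (\<chi> y) (c x)) \<in> Y j" for x y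
        proof -
          have s: "\<psi> x = \<chi> x + c x" for x unfolding c_def by simp
          have "c (brg x y) = brn (\<psi> x) (\<psi> y) - brn (\<chi> x) (\<chi> y)" unfolding c_def \<psi>_hom \<chi>h ..
          then have "c (brg x y) - (brn (\<chi> x) (c y) - brn (\<chi> y) (c x)) = brn (c x) (c y)"
            unfolding s n.br_add n.br_anti[of "c x" "\<chi> y"] by (simp add: algebra_simps)
          also have "\<dots> \<in> Y j" using cY[of x] by (intro Y_lower cY) blast
          finally show ?thesis .
        qed
      qed (use cY in blast)+
      have nu: "- u \<in> Y (Suc j)" by (rule subspace_neg[OF Y_subspace u(1)])
      have "\<psi> x - n.expo N (w + - u) (?s x) \<in> Y j" for x
      proof -
        let ?y = "?s x"
        have e: "n.expo N (w + - u) ?y - n.expo N w ?y - brn (- u) ?y \<in> Y j"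
          by (rule expo_perturb[OF w nu N(2)])
        have y: "brn (\<chi> x - ?y) u \<in> Y j"
          unfolding \<chi>_def by (rule Y_lower[OF expo_minus_id[OF w] u(1)])
        have "\<psi> x - n.expo N (w + - u) ?y = (c x - brn (\<chi> x) u) + brn (\<chi> x - ?y) u
            - (n.expo N (w + - u) ?y - n.expo N w ?y - brn (- u) ?y)"
          unfolding c_def \<chi>_def n.br_diff n.br_minus n.br_anti[of u ?y] by (simp add: algebra_simps)
        also have "\<dots> \<in> Y j" by (intro subspace_diff[OF Y_subspace] subspace_add[OF Y_subspace] u(2) y e)
        finally show ?thesis .
      qed
      moreover have "w + - u \<in> r" using w nu by (intro subspace_add[OF nr.r_subspace]) auto
      ultimately show ?thesis unfolding j_def by blast
    qed
  qed
  from this[of k] show thesis using that Y_zero by auto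
qed

subsection \<open>Vanishing of the radical\<close>

text \<open>Expanding the exponential, \<open>x\<close> is {w, \<phi> x} plus further brackets of
  that element with \<open>w\<close>. So if {w, \<phi> x} lies in \<open>Y (Suc l)\<close>, it
  equals \<open>x\<close> modulo \<open>Y l\<close>, and this estimate can be fed back into
  itself.\<close>

lemma right_multiplication_unipotent:
  assumes k: "n.ann_chain brn r k = UNIV"
  obtains w where "w \<in> r" "\<And>x j. x \<in> Y (Suc j) \<Longrightarrow> x + brn (\<phi> x) w \<in> Y j"
proof -
  \<comment> \<open>2k is what \<open>expo_hom\<close> asks for; the successor secures the linear
    term even when \<open>k\<close> is 0.\<close>
  define N where "N = Suc (2 * k)"
  obtain \<tau> where \<tau>: "levi_map 0 \<tau>" by (rule levi_exists[OF k])
  obtain w where w: "w \<in> r" "\<And>x. \<psi> x = n.expo N w (\<tau> (\<psi> x))"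
    by (rule malcev_exists[OF k _ _ \<tau>, of N]) (simp_all add: N_def)
  have \<tau>l: "lin \<tau>" "\<And>x. x \<in> r \<Longrightarrow> \<tau> x = 0" "\<And>x. \<tau> (\<phi> x) = \<phi> x"
    using \<tau> unfolding levi_map_def Y_zero by auto
  have exp: "x = brn w (\<phi> x) + (\<Sum>i<2 * k. scale (1 / fact (Suc (Suc i))) ((brn w ^^ Suc i) (brn w (\<phi> x))))"
    if x: "x \<in> r" for x
  proof -
    have "\<tau> (\<psi> x) = \<phi> x" unfolding \<psi>_def lin_addD[OF \<tau>l(1)] by (simp add: \<tau>l x)
    then have "\<phi> x + x = n.expo N w (\<phi> x)" using w(2)[of x] unfolding \<psi>_def by simp
    also have "\<dots> = \<phi> x + (\<Sum>i<N. scale (1 / fact (Suc i)) ((brn w ^^ Suc i) (\<phi> x)))"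
      unfolding n.expo_def by (subst sum.atMost_shift) simp
    finally have "x = (\<Sum>i<N. scale (1 / fact (Suc i)) ((brn w ^^ i) (brn w (\<phi> x))))"
      by (simp add: funpow_swap1)
    also have "\<dots> = brn w (\<phi> x) + (\<Sum>i<2 * k. scale (1 / fact (Suc (Suc i))) ((brn w ^^ Suc i) (brn w (\<phi> x))))"
      unfolding N_def by (subst sum.lessThan_Suc_shift) simp
    finally show ?thesis .
  qed
  have lower: "x - brn w (\<phi> x) \<in> Y l" if x: "x \<in> r" and v: "brn w (\<phi> x) \<in> Y (Suc l)" for x l
  proof -
    have pw: "(brn w ^^ Suc i) (brn w (\<phi> x)) \<in> Y l" for i
      by (induction i) (use Y_lower[OF w(1) v] n.ideal_br[OF Y_ideal] in auto)
    have "x - brn w (\<phi> x) = (\<Sum>i<2 * k. scale (1 / fact (Suc (Suc i))) ((brn w ^^ Suc i) (brn w (\<phi> x))))"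
      using exp[OF x] by (metis add_diff_cancel_left')
    also have "\<dots> \<in> Y l" by (intro subspace_sum subspace_scale Y_subspace pw)
    finally show ?thesis .
  qed
  show thesis
  proof (rule that[OF w(1)])
    fix x j assume x: "x \<in> Y (Suc j)"
    then have xr: "x \<in> r" by blast
    \<comment> \<open>The bracket descends from level \<open>k\<close> as long as \<open>x\<close>
      itself lies in the next level; \<open>max\<close> stops it at the level of
      \<open>x\<close>.\<close>
    have "brn w (\<phi> x) \<in> Y (max (Suc j) (k - i))" for i
    proof (induction i)
      case 0
      have "n.ann_chain brn r (max (Suc j) k) = UNIV"
        using n.ann_chain_mono[OF n.lie_rep_br, of k "max (Suc j) k" r] k by auto
      then show ?case using n.ideal_br'[OF r_ideal w(1)] by simp
    next
      case (Suc i)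
      show ?case
      proof (cases "Suc j < k - i")
        case False
        then show ?thesis using Suc by simp
      next
        case True
        define l where "l = k - Suc i"
        have l: "k - i = Suc l" "Suc j \<le> l" using True unfolding l_def by auto
        then have lo: "x - brn w (\<phi> x) \<in> Y l" using Suc by (intro lower[OF xr]) simp
        have "x \<in> Y l" using x n.ann_chain_mono[OF n.lie_rep_br l(2), of r] by blast
        from subspace_diff[OF Y_subspace this lo] have "x - (x - brn w (\<phi> x)) \<in> Y l" .
        moreover have "max (Suc j) (k - Suc i) = l" using l unfolding l_def by simp
        ultimately show ?thesis by simp
      qed
    qed
    from this[of k] have "brn w (\<phi> x) \<in> Y (Suc j)" by simp
    from lower[OF xr this] show "x + brn (\<phi> x) w \<in> Y j" unfolding n.br_anti[of "\<phi> x" w] by simp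
  qed
qed

text \<open>g is perfect, so \<open>brg w\<close> has trace zero. n is perfect, so ad (\<psi> w) has
  trace zero on \<open>r\<close> and on the quotient by \<open>r\<close>. Since w is in
  \<open>r\<close>, {\<phi> v, w} always lies in \<open>r\<close>, so this term contributes only its
  trace on \<open>r\<close>. Splitting by \<open>p\<close> also leaves an off-diagonal part of trace
  zero.\<close>

lemma tr_right_multiplication:
  assumes w: "w \<in> r"
  shows "tr (\<lambda>v. brn (\<phi> (p v)) w) = 0"
proof -
  have pp: "p (p v) = p v" for v by (rule p_id[OF p_mem])
  have eq: "brg w v = brn (\<psi> w) v - brn (\<phi> v) w" for v
    unfolding brg_eq \<psi>_def n.br_add by simp
  have gl: "lin (brg w)" by (rule g.br_lin)
  have pbr: "p (brn z (p v)) = brn z (p v)" for z v by (rule p_id[OF n.ideal_br[OF r_ideal p_mem]])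
  have "n.lie_rep (\<lambda>x v. p (brn x (p v)))"
    by (rule n.lie_rep_subquotient[OF n.lie_rep_br p_lin p_mem, of "{0}"])
      (auto simp: pp p_id lin_zeroD[OF p_lin] n.br_zero n.ideal_br[OF r_ideal])
  then have t1: "tr (\<lambda>v. brn (\<psi> w) (p v)) = 0"
    using n.perfect_tr_zero[OF n_perfect, of "\<lambda>x v. p (brn x (p v))" "\<psi> w"] by (simp add: pbr)
  have t2: "tr (\<lambda>v. brn (\<psi> w) (v - p v) - p (brn (\<psi> w) (v - p v))) = 0"
    using n.perfect_tr_zero[OF n_perfect nr.qad_rep, of "\<psi> w"] unfolding nr.qad_def .
  have t0: "tr (brg w) = 0" by (rule g.perfect_tr_zero[OF g_perfect g.lie_rep_br])
  have t3: "tr (\<lambda>v. p (brg w (v - p v))) = 0"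
    using tr_comm[OF p_lin lin_comp[OF gl lin_diff[OF lin_id p_lin]]]
    by (simp add: pp tr_0 lin_zeroD[OF gl])
  have "brg w v = (brn (\<psi> w) (p v) - brn (\<phi> (p v)) w) +
      ((brn (\<psi> w) (v - p v) - p (brn (\<psi> w) (v - p v))) + p (brg w (v - p v)))" for v
  proof -
    have "p (brn (\<phi> (v - p v)) w) = brn (\<phi> (v - p v)) w"
      by (rule p_id[OF n.ideal_br[OF r_ideal w]])
    then have "p (brg w (v - p v)) = p (brn (\<psi> w) (v - p v)) - brn (\<phi> (v - p v)) w"
      unfolding eq[of "v - p v"] lin_diffD[OF p_lin, of "brn _ _"] by simp
    moreover have "brg w v = brg w (p v) + brg w (v - p v)" by (simp add: lin_diffD[OF gl])
    ultimately show ?thesis unfolding eq[of "p v"] eq[of "v - p v"] by simp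
  qed
  then have "tr (brg w) = tr (\<lambda>v. (brn (\<psi> w) (p v) - brn (\<phi> (p v)) w) +
      ((brn (\<psi> w) (v - p v) - p (brn (\<psi> w) (v - p v))) + p (brg w (v - p v))))"
    by (metis (no_types, lifting) ext)
  also have "\<dots> = - tr (\<lambda>v. brn (\<phi> (p v)) w)"
    unfolding tr_add by (subst tr_diff) (simp add: t1 t2 t3)
  finally show ?thesis using t0 by simp
qed

text \<open>\<open>T\<close> is x + {\<phi> x, w} on \<open>r\<close>, extended by zero to the
  complement. It lowers the chain, hence is nilpotent, and its trace is that of the projection
  \<open>p\<close>.\<close>

theorem radical_trivial: "r = {0}"
proof -
  obtain k where k: "n.ann_chain brn r k = UNIV"
    by (rule n.radical_chain_exhausts[OF n_perfect r_ideal r_solvable])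
  obtain w where w: "w \<in> r" "\<And>x j. x \<in> Y (Suc j) \<Longrightarrow> x + brn (\<phi> x) w \<in> Y j"
    by (rule right_multiplication_unipotent[OF k]) blast
  define T where "T v = p v + brn (\<phi> (p v)) w" for v
  have Rl: "lin (\<lambda>v. brn (\<phi> (p v)) w)" by (rule lin_comp[OF n.br_lin(2) lin_comp[OF \<phi>_lin p_lin]])
  have Tl: "lin T" unfolding T_def by (intro lin_add p_lin Rl)
  have TY: "T x \<in> Y j" if "x \<in> Y (Suc j)" for x j
    using w(2)[OF that] that p_id[of x] unfolding T_def by auto
  have TY0: "T x \<in> Y (j - 1)" if "x \<in> Y j" for x j
  proof (cases j)
    case 0
    then have "x = 0" using that by simp
    then show ?thesis using subspace_0[OF Y_subspace] lin_zeroD[OF Tl] by simp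
  next
    case (Suc m)
    then show ?thesis using TY[of x m] that by (simp only: diff_Suc_1)
  qed
  have "(T ^^ Suc i) v \<in> Y (k - i)" for i v
  proof (induction i)
    case 0
    have "T v \<in> r" unfolding T_def by (intro subspace_add[OF nr.r_subspace] p_mem n.ideal_br[OF r_ideal] w(1))
    then show ?case by (simp add: k)
  next
    case (Suc i)
    show ?case using TY0[OF Suc] by simp
  qed
  from this[of k] have "(T ^^ Suc k) v = 0" for v by simp
  then have "tr T = 0" by (rule tr_nilpotent[OF Tl])
  then have "tr p = 0" unfolding T_def[abs_def] tr_add tr_right_multiplication[OF w(1)] by simp
  then have "p v = 0" for v by (rule tr_idempotent_eq_0[OF p_lin p_id[OF p_mem]])
  then show ?thesis using p_id subspace_0[OF nr.r_subspace] by fastforce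
qed

end

text \<open>Completeness enters twice. By axiom (3) left multiplications are derivations, hence
  inner, which yields \<phi>. The trivial center makes \<phi> x unique, so bilinearity of the
  product and axiom (2) turn into linearity and the homomorphism property of \<phi>.\<close>

theorem corollary4p8:
  fixes scale :: "'k::field_char_0 \<Rightarrow> 'v::ab_group_add \<Rightarrow> 'v"
    and brg brn prod :: "'v \<Rightarrow> 'v \<Rightarrow> 'v"
  assumes "lie_algebra scale brg"
    and "lie_algebra scale brn"
    and "lie_algebra.semisimple scale brg"
    and "lie_algebra.complete scale brn"
    and "post_lie_algebra scale brg brn prod"
  shows "lie_algebra.semisimple scale brn"
proof -
  interpret g: lie_algebra scale brg by fact
  interpret n: lie_algebra scale brn by fact
  interpret pl: post_lie_algebra scale brg brn prod by fact
  obtain B0 where B0: "finite B0" "g.span B0 = UNIV" using n.finite_dim by blast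
  obtain Basis where Basis: "Basis \<subseteq> B0" "g.independent Basis" "B0 \<subseteq> g.span Basis"
    using g.maximal_independent_subset[of B0] by blast
  have sB: "g.span Basis = UNIV" using g.span_minimal[OF Basis(3) g.subspace_span] B0(2) by auto
  interpret fin_dim_space scale Basis
    by unfold_locales (use Basis sB finite_subset[OF Basis(1) B0(1)] in auto)
  interpret g: lie_space scale Basis brg by unfold_locales
  interpret n: lie_space scale Basis brn by unfold_locales
  have pl: "lin (prod x)" "lin (\<lambda>x. prod x y)" for x y
    using pl.prod_bilinear unfolding bilinear_product_def by auto
  have center: "z = 0" if "\<And>x. brn z x = 0" for z
    using assms(4) that unfolding n.complete_def n.center_def by auto
  have "\<exists>z. \<forall>y. prod x y = brn z y" for x
  proof -
    have "n.derivation (prod x)" unfolding n.derivation_def using pl(1) pl.prod_derivation by blast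
    then show ?thesis using assms(4) unfolding n.complete_def n.inner_derivation_def by blast
  qed
  then obtain \<phi> where \<phi>: "\<And>x y. prod x y = brn (\<phi> x) y" by metis
  have inj: "z = w" if "\<And>x. brn z x = brn w x" for z w
    using center[of "z - w"] that by (simp add: n.br_diff)
  have \<phi>_lin: "lin \<phi>"
  proof (rule linI)
    show "\<phi> (x + y) = \<phi> x + \<phi> y" for x y
      by (rule inj) (simp add: n.br_add lin_addD[OF pl(2)] flip: \<phi>)
    show "\<phi> (scale c x) = scale c (\<phi> x)" for c x
      by (rule inj) (simp add: n.br_scale lin_scaleD[OF pl(2)] flip: \<phi>)
  qed
  have \<phi>_hom: "\<phi> (brg x y) = brn (\<phi> x) (\<phi> y)" for x y
  proof (rule inj)
    fix z
    have "brn (\<phi> (brg x y)) z = prod (brg x y) z" by (rule \<phi>[symmetric])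
    also have "\<dots> = prod x (prod y z) - prod y (prod x z)" by (rule pl.prod_bracket)
    also have "\<dots> = brn (brn (\<phi> x) (\<phi> y)) z" unfolding \<phi> by (rule n.br_br_left[symmetric])
    finally show "brn (\<phi> (brg x y)) z = brn (brn (\<phi> x) (\<phi> y)) z" .
  qed
  have brg: "brg x y = brn (\<phi> x) y - brn (\<phi> y) x + brn x y" for x y
    using pl.prod_commutator[of x y] unfolding \<phi> by (simp add: algebra_simps)
  have rad: "n.is_radical n.radical" by (rule n.is_radical_radical)
  then have "g.subspace n.radical" unfolding n.is_radical_def n.lie_ideal_def by blast
  then obtain p where p: "lin p" "\<And>v. p v \<in> n.radical" "\<And>u. u \<in> n.radical \<Longrightarrow> p u = u"
    by (rule projection_exists) blast
  have "g.is_radical {0}" using g.is_radical_radical assms(3) unfolding g.semisimple_def by simp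
  then interpret rota_baxter_pair scale Basis brg brn \<phi> "\<lambda>x. \<phi> x + x" n.radical p
    by (intro rota_baxter_pair.intro rota_baxter_pair_axioms.intro fin_dim_space_axioms
        g.lie_space_axioms n.lie_space_axioms \<phi>_lin \<phi>_hom brg rad p refl)
  show ?thesis unfolding n.semisimple_def by (rule radical_trivial)
qed

end
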